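(* Let $k$ be a field of arbitrary characteristic and let $G$ be a finite group acting linearly on a finite-dimensional $k$-vector space $V$. Let $A_t$ be a graded deformation of $A=S(V)\# G$ over $k[t]$ with multiplication maps $\mu_i$. Assume $V\otimes V$ lies in the kernel of $\mu_1$. Define ($k$-linear) parameters $\lambda: kG\otimes V\to kG$ and $\kappa: V\otimes V\to kG$ by $$\lambda(g,v)=\mu_1(g\otimes v)-\mu_1({}^gv\otimes g)\quad\text{and}\quad \kappa(v,w)=\mu_2(v\otimes w)-\mu_2(w\otimes v)$$ for all $v,w\in V$ and $g\in G$. Then the algebra $\mathcal{H}_{\lambda,\kappa}$ exhibits the PBW property and $$A_t|_{t=1}\cong\mathcal{H}_{\lambda,\kappa}.$$
   Context: Notation: $\otimes=\otimes_k$; ${}^gv$ denotes the action of $g\in G$ on $v$; $\lambda(g,v)=\lambda(g\otimes v)$ and $\kappa(v,w)=\kappa(v\otimes w)$. The skew group algebra $A=S(V)\# G$ is the vector space $S(V)\otimes kG$ with product $(r\otimes g)(s\otimes h)=r({}^gs)\otimes gh$; it is $\mathbb{N}$-graded with $V$ in degree 1 and $G$ in degree 0. A deformation of a $k$-algebra $A$ over $k[t]$ is an associative $k[t]$-algebra structure on $A[t]$ whose product $*$ is determined by $a_1*a_2=a_1a_2+\mu_1(a_1\otimes a_2)t+\mu_2(a_1\otimes a_2)t^2+\cdots$ for $a_1,a_2\in A$, where $a_1a_2$ is the product in $A$, each $\mu_j:A\otimes A\to A$ (the $j$-th multiplication map) is $k$-linear and extended $k[t]$-linearly, only finitely many terms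 are nonzero for each pair $a_1,a_2$, and $1_A$ is the multiplicative identity for $*$. If $A$ is $\mathbb{N}$-graded, the deformation is graded if each $\mu_j$ is homogeneous of degree $-j$. (In particular the formulas above for $\lambda,\kappa$ do take values in $kG$, the degree-0 part of $A$.) The fiber at $t=1$ is $A_t|_{t=1}=A_t/(t-1)A_t$. For $k$-linear $\lambda: kG\otimes V\to kG$ and alternating $k$-linear $\kappa: V\otimes V\to kG$, $\mathcal{H}_{\lambda,\kappa}$ is the associative unital $k$-algebra generated by a basis of $V$ together with the group algebra $kG$, subject to the relations in $kG$ and $vw-wv=\kappa(v,w)$, $gv-{}^gv\,g=\lambda(g,v)$ for all $v,w\in V$, $g\in G$. It is filtered by $\deg v=1$ ($v\in V$), $\deg g=0$ ($g\in G$), and exhibits the PBW property when $\mathrm{gr}(\mathcal{H}_{\lambda,\kappa})\cong S(V)\# G$ as graded algebras; equivalently, when $\{v_1^{i_1}\cdots v_m^{i_m}g: i_j\in\mathbb{Z}_{\ge 0},\ g\in G\}$ is a $k$-basis for $v_1,\dots,v_m$ any basis of $V$. *)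

theory Defs
  imports
    Complex_Main
    "HOL-Algebra.Group_Action"
    "HOL-Algebra.QuotRing"
    "HOL-Algebra.UnivPoly"
    "HOL-Library.Poly_Mapping"
begin

text \<open>
  Associative unital algebras over a field, given as a type \<^typ>\<open>'k::field\<close>, are records of type
  \<^typ>\<open>('k, 'a) module\<close>, i.e. a ring record together with a scalar multiplication. (The locale
  \<^locale>\<open>algebra\<close> of the library is restricted to commutative algebras.)
\<close>

section \<open>Algebras, quotients, gradings\<close>

definition alg_iso :: "('k, 'a, 'm) module_scheme \<Rightarrow> ('k, 'b, 'n) module_scheme \<Rightarrow> ('a \<Rightarrow> 'b) set"
  where "alg_iso A B =
    {h \<in> ring_iso A B. \<forall>c. \<forall>x \<in> carrier A. h (c \<odot>\<^bsub>A\<^esub> x) = c \<odot>\<^bsub>B\<^esub> h x}"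

definition alg_isomorphic :: "('k, 'a, 'm) module_scheme \<Rightarrow> ('k, 'b, 'n) module_scheme \<Rightarrow> bool"
  where "alg_isomorphic A B \<longleftrightarrow> alg_iso A B \<noteq> {}"

definition alg_quot :: "('k, 'a, 'm) module_scheme \<Rightarrow> 'a set \<Rightarrow> ('k, 'a set) module"
  where "alg_quot A I =
    \<lparr>carrier = carrier (A Quot I), mult = mult (A Quot I), one = one (A Quot I),
     zero = zero (A Quot I), add = add (A Quot I),
     smult = (\<lambda>c X. \<Union>x\<in>X. I +>\<^bsub>A\<^esub> (c \<odot>\<^bsub>A\<^esub> x))\<rparr>"

text \<open>In a graded algebra the component of degree \<open>d\<close> is \<open>Ad d\<close>.\<close>

definition graded_alg_isomorphic ::
    "('k, 'a, 'm) module_scheme \<Rightarrow> (nat \<Rightarrow> 'a set) \<Rightarrow>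
     ('k, 'b, 'n) module_scheme \<Rightarrow> (nat \<Rightarrow> 'b set) \<Rightarrow> bool"
  where "graded_alg_isomorphic A Ad B Bd \<longleftrightarrow> (\<exists>h \<in> alg_iso A B. \<forall>d. h ` Ad d = Bd d)"

text \<open>
  The associated graded algebra of an algebra \<open>H\<close> with an increasing filtration \<open>F\<close>: an element is
  a family, almost everywhere zero, of cosets \<open>x d \<in> F d / F (d - 1)\<close>, where \<open>F (-1) = 0\<close>.
  The operations are given by all choices of representatives, as for \<^const>\<open>FactRing\<close>.
\<close>

definition filt_below :: "('k, 'h, 'm) module_scheme \<Rightarrow> (nat \<Rightarrow> 'h set) \<Rightarrow> nat \<Rightarrow> 'h set"
  where "filt_below H F d = (if d = 0 then {\<zero>\<^bsub>H\<^esub>} else F (d - 1))"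

definition assoc_graded ::
    "('k, 'h, 'm) module_scheme \<Rightarrow> (nat \<Rightarrow> 'h set) \<Rightarrow> ('k, nat \<Rightarrow> 'h set) module"
  where "assoc_graded H F = (let L = filt_below H F in
    \<lparr>carrier = {x. (\<forall>d. \<exists>y \<in> F d. x d = L d +>\<^bsub>H\<^esub> y) \<and> finite {d. x d \<noteq> L d}},
     mult = (\<lambda>x y d. \<Union>a \<in> Pi UNIV x. \<Union>b \<in> Pi UNIV y.
               L d +>\<^bsub>H\<^esub> (\<Oplus>\<^bsub>H\<^esub>i \<in> {..d}. a i \<otimes>\<^bsub>H\<^esub> b (d - i))),
     one = (\<lambda>d. L d +>\<^bsub>H\<^esub> (if d = 0 then \<one>\<^bsub>H\<^esub> else \<zero>\<^bsub>H\<^esub>)),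
     zero = L,
     add = (\<lambda>x y d. x d <+>\<^bsub>H\<^esub> y d),
     smult = (\<lambda>c x d. \<Union>a \<in> x d. L d +>\<^bsub>H\<^esub> (c \<odot>\<^bsub>H\<^esub> a))\<rparr>)"

definition assoc_graded_component ::
    "('k, 'h, 'm) module_scheme \<Rightarrow> (nat \<Rightarrow> 'h set) \<Rightarrow> nat \<Rightarrow> (nat \<Rightarrow> 'h set) set"
  where "assoc_graded_component H F d =
    {x \<in> carrier (assoc_graded H F). \<forall>e. e \<noteq> d \<longrightarrow> x e = filt_below H F e}"


section \<open>Deformations over \<open>k[t]\<close>\<close>

text \<open>A linear map \<open>A \<otimes> A \<rightarrow> A\<close> is rendered as a bilinear map.\<close>

definition bilinear_map :: "('k, 'a, 'm) module_scheme \<Rightarrow> ('a \<Rightarrow> 'a \<Rightarrow> 'a) \<Rightarrow> bool"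
  where "bilinear_map A f \<longleftrightarrow>
    (\<forall>a \<in> carrier A. \<forall>b \<in> carrier A. f a b \<in> carrier A) \<and>
    (\<forall>a \<in> carrier A. \<forall>a' \<in> carrier A. \<forall>b \<in> carrier A.
       f (a \<oplus>\<^bsub>A\<^esub> a') b = f a b \<oplus>\<^bsub>A\<^esub> f a' b \<and>
       f b (a \<oplus>\<^bsub>A\<^esub> a') = f b a \<oplus>\<^bsub>A\<^esub> f b a') \<and>
    (\<forall>c. \<forall>a \<in> carrier A. \<forall>b \<in> carrier A.
       f (c \<odot>\<^bsub>A\<^esub> a) b = c \<odot>\<^bsub>A\<^esub> f a b \<and> f a (c \<odot>\<^bsub>A\<^esub> b) = c \<odot>\<^bsub>A\<^esub> f a b)"

text \<open>
  The \<open>k\<close>-algebra \<open>A[t]\<close> with the \<open>k[t]\<close>-bilinear product extending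
  \<open>a * b = \<mu> 0 a b + \<mu> 1 a b t + \<mu> 2 a b t\<^sup>2 + \<dots>\<close> for \<open>a, b \<in> A\<close>. As in \<^const>\<open>UP\<close>, a polynomial is
  the sequence of its coefficients; the coefficient of \<open>t\<^sup>n\<close> in \<open>p * q\<close> is the sum of
  the \<open>\<mu> l (p i) (q j)\<close> with \<open>i + j + l = n\<close>.
\<close>

definition deformed_alg ::
    "('k, 'a, 'm) module_scheme \<Rightarrow> (nat \<Rightarrow> 'a \<Rightarrow> 'a \<Rightarrow> 'a) \<Rightarrow> ('k, nat \<Rightarrow> 'a) module"
  where "deformed_alg A \<mu> =
    \<lparr>carrier = carrier (UP A),
     mult = (\<lambda>p q n. \<Oplus>\<^bsub>A\<^esub>i \<in> {..n}. \<Oplus>\<^bsub>A\<^esub>j \<in> {..n - i}. \<mu> (n - i - j) (p i) (q j)),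
     one = \<one>\<^bsub>UP A\<^esub>, zero = \<zero>\<^bsub>UP A\<^esub>, add = add (UP A),
     smult = (\<lambda>c p n. c \<odot>\<^bsub>A\<^esub> p n)\<rparr>"

definition deformation :: "('k, 'a, 'm) module_scheme \<Rightarrow> (nat \<Rightarrow> 'a \<Rightarrow> 'a \<Rightarrow> 'a) \<Rightarrow> bool"
  where "deformation A \<mu> \<longleftrightarrow>
    (\<forall>j. bilinear_map A (\<mu> j)) \<and>
    (\<forall>a \<in> carrier A. \<forall>b \<in> carrier A. \<mu> 0 a b = a \<otimes>\<^bsub>A\<^esub> b) \<and>
    (\<forall>a \<in> carrier A. \<forall>b \<in> carrier A. finite {j. \<mu> j a b \<noteq> \<zero>\<^bsub>A\<^esub>}) \<and>
    ring (deformed_alg A \<mu>)"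

definition graded_deformation ::
    "('k, 'a, 'm) module_scheme \<Rightarrow> (nat \<Rightarrow> 'a set) \<Rightarrow> (nat \<Rightarrow> 'a \<Rightarrow> 'a \<Rightarrow> 'a) \<Rightarrow> bool"
  where "graded_deformation A Ad \<mu> \<longleftrightarrow> deformation A \<mu> \<and>
    (\<forall>j m n. \<forall>a \<in> Ad m. \<forall>b \<in> Ad n.
       if j \<le> m + n then \<mu> j a b \<in> Ad (m + n - j) else \<mu> j a b = \<zero>\<^bsub>A\<^esub>)"

definition t_minus_one :: "('k, 'a, 'm) module_scheme \<Rightarrow> nat \<Rightarrow> 'a"
  where "t_minus_one A = monom (UP A) \<one>\<^bsub>A\<^esub> 1 \<ominus>\<^bsub>UP A\<^esub> \<one>\<^bsub>UP A\<^esub>"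

definition fiber_at_one ::
    "('k, 'a, 'm) module_scheme \<Rightarrow> (nat \<Rightarrow> 'a \<Rightarrow> 'a \<Rightarrow> 'a) \<Rightarrow> ('k, (nat \<Rightarrow> 'a) set) module"
  where "fiber_at_one A \<mu> = (let At = deformed_alg A \<mu> in
    alg_quot At {t_minus_one A \<otimes>\<^bsub>At\<^esub> p | p. p \<in> carrier At})"


section \<open>The skew group algebra\<close>

definition pm_scale :: "'k::semiring_0 \<Rightarrow> ('x \<Rightarrow>\<^sub>0 'k) \<Rightarrow> 'x \<Rightarrow>\<^sub>0 'k"
  where "pm_scale c p = Poly_Mapping.map ((*) c) p"

text \<open>
  \<open>S(V)\<close> is the polynomial algebra whose indeterminates are the elements of a basis of \<open>V\<close>.
\<close>

type_synonym ('v, 'k) sym = "('v \<Rightarrow>\<^sub>0 nat) \<Rightarrow>\<^sub>0 'k"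

definition sym_carrier :: "'v set \<Rightarrow> ('v, 'k::field) sym set"
  where "sym_carrier Basis = {p. \<forall>m \<in> Poly_Mapping.keys p. Poly_Mapping.keys m \<subseteq> Basis}"

definition sym_vec ::
    "('k::field \<Rightarrow> 'v::ab_group_add \<Rightarrow> 'v) \<Rightarrow> 'v set \<Rightarrow> 'v \<Rightarrow> ('v, 'k) sym"
  where "sym_vec scale Basis v =
    (\<Sum>b\<in>Basis. Poly_Mapping.single (Poly_Mapping.single b 1) (module.representation scale Basis v b))"

definition mon_degree :: "('v \<Rightarrow>\<^sub>0 nat) \<Rightarrow> nat"
  where "mon_degree m = (\<Sum>b \<in> Poly_Mapping.keys m. Poly_Mapping.lookup m b)"

text \<open>The algebra endomorphism of \<open>S(V)\<close> induced by a linear endomorphism of \<open>V\<close>.\<close>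

definition sym_map ::
    "('k::field \<Rightarrow> 'v::ab_group_add \<Rightarrow> 'v) \<Rightarrow> 'v set \<Rightarrow> ('v \<Rightarrow> 'v) \<Rightarrow> ('v, 'k) sym \<Rightarrow> ('v, 'k) sym"
  where "sym_map scale Basis f p =
    (\<Sum>m \<in> Poly_Mapping.keys p. pm_scale (Poly_Mapping.lookup p m)
       (\<Prod>b \<in> Poly_Mapping.keys m. sym_vec scale Basis (f b) ^ Poly_Mapping.lookup m b))"

text \<open>
  \<open>S(V) # G\<close>: the element \<open>\<Sum>\<^sub>g r\<^sub>g \<otimes> g\<close> of \<open>S(V) \<otimes> kG\<close> is the finitely supported function \<open>g \<mapsto> r\<^sub>g\<close>.
\<close>

type_synonym ('g, 'v, 'k) skew = "'g \<Rightarrow>\<^sub>0 ('v, 'k) sym"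

definition skew_group_alg ::
    "('g, 'x) monoid_scheme \<Rightarrow> ('k::field \<Rightarrow> 'v::ab_group_add \<Rightarrow> 'v) \<Rightarrow> 'v set \<Rightarrow> ('g \<Rightarrow> 'v \<Rightarrow> 'v) \<Rightarrow>
     ('k, ('g, 'v, 'k) skew) module"
  where "skew_group_alg G scale Basis \<rho> =
    \<lparr>carrier = {a. Poly_Mapping.keys a \<subseteq> carrier G \<and>
                   (\<forall>g. Poly_Mapping.lookup a g \<in> sym_carrier Basis)},
     mult = (\<lambda>a b. \<Sum>g \<in> Poly_Mapping.keys a. \<Sum>h \<in> Poly_Mapping.keys b.
               Poly_Mapping.single (g \<otimes>\<^bsub>G\<^esub> h)
                 (Poly_Mapping.lookup a g * sym_map scale Basis (\<rho> g) (Poly_Mapping.lookup b h))),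
     one = Poly_Mapping.single \<one>\<^bsub>G\<^esub> 1, zero = 0, add = (+),
     smult = (\<lambda>c. Poly_Mapping.map (pm_scale c))\<rparr>"

definition skew_component ::
    "('g, 'x) monoid_scheme \<Rightarrow> 'v set \<Rightarrow> nat \<Rightarrow> ('g, 'v, 'k::field) skew set"
  where "skew_component G Basis d =
    {a. Poly_Mapping.keys a \<subseteq> carrier G \<and>
        (\<forall>g. Poly_Mapping.lookup a g \<in> sym_carrier Basis \<and>
             (\<forall>m \<in> Poly_Mapping.keys (Poly_Mapping.lookup a g). mon_degree m = d))}"

definition group_alg_carrier :: "('g, 'x) monoid_scheme \<Rightarrow> ('g \<Rightarrow>\<^sub>0 'k::field) set"
  where "group_alg_carrier G = {a. Poly_Mapping.keys a \<subseteq> carrier G}"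

text \<open>The inclusions of \<open>kG\<close> and of \<open>V\<close> into \<open>S(V) # G\<close>.\<close>

definition skew_of_group_alg :: "('g \<Rightarrow>\<^sub>0 'k::field) \<Rightarrow> ('g, 'v, 'k) skew"
  where "skew_of_group_alg = Poly_Mapping.map (Poly_Mapping.single 0)"

definition skew_vec ::
    "('g, 'x) monoid_scheme \<Rightarrow> ('k::field \<Rightarrow> 'v::ab_group_add \<Rightarrow> 'v) \<Rightarrow> 'v set \<Rightarrow> 'v \<Rightarrow>
     ('g, 'v, 'k) skew"
  where "skew_vec G scale Basis v = Poly_Mapping.single \<one>\<^bsub>G\<^esub> (sym_vec scale Basis v)"

definition group_elt :: "'g \<Rightarrow> 'g \<Rightarrow>\<^sub>0 'k::field"
  where "group_elt g = Poly_Mapping.single g 1"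


section \<open>The algebra \<open>H\<^sub>\<lambda>\<^sub>,\<^sub>\<kappa>\<close>\<close>

text \<open>
  Finite words form a monoid under concatenation, written additively because the convolution
  product of \<^theory>\<open>HOL-Library.Poly_Mapping\<close> is based on addition of exponents. Hence
  \<open>'x word \<Rightarrow>\<^sub>0 'k\<close> is the free associative algebra on \<open>'x\<close>.
\<close>

datatype 'x word = Word (letters: "'x list")

instantiation word :: (type) monoid_add
begin

definition "0 = Word []"

definition "u + v = Word (letters u @ letters v)"

instance
  by standard (simp_all add: zero_word_def plus_word_def)

end

definition free_alg :: "'x set \<Rightarrow> ('k::field, 'x word \<Rightarrow>\<^sub>0 'k) module"
  where "free_alg X =
    \<lparr>carrier = {p. \<forall>w \<in> Poly_Mapping.keys p. set (letters w) \<subseteq> X},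
     mult = (*), one = 1, zero = 0, add = (+), smult = pm_scale\<rparr>"

text \<open>The generators are the elements of a basis of \<open>V\<close> (\<^const>\<open>Inl\<close>) and of \<open>G\<close> (\<^const>\<open>Inr\<close>).\<close>

type_synonym ('g, 'v, 'k) free_VG = "('v + 'g) word \<Rightarrow>\<^sub>0 'k"

definition free_group_alg :: "('g \<Rightarrow>\<^sub>0 'k::field) \<Rightarrow> ('g, 'v, 'k) free_VG"
  where "free_group_alg a =
    (\<Sum>g \<in> Poly_Mapping.keys a. Poly_Mapping.single (Word [Inr g]) (Poly_Mapping.lookup a g))"

definition free_vec ::
    "('k::field \<Rightarrow> 'v::ab_group_add \<Rightarrow> 'v) \<Rightarrow> 'v set \<Rightarrow> 'v \<Rightarrow> ('g, 'v, 'k) free_VG"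
  where "free_vec scale Basis v =
    (\<Sum>b\<in>Basis. Poly_Mapping.single (Word [Inl b]) (module.representation scale Basis v b))"

definition H_relations ::
    "('g, 'x) monoid_scheme \<Rightarrow> ('k::field \<Rightarrow> 'v::ab_group_add \<Rightarrow> 'v) \<Rightarrow> 'v set \<Rightarrow> ('g \<Rightarrow> 'v \<Rightarrow> 'v) \<Rightarrow>
     (('g \<Rightarrow>\<^sub>0 'k) \<Rightarrow> 'v \<Rightarrow> ('g \<Rightarrow>\<^sub>0 'k)) \<Rightarrow> ('v \<Rightarrow> 'v \<Rightarrow> ('g \<Rightarrow>\<^sub>0 'k)) \<Rightarrow> ('g, 'v, 'k) free_VG set"
  where "H_relations G scale Basis \<rho> lam kap =
    (let gr = (\<lambda>g. free_group_alg (group_elt g)); vec = free_vec scale Basis in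
       {gr \<one>\<^bsub>G\<^esub> - 1}
     \<union> {gr g * gr h - gr (g \<otimes>\<^bsub>G\<^esub> h) | g h. g \<in> carrier G \<and> h \<in> carrier G}
     \<union> {vec v * vec w - vec w * vec v - free_group_alg (kap v w) | v w. True}
     \<union> {gr g * vec v - vec (\<rho> g v) * gr g - free_group_alg (lam (group_elt g) v)
          | g v. g \<in> carrier G})"

definition H_ideal ::
    "('g, 'x) monoid_scheme \<Rightarrow> ('k::field \<Rightarrow> 'v::ab_group_add \<Rightarrow> 'v) \<Rightarrow> 'v set \<Rightarrow> ('g \<Rightarrow> 'v \<Rightarrow> 'v) \<Rightarrow>
     (('g \<Rightarrow>\<^sub>0 'k) \<Rightarrow> 'v \<Rightarrow> ('g \<Rightarrow>\<^sub>0 'k)) \<Rightarrow> ('v \<Rightarrow> 'v \<Rightarrow> ('g \<Rightarrow>\<^sub>0 'k)) \<Rightarrow> ('g, 'v, 'k) free_VG set"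
  where "H_ideal G scale Basis \<rho> lam kap =
    genideal (free_alg (Basis <+> carrier G) :: ('k, ('g, 'v, 'k) free_VG) module)
      (H_relations G scale Basis \<rho> lam kap)"

definition H_alg ::
    "('g, 'x) monoid_scheme \<Rightarrow> ('k::field \<Rightarrow> 'v::ab_group_add \<Rightarrow> 'v) \<Rightarrow> 'v set \<Rightarrow> ('g \<Rightarrow> 'v \<Rightarrow> 'v) \<Rightarrow>
     (('g \<Rightarrow>\<^sub>0 'k) \<Rightarrow> 'v \<Rightarrow> ('g \<Rightarrow>\<^sub>0 'k)) \<Rightarrow> ('v \<Rightarrow> 'v \<Rightarrow> ('g \<Rightarrow>\<^sub>0 'k)) \<Rightarrow>
     ('k, ('g, 'v, 'k) free_VG set) module"
  where "H_alg G scale Basis \<rho> lam kap =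
    alg_quot (free_alg (Basis <+> carrier G)) (H_ideal G scale Basis \<rho> lam kap)"

text \<open>The filtration given by \<open>deg v = 1\<close> and \<open>deg g = 0\<close>.\<close>

definition vec_degree :: "('v + 'g) word \<Rightarrow> nat"
  where "vec_degree w = length (filter isl (letters w))"

definition H_filtration ::
    "('g, 'x) monoid_scheme \<Rightarrow> ('k::field \<Rightarrow> 'v::ab_group_add \<Rightarrow> 'v) \<Rightarrow> 'v set \<Rightarrow> ('g \<Rightarrow> 'v \<Rightarrow> 'v) \<Rightarrow>
     (('g \<Rightarrow>\<^sub>0 'k) \<Rightarrow> 'v \<Rightarrow> ('g \<Rightarrow>\<^sub>0 'k)) \<Rightarrow> ('v \<Rightarrow> 'v \<Rightarrow> ('g \<Rightarrow>\<^sub>0 'k)) \<Rightarrow>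
     nat \<Rightarrow> ('g, 'v, 'k) free_VG set set"
  where "H_filtration G scale Basis \<rho> lam kap d =
    (let F = free_alg (Basis <+> carrier G) in
     (\<lambda>p. H_ideal G scale Basis \<rho> lam kap +>\<^bsub>F\<^esub> p) `
       {p \<in> carrier F. \<forall>w \<in> Poly_Mapping.keys p. vec_degree w \<le> d})"

definition exhibits_PBW ::
    "('g, 'x) monoid_scheme \<Rightarrow> ('k::field \<Rightarrow> 'v::ab_group_add \<Rightarrow> 'v) \<Rightarrow> 'v set \<Rightarrow> ('g \<Rightarrow> 'v \<Rightarrow> 'v) \<Rightarrow>
     (('g \<Rightarrow>\<^sub>0 'k) \<Rightarrow> 'v \<Rightarrow> ('g \<Rightarrow>\<^sub>0 'k)) \<Rightarrow> ('v \<Rightarrow> 'v \<Rightarrow> ('g \<Rightarrow>\<^sub>0 'k)) \<Rightarrow> bool"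
  where "exhibits_PBW G scale Basis \<rho> lam kap =
    (let H = H_alg G scale Basis \<rho> lam kap; F = H_filtration G scale Basis \<rho> lam kap in
     graded_alg_isomorphic (assoc_graded H F) (assoc_graded_component H F)
       (skew_group_alg G scale Basis \<rho>) (skew_component G Basis))"

text \<open>
  The parameters: \<open>\<lambda> : kG \<otimes> V \<rightarrow> kG\<close> linear and \<open>\<kappa> : V \<otimes> V \<rightarrow> kG\<close> linear and alternating.
\<close>

definition H_parameters ::
    "('g, 'x) monoid_scheme \<Rightarrow> ('k::field \<Rightarrow> 'v::ab_group_add \<Rightarrow> 'v) \<Rightarrow>
     (('g \<Rightarrow>\<^sub>0 'k) \<Rightarrow> 'v \<Rightarrow> ('g \<Rightarrow>\<^sub>0 'k)) \<Rightarrow> ('v \<Rightarrow> 'v \<Rightarrow> ('g \<Rightarrow>\<^sub>0 'k)) \<Rightarrow> bool"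
  where "H_parameters G scale lam kap \<longleftrightarrow>
    (\<forall>a \<in> group_alg_carrier G. \<forall>b \<in> group_alg_carrier G. \<forall>v w c.
       lam a v \<in> group_alg_carrier G \<and>
       lam (a + b) v = lam a v + lam b v \<and>
       lam (pm_scale c a) v = pm_scale c (lam a v) \<and>
       lam a (v + w) = lam a v + lam a w \<and>
       lam a (scale c v) = pm_scale c (lam a v)) \<and>
    (\<forall>u v w c.
       kap v w \<in> group_alg_carrier G \<and>
       kap (u + v) w = kap u w + kap v w \<and>
       kap (scale c v) w = pm_scale c (kap v w) \<and>
       kap u (v + w) = kap u v + kap u w \<and>
       kap v (scale c w) = pm_scale c (kap v w) \<and>
       kap v v = 0)"

text \<open>
  The formulas by which a graded deformation defines \<open>\<lambda>\<close> and \<open>\<kappa>\<close> are equations in \<open>S(V) # G\<close>, and the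
  one for \<open>\<lambda>\<close> is for group elements. They determine \<open>\<lambda>\<close> on \<open>kG \<otimes> V\<close> and \<open>\<kappa>\<close>, since
  \<^const>\<open>skew_of_group_alg\<close> is injective; that such parameters exist is shown next.
\<close>

lemma lookup_pm_scale: "Poly_Mapping.lookup (pm_scale c p) x = c * Poly_Mapping.lookup p x"
  by (simp add: pm_scale_def Poly_Mapping.map.rep_eq when_def)

lemma pm_scale_add_right: "pm_scale c (p + q) = pm_scale c p + pm_scale c q"
  by (rule poly_mapping_eqI) (simp add: lookup_pm_scale lookup_add distrib_left)

lemma pm_scale_zero_right: "pm_scale c 0 = 0"
  by (rule poly_mapping_eqI) (simp add: lookup_pm_scale)

lemma pm_scale_sum: "pm_scale c (sum f I) = (\<Sum>i\<in>I. pm_scale c (f i))"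
  by (induction I rule: infinite_finite_induct) (simp_all add: pm_scale_zero_right pm_scale_add_right)

lemma lookup_skew_scale:
  "Poly_Mapping.lookup (Poly_Mapping.map (pm_scale c) a) g = pm_scale c (Poly_Mapping.lookup a g)"
  by (simp add: Poly_Mapping.map.rep_eq when_def pm_scale_zero_right)

lemma lookup_skew_of_group_alg:
  "Poly_Mapping.lookup (skew_of_group_alg a) g = Poly_Mapping.single 0 (Poly_Mapping.lookup a g)"
  by (simp add: skew_of_group_alg_def Poly_Mapping.map.rep_eq when_def)

lemma keys_subset_iff: "Poly_Mapping.keys p \<subseteq> S \<longleftrightarrow> (\<forall>x. x \<notin> S \<longrightarrow> Poly_Mapping.lookup p x = 0)"
  by (auto simp: in_keys_iff)

lemma mon_degree_eq_0_iff: "mon_degree m = 0 \<longleftrightarrow> m = 0"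
proof
  assume "mon_degree m = 0"
  then have "\<forall>b \<in> Poly_Mapping.keys m. Poly_Mapping.lookup m b = 0"
    by (simp add: mon_degree_def)
  then have "Poly_Mapping.lookup m b = 0" for b
    by (cases "b \<in> Poly_Mapping.keys m") (auto simp: in_keys_iff)
  then show "m = 0" by (intro poly_mapping_eqI) simp
qed (simp add: mon_degree_def)

definition group_alg_part :: "('g, 'v, 'k::field) skew \<Rightarrow> 'g \<Rightarrow>\<^sub>0 'k"
  where "group_alg_part = Poly_Mapping.map (\<lambda>p. Poly_Mapping.lookup p 0)"

lemma lookup_group_alg_part:
  "Poly_Mapping.lookup (group_alg_part x) g = Poly_Mapping.lookup (Poly_Mapping.lookup x g) 0"
  by (simp add: group_alg_part_def Poly_Mapping.map.rep_eq when_def)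

lemma group_alg_part_add: "group_alg_part (x + y) = group_alg_part x + group_alg_part y"
  by (rule poly_mapping_eqI) (simp add: lookup_group_alg_part lookup_add)

lemma group_alg_part_diff: "group_alg_part (x - y) = group_alg_part x - group_alg_part y"
  by (rule poly_mapping_eqI) (simp add: lookup_group_alg_part lookup_minus)

lemma group_alg_part_scale:
  "group_alg_part (Poly_Mapping.map (pm_scale c) x) = pm_scale c (group_alg_part x)"
  by (rule poly_mapping_eqI) (simp add: lookup_group_alg_part lookup_skew_scale lookup_pm_scale)

lemma group_alg_part_closed:
  "x \<in> skew_component G Basis d \<Longrightarrow> group_alg_part x \<in> group_alg_carrier G"
  unfolding skew_component_def group_alg_carrier_def mem_Collect_eq keys_subset_iff
  by (simp add: lookup_group_alg_part)

lemma skew_of_group_alg_part: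
  assumes "x \<in> skew_component G Basis 0"
  shows "skew_of_group_alg (group_alg_part x) = x"
proof (rule poly_mapping_eqI)
  fix g
  have "m = 0" if "Poly_Mapping.lookup (Poly_Mapping.lookup x g) m \<noteq> 0" for m
    using assms that by (auto simp: skew_component_def mon_degree_eq_0_iff in_keys_iff)
  then show "Poly_Mapping.lookup (skew_of_group_alg (group_alg_part x)) g = Poly_Mapping.lookup x g"
    by (intro poly_mapping_eqI)
      (auto simp: lookup_skew_of_group_alg lookup_group_alg_part lookup_single when_def)
qed

lemma skew_component_diff:
  assumes "x \<in> skew_component G Basis d" "y \<in> skew_component G Basis d"
  shows "x - y \<in> skew_component G Basis d"
proof -
  have "m \<in> Poly_Mapping.keys (Poly_Mapping.lookup x g) \<union> Poly_Mapping.keys (Poly_Mapping.lookup y g)"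
    if "m \<in> Poly_Mapping.keys (Poly_Mapping.lookup (x - y) g)" for g m
    using that by (auto simp: lookup_minus in_keys_iff)
  moreover have "g \<in> Poly_Mapping.keys x \<union> Poly_Mapping.keys y" if "g \<in> Poly_Mapping.keys (x - y)" for g
    using that by (auto simp: lookup_minus in_keys_iff)
  ultimately show ?thesis
    using assms unfolding skew_component_def sym_carrier_def by blast
qed

lemma skew_component_subset:
  "skew_component G Basis d \<subseteq> carrier (skew_group_alg G scale Basis \<rho>)"
  by (auto simp: skew_component_def skew_group_alg_def)

lemma (in group) group_elt_component:
  assumes "g \<in> carrier G"
  shows "skew_of_group_alg (group_elt g) \<in> skew_component G Basis 0"
  using assms unfolding skew_component_def sym_carrier_def mem_Collect_eq keys_subset_iff
  by (auto simp: lookup_skew_of_group_alg group_elt_def lookup_single when_def mon_degree_eq_0_iff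
      split: if_splits)

lemma keys_sum_subset:
  assumes "\<And>i. i \<in> I \<Longrightarrow> Poly_Mapping.keys (f i) \<subseteq> S"
  shows "Poly_Mapping.keys (sum f I) \<subseteq> S"
  using keys_sum[of f I] assms by blast

lemma (in group) skew_vec_component: "skew_vec G scale Basis v \<in> skew_component G Basis 1"
proof -
  have "Poly_Mapping.keys (sym_vec scale Basis v) \<subseteq> (\<lambda>b. Poly_Mapping.single b 1) ` Basis"
    unfolding sym_vec_def by (rule keys_sum_subset) auto
  then have "Poly_Mapping.keys m \<subseteq> Basis \<and> mon_degree m = 1"
    if "m \<in> Poly_Mapping.keys (sym_vec scale Basis v)" for m
    using that by (auto simp: mon_degree_def)
  then show ?thesis
    by (auto simp: skew_component_def sym_carrier_def skew_vec_def lookup_single when_def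
        split: if_splits)
qed

lemma (in finite_dimensional_vector_space) sym_vec_add:
  "sym_vec scale Basis (v + w) = sym_vec scale Basis v + sym_vec scale Basis w"
  by (simp add: sym_vec_def representation_add independent_Basis span_Basis single_add sum.distrib)

lemma (in finite_dimensional_vector_space) sym_vec_scale:
  "sym_vec scale Basis (scale c v) = pm_scale c (sym_vec scale Basis v)"
  unfolding sym_vec_def pm_scale_sum
  by (rule sum.cong, simp, rule poly_mapping_eqI)
    (simp add: representation_scale independent_Basis span_Basis lookup_pm_scale lookup_single when_def)

lemma (in finite_dimensional_vector_space) skew_vec_add:
  "skew_vec G scale Basis (v + w) = skew_vec G scale Basis v + skew_vec G scale Basis w"
  by (simp add: skew_vec_def sym_vec_add single_add)

lemma (in finite_dimensional_vector_space) skew_vec_scale: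
  "skew_vec G scale Basis (scale c v) = Poly_Mapping.map (pm_scale c) (skew_vec G scale Basis v)"
  unfolding skew_vec_def sym_vec_scale
  by (rule poly_mapping_eqI) (simp add: lookup_skew_scale lookup_single when_def pm_scale_zero_right)

lemma bilinear_mapD:
  assumes "bilinear_map A f"
  shows "\<lbrakk>a \<in> carrier A; a' \<in> carrier A; b \<in> carrier A\<rbrakk> \<Longrightarrow> f (a \<oplus>\<^bsub>A\<^esub> a') b = f a b \<oplus>\<^bsub>A\<^esub> f a' b"
    and "\<lbrakk>a \<in> carrier A; a' \<in> carrier A; b \<in> carrier A\<rbrakk> \<Longrightarrow> f b (a \<oplus>\<^bsub>A\<^esub> a') = f b a \<oplus>\<^bsub>A\<^esub> f b a'"
    and "\<lbrakk>a \<in> carrier A; b \<in> carrier A\<rbrakk> \<Longrightarrow> f (c \<odot>\<^bsub>A\<^esub> a) b = c \<odot>\<^bsub>A\<^esub> f a b"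
    and "\<lbrakk>a \<in> carrier A; b \<in> carrier A\<rbrakk> \<Longrightarrow> f a (c \<odot>\<^bsub>A\<^esub> b) = c \<odot>\<^bsub>A\<^esub> f a b"
  using assms by (simp_all add: bilinear_map_def)

lemma deformation_parameters_exist:
  fixes scale :: "'k::field \<Rightarrow> 'v::ab_group_add \<Rightarrow> 'v" and Basis :: "'v set" and G :: "'g monoid"
  assumes V: "finite_dimensional_vector_space scale Basis"
    and G: "group G" "finite (carrier G)"
    and \<rho>: "\<And>g. g \<in> carrier G \<Longrightarrow> Vector_Spaces.linear scale scale (\<rho> g)"
    and \<mu>: "graded_deformation (skew_group_alg G scale Basis \<rho>) (skew_component G Basis) \<mu>"
  shows "\<exists>lam kap. H_parameters G scale lam kap \<and>
    (\<forall>g v. g \<in> carrier G \<longrightarrow> skew_of_group_alg (lam (group_elt g) v) =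
       \<mu> 1 (skew_of_group_alg (group_elt g)) (skew_vec G scale Basis v) -
       \<mu> 1 (skew_vec G scale Basis (\<rho> g v)) (skew_of_group_alg (group_elt g))) \<and>
    (\<forall>v w. skew_of_group_alg (kap v w) =
       \<mu> 2 (skew_vec G scale Basis v) (skew_vec G scale Basis w) -
       \<mu> 2 (skew_vec G scale Basis w) (skew_vec G scale Basis v))"
proof -
  interpret V: finite_dimensional_vector_space scale Basis by fact
  interpret G: group G by fact
  let ?A = "skew_group_alg G scale Basis \<rho>"
  let ?g = "\<lambda>g. skew_of_group_alg (group_elt g) :: ('g, 'v, 'k) skew"
  let ?v = "skew_vec G scale Basis"
  have bil: "bilinear_map ?A (\<mu> j)" for j
    using \<mu> by (simp add: graded_deformation_def deformation_def)
  have comp: "\<mu> j a b \<in> skew_component G Basis 0"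
    if "a \<in> skew_component G Basis m" "b \<in> skew_component G Basis n" "m + n = j" for j m n a b
  proof -
    have "if j \<le> m + n then \<mu> j a b \<in> skew_component G Basis (m + n - j) else \<mu> j a b = \<zero>\<^bsub>?A\<^esub>"
      using \<mu> that(1,2) unfolding graded_deformation_def by blast
    then show ?thesis using that(3) by simp
  qed
  have gA: "?g g \<in> carrier ?A" if "g \<in> carrier G" for g
    using G.group_elt_component[OF that] skew_component_subset by blast
  have vA: "?v v \<in> carrier ?A" for v
    using G.skew_vec_component skew_component_subset by blast
  have add: "\<mu> j (a + a') b = \<mu> j a b + \<mu> j a' b" "\<mu> j b (a + a') = \<mu> j b a + \<mu> j b a'"
    if "a \<in> carrier ?A" "a' \<in> carrier ?A" "b \<in> carrier ?A" for j a a' b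
  proof -
    have "add ?A = (+)" by (simp add: skew_group_alg_def)
    then show "\<mu> j (a + a') b = \<mu> j a b + \<mu> j a' b" "\<mu> j b (a + a') = \<mu> j b a + \<mu> j b a'"
      using bil[THEN bilinear_mapD(1), OF that] bil[THEN bilinear_mapD(2), OF that] by simp_all
  qed
  have scl: "\<mu> j (Poly_Mapping.map (pm_scale c) a) b = Poly_Mapping.map (pm_scale c) (\<mu> j a b)"
    "\<mu> j a (Poly_Mapping.map (pm_scale c) b) = Poly_Mapping.map (pm_scale c) (\<mu> j a b)"
    if "a \<in> carrier ?A" "b \<in> carrier ?A" for j a b c
  proof -
    have "smult ?A = (\<lambda>c. Poly_Mapping.map (pm_scale c))" by (simp add: skew_group_alg_def)
    then show "\<mu> j (Poly_Mapping.map (pm_scale c) a) b = Poly_Mapping.map (pm_scale c) (\<mu> j a b)"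
      "\<mu> j a (Poly_Mapping.map (pm_scale c) b) = Poly_Mapping.map (pm_scale c) (\<mu> j a b)"
      using bil[THEN bilinear_mapD(3), OF that] bil[THEN bilinear_mapD(4), OF that] by simp_all
  qed
  define f where "f g v = \<mu> 1 (?g g) (?v v) - \<mu> 1 (?v (\<rho> g v)) (?g g)" for g v
  define h where "h v w = \<mu> 2 (?v v) (?v w) - \<mu> 2 (?v w) (?v v)" for v w
  have f0: "f g v \<in> skew_component G Basis 0" if "g \<in> carrier G" for g v
    unfolding f_def
    by (intro skew_component_diff comp[OF G.group_elt_component[OF that] G.skew_vec_component]
        comp[OF G.skew_vec_component G.group_elt_component[OF that]]) simp_all
  have h0: "h v w \<in> skew_component G Basis 0" for v w
    unfolding h_def
    by (intro skew_component_diff comp[OF G.skew_vec_component G.skew_vec_component]) simp_all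
  have fl: "group_alg_part (f g (v + w)) = group_alg_part (f g v) + group_alg_part (f g w)"
    "group_alg_part (f g (scale c v)) = pm_scale c (group_alg_part (f g v))"
    if g: "g \<in> carrier G" for g v w c
  proof -
    interpret lin: Vector_Spaces.linear scale scale "\<rho> g" by (rule \<rho>[OF g])
    show "group_alg_part (f g (v + w)) = group_alg_part (f g v) + group_alg_part (f g w)"
      unfolding f_def by (simp add: lin.add V.skew_vec_add add vA gA[OF g] group_alg_part_add group_alg_part_diff)
    show "group_alg_part (f g (scale c v)) = pm_scale c (group_alg_part (f g v))"
      unfolding f_def
      by (simp add: lin.scale V.skew_vec_scale scl vA gA[OF g] group_alg_part_scale group_alg_part_diff)
        (rule poly_mapping_eqI, simp add: lookup_pm_scale lookup_minus right_diff_distrib)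
  qed
  have hl: "group_alg_part (h (u + v) w) = group_alg_part (h u w) + group_alg_part (h v w)"
    "group_alg_part (h w (u + v)) = group_alg_part (h w u) + group_alg_part (h w v)"
    "group_alg_part (h (scale c v) w) = pm_scale c (group_alg_part (h v w))"
    "group_alg_part (h w (scale c v)) = pm_scale c (group_alg_part (h w v))" for u v w c
    unfolding h_def
    by (simp_all add: V.skew_vec_add V.skew_vec_scale add scl vA group_alg_part_add
        group_alg_part_diff group_alg_part_scale)
      (rule poly_mapping_eqI, simp add: lookup_pm_scale lookup_minus right_diff_distrib)+
  define lam :: "('g \<Rightarrow>\<^sub>0 'k) \<Rightarrow> 'v \<Rightarrow> ('g \<Rightarrow>\<^sub>0 'k)" where
    "lam a v = (\<Sum>g\<in>carrier G. pm_scale (Poly_Mapping.lookup a g) (group_alg_part (f g v)))" for a v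
  define kap where "kap v w = group_alg_part (h v w)" for v w
  have lookup_lam: "Poly_Mapping.lookup (lam a v) x =
      (\<Sum>g\<in>carrier G. Poly_Mapping.lookup a g * Poly_Mapping.lookup (group_alg_part (f g v)) x)" for a v x
    by (simp add: lam_def lookup_sum lookup_pm_scale)
  have lam_elt: "lam (group_elt g) v = group_alg_part (f g v)" if "g \<in> carrier G" for g v
    using that G(2)
    by (intro poly_mapping_eqI) (simp add: lookup_lam group_elt_def lookup_single when_def if_distrib
        if_distribR sum.delta cong: if_cong)
  have "lam a v \<in> group_alg_carrier G" for a v
    using group_alg_part_closed[OF f0] unfolding group_alg_carrier_def mem_Collect_eq keys_subset_iff
    by (simp add: lookup_lam)
  moreover have "lam (a + b) v = lam a v + lam b v" for a b v
    by (rule poly_mapping_eqI) (simp add: lookup_lam lookup_add distrib_right sum.distrib)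
  moreover have "lam (pm_scale c a) v = pm_scale c (lam a v)" for a v c
    by (rule poly_mapping_eqI) (simp add: lookup_lam lookup_pm_scale sum_distrib_left mult.assoc)
  moreover have "lam a (v + w) = lam a v + lam a w" for a v w
    by (rule poly_mapping_eqI) (simp add: lookup_lam lookup_add fl distrib_left sum.distrib)
  moreover have "lam a (scale c v) = pm_scale c (lam a v)" for a v c
    by (rule poly_mapping_eqI)
      (simp add: lookup_lam lookup_pm_scale fl sum_distrib_left mult.left_commute)
  moreover have "kap v w \<in> group_alg_carrier G" for v w
    unfolding kap_def by (rule group_alg_part_closed[OF h0])
  moreover have "kap v v = 0" for v
    by (simp add: kap_def h_def) (rule poly_mapping_eqI, simp add: lookup_group_alg_part)
  ultimately have "H_parameters G scale lam kap"
    unfolding H_parameters_def by (simp add: hl kap_def)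
  moreover have "skew_of_group_alg (lam (group_elt g) v) = f g v" if "g \<in> carrier G" for g v
    by (simp add: lam_elt[OF that] skew_of_group_alg_part[OF f0[OF that]])
  moreover have "skew_of_group_alg (kap v w) = h v w" for v w
    by (simp add: kap_def skew_of_group_alg_part[OF h0])
  ultimately show ?thesis unfolding f_def h_def by blast
qed

end

theory Submission
  imports Defs "HOL-Library.Multiset"
begin

hide_const (open) Multiset.mult

text \<open>
  Evaluation at \<open>t = 1\<close> identifies the fiber with \<open>B\<close>, the space \<open>A\<close> with the product
  \<open>a \<circ> b = a b + \<mu> 1 a b + \<mu> 2 a b + \<dots>\<close>. Since \<open>\<mu> j\<close> lowers the degree by \<open>j\<close>, products in \<open>B\<close> and
  in \<open>A\<close> have the same leading terms, and the sum stops early on generators, so that they satisfy the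
  relations of \<open>H\<close> in \<open>B\<close>. This gives a filtered homomorphism \<open>H \<rightarrow> B\<close>. The relations reduce every
  word to a combination of monomials \<open>v\<^sub>1\<dots>v\<^sub>n g\<close> modulo lower degree, and the leading terms of the images
  of these monomials form a basis of \<open>A\<close>. Hence \<open>H \<rightarrow> B\<close> is an isomorphism and \<open>A\<close> is the associated
  graded algebra of \<open>H\<close>. Associativity is never checked: it is inherited from the deformation.
\<close>

subsection \<open>Algebras\<close>

text \<open>A presentation bounds \<open>H\<close> only from above; proving directly that nothing
  collapses would mean resolving every overlap between the relations. The lower bound comes instead
  from the model \<open>B\<close>, so rewriting serves only to show spanning, and only modulo words
  of smaller degree: the degree is the only termination measure. The hypothesis on
  \<open>\<mu> 1\<close> is a matter of degrees. \<open>\<mu> 1 v w\<close> has degree 1, so an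
  antisymmetric part of it would put terms of degree 1 into the commutator of two vectors, where the
  relations of \<open>H\<close> allow only elements of kG. In the commutators of generators the
  \<open>\<mu> 0\<close> parts cancel, and the formulas for \<open>lam\<close> and
  \<open>kap\<close> are exactly what remains. Degree bounds are strict throughout
  (\<open>below d\<close>, \<open>F_below d\<close>). Level 0 is then the zero space, which is both
  the start of the inductions on degree and the convention F(-1) = 0 of the associated graded
  algebra.\<close>

lemma alg_iso_inv_into:
  assumes "ring A" and h: "h \<in> alg_iso A B"
    and cl: "\<And>c x. x \<in> carrier A \<Longrightarrow> c \<odot>\<^bsub>A\<^esub> x \<in> carrier A"
  shows "inv_into (carrier A) h \<in> alg_iso B A"
proof -
  have iso: "h \<in> ring_iso A B" and lin: "\<And>c x. x \<in> carrier A \<Longrightarrow> h (c \<odot>\<^bsub>A\<^esub> x) = c \<odot>\<^bsub>B\<^esub> h x"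
    using h by (auto simp: alg_iso_def)
  have bij: "bij_betw h (carrier A) (carrier B)"
    using iso by (rule ring_iso_memE)
  have "inv_into (carrier A) h (c \<odot>\<^bsub>B\<^esub> y) = c \<odot>\<^bsub>A\<^esub> inv_into (carrier A) h y"
    if y: "y \<in> carrier B" for c y
  proof -
    obtain x where x: "x \<in> carrier A" "y = h x"
      using bij y by (auto simp: bij_betw_def)
    then show ?thesis
      using bij cl lin[OF x(1), of c, symmetric] by (simp add: bij_betw_inv_into_left)
  qed
  then show ?thesis
    using ring_iso_set_sym[OF assms(1) iso] by (simp add: alg_iso_def)
qed

lemma alg_isomorphic_sym:
  assumes "ring A" "alg_isomorphic A B"
    and "\<And>c x. x \<in> carrier A \<Longrightarrow> c \<odot>\<^bsub>A\<^esub> x \<in> carrier A"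
  shows "alg_isomorphic B A"
proof -
  obtain h where "h \<in> alg_iso A B"
    using assms(2) by (auto simp: alg_isomorphic_def)
  from alg_iso_inv_into[OF assms(1) this assms(3)] show ?thesis
    by (auto simp: alg_isomorphic_def)
qed

lemma alg_isomorphic_trans:
  assumes "alg_isomorphic A B" "alg_isomorphic B C"
  shows "alg_isomorphic A C"
proof -
  obtain g h where g: "g \<in> alg_iso A B" and h: "h \<in> alg_iso B C"
    using assms by (auto simp: alg_isomorphic_def)
  have "g x \<in> carrier B" if "x \<in> carrier A" for x
    using g that ring_iso_memE(1) by (fastforce simp: alg_iso_def)
  then have "h \<circ> g \<in> alg_iso A C"
    using g h by (auto simp: alg_iso_def intro: ring_iso_set_trans)
  then show ?thesis by (auto simp: alg_isomorphic_def)
qed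

lemma alg_quot_simps [simp]:
  "carrier (alg_quot R I) = carrier (R Quot I)" "mult (alg_quot R I) = mult (R Quot I)"
  "one (alg_quot R I) = one (R Quot I)" "zero (alg_quot R I) = zero (R Quot I)"
  "add (alg_quot R I) = add (R Quot I)"
  by (simp_all add: alg_quot_def)

text \<open>Quotients and images come as records of another type or with updated fields; a
  comparison by components transfers the axioms to the algebra at hand.\<close>

lemma ring_cong:
  assumes "ring R" "carrier S = carrier R" "mult S = mult R" "one S = one R"
    "zero S = zero R" "add S = add R"
  shows "ring S"
proof -
  interpret ring R by fact
  have "abelian_group S"
    by (rule abelian_groupI; unfold assms(2-6))
      (auto simp: a_ac intro: bexI[of _ "\<ominus>\<^bsub>R\<^esub> _"] l_neg)
  moreover have "Group.monoid S"
    by (rule Group.monoidI; unfold assms(2-6)) (auto simp: m_assoc)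
  ultimately show ?thesis
    by (rule ringI; unfold assms(2-6)) (auto simp: l_distr r_distr)
qed

lemma ring_alg_quot:
  assumes "ideal I R"
  shows "ring (alg_quot R I)"
  by (rule ring_cong[OF ideal.quotient_is_ring[OF assms]]) simp_all

text \<open>Scalar multiplication in the quotient is a union over all representatives. It collapses
  to one coset because the kernel of a linear map is stable under scalars, which is not part of
  being a ring ideal.\<close>

lemma alg_quot_smult:
  fixes R :: "('k, 'a, 'm) module_scheme" and S :: "('k, 'b, 'n) module_scheme"
  assumes h: "ring_hom_ring R S h"
    and sm: "\<And>c x. x \<in> carrier R \<Longrightarrow> c \<odot>\<^bsub>R\<^esub> x \<in> carrier R"
    and lin: "\<And>c x. x \<in> carrier R \<Longrightarrow> h (c \<odot>\<^bsub>R\<^esub> x) = c \<odot>\<^bsub>S\<^esub> h x"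
    and x: "x \<in> carrier R"
  shows "c \<odot>\<^bsub>alg_quot R (a_kernel R S h)\<^esub> (a_kernel R S h +>\<^bsub>R\<^esub> x) =
    a_kernel R S h +>\<^bsub>R\<^esub> (c \<odot>\<^bsub>R\<^esub> x)"
proof -
  interpret ring_hom_ring R S h by fact
  let ?K = "a_kernel R S h"
  have eq: "?K +>\<^bsub>R\<^esub> (c \<odot>\<^bsub>R\<^esub> y) = ?K +>\<^bsub>R\<^esub> (c \<odot>\<^bsub>R\<^esub> x)" if "y \<in> ?K +>\<^bsub>R\<^esub> x" for y
  proof -
    have y: "y \<in> carrier R" "h y = h x"
      using that x rcos_imp_homeq abelian_subgroup.a_elemrcos_carrier abelian_subgroup_a_kernel
      by metis+
    then have "h (c \<odot>\<^bsub>R\<^esub> y) = h (c \<odot>\<^bsub>R\<^esub> x)"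
      using lin x by simp
    then have "c \<odot>\<^bsub>R\<^esub> y \<in> ?K +>\<^bsub>R\<^esub> (c \<odot>\<^bsub>R\<^esub> x)"
      using sm x y by (intro homeq_imp_rcos) simp_all
    then show ?thesis
      using sm x by (metis R.a_repr_independence additive_subgroup.a_subgroup additive_subgroup_a_kernel)
  qed
  \<comment> \<open>The members of the union all agree, so it remains to see that the index set is
    not empty.\<close>
  have "x \<in> ?K +>\<^bsub>R\<^esub> x"
    using x by (intro homeq_imp_rcos) simp_all
  then have "(\<Union>y\<in>?K +>\<^bsub>R\<^esub> x. ?K +>\<^bsub>R\<^esub> (c \<odot>\<^bsub>R\<^esub> y)) = ?K +>\<^bsub>R\<^esub> (c \<odot>\<^bsub>R\<^esub> x)"
    by (intro SUP_eq_const eq) blast+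
  then show ?thesis
    unfolding alg_quot_def by simp
qed

text \<open>First isomorphism theorem for algebras: the ring part is
  \<open>FactRing_iso_set\<close>, and compatibility with scalars is read off on
  representatives.\<close>

lemma alg_quot_iso:
  fixes R :: "('k, 'a, 'm) module_scheme" and S :: "('k, 'b, 'n) module_scheme"
  assumes h: "ring_hom_ring R S h"
    and sm: "\<And>c x. x \<in> carrier R \<Longrightarrow> c \<odot>\<^bsub>R\<^esub> x \<in> carrier R"
    and lin: "\<And>c x. x \<in> carrier R \<Longrightarrow> h (c \<odot>\<^bsub>R\<^esub> x) = c \<odot>\<^bsub>S\<^esub> h x"
    and surj: "h ` carrier R = carrier S"
  shows "(\<lambda>X. the_elem (h ` X)) \<in> alg_iso (alg_quot R (a_kernel R S h)) S"
proof -
  interpret ring_hom_ring R S h by fact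
  let ?K = "a_kernel R S h"
  have "the_elem (h ` (c \<odot>\<^bsub>alg_quot R ?K\<^esub> X)) = c \<odot>\<^bsub>S\<^esub> the_elem (h ` X)"
    if X: "X \<in> carrier (R Quot ?K)" for c X
  proof -
    obtain x where x: "x \<in> carrier R" "X = ?K +>\<^bsub>R\<^esub> x"
      using quot_mem[OF X] by (elim bexE)
    have "c \<odot>\<^bsub>alg_quot R ?K\<^esub> X = ?K +>\<^bsub>R\<^esub> (c \<odot>\<^bsub>R\<^esub> x)"
      unfolding x(2) by (rule alg_quot_smult[OF h]) (fact sm lin x(1))+
    then show ?thesis
      using the_elem_simp[OF sm[OF x(1)]] the_elem_simp[OF x(1)] lin[OF x(1)] x(2) by simp
  qed
  moreover have "(\<lambda>X. the_elem (h ` X)) \<in> ring_iso (alg_quot R ?K) S"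
    using FactRing_iso_set[OF surj] by (simp add: ring_iso_def ring_hom_def)
  ultimately show ?thesis
    by (simp add: alg_iso_def)
qed

lemma finsum_eq_sum:
  fixes R :: "('a::comm_monoid_add, 'm) ring_scheme"
  assumes "abelian_monoid R" "zero R = 0" "add R = (+)" "\<And>i. i \<in> S \<Longrightarrow> f i \<in> carrier R" "finite S"
  shows "finsum R f S = sum f S"
proof -
  interpret abelian_monoid R by fact
  show ?thesis
    using assms(5,4)
  proof (induction S rule: finite_induct)
    case empty
    then show ?case by (simp add: assms(2))
  next
    case (insert i S)
    then have "finsum R f (insert i S) = f i \<oplus>\<^bsub>R\<^esub> finsum R f S"
      by (intro finsum_insert) auto
    then show ?case
      using insert by (simp add: assms(3))
  qed
qed

subsection \<open>Free algebras\<close>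

lemma vector_space_pm_scale: "vector_space (pm_scale :: 'k::field \<Rightarrow> ('x \<Rightarrow>\<^sub>0 'k) \<Rightarrow> _)"
  by unfold_locales (rule poly_mapping_eqI, simp add: lookup_pm_scale lookup_add algebra_simps)+

lemma vector_space_skew_scale:
  "vector_space (\<lambda>c :: 'k::field. Poly_Mapping.map (pm_scale c) :: ('g, 'v, 'k) skew \<Rightarrow> _)"
  by unfold_locales
    (rule poly_mapping_eqI, rule poly_mapping_eqI, simp add: lookup_skew_scale lookup_pm_scale lookup_add algebra_simps)+

interpretation pm: vector_space "pm_scale :: 'k::field \<Rightarrow> ('x \<Rightarrow>\<^sub>0 'k) \<Rightarrow> _"
  by (rule vector_space_pm_scale)

interpretation skew: vector_space "\<lambda>c :: 'k::field. Poly_Mapping.map (pm_scale c) :: ('g, 'v, 'k) skew \<Rightarrow> _"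
  by (rule vector_space_skew_scale)

lemma pm_scale_single: "pm_scale c (Poly_Mapping.single x d) = Poly_Mapping.single x (c * d)"
  by (rule poly_mapping_eqI) (simp add: lookup_pm_scale lookup_single when_def)

lemma pm_scale_conv_mult: "pm_scale c p = Poly_Mapping.single 0 c * p"
  unfolding pm_scale_def by (rule mult_map_scale_conv_mult)

lemma pm_scale_mult_left: "pm_scale c p * q = pm_scale c (p * q)"
  by (simp add: pm_scale_conv_mult mult.assoc)

lemma poly_mapping_sum_single:
  "p = (\<Sum>w\<in>Poly_Mapping.keys p. Poly_Mapping.single w (Poly_Mapping.lookup p w))"
  by (rule poly_mapping_eqI)
    (simp add: lookup_sum lookup_single when_def in_keys_iff)

text \<open>Scalars are central even for a noncommutative monoid of exponents such as words:
  \<open>0\<close> is neutral on both sides and the coefficients commute.\<close>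

lemma single_zero_mult_comm:
  fixes p :: "'x::monoid_add \<Rightarrow>\<^sub>0 'k::field"
  shows "p * Poly_Mapping.single 0 c = Poly_Mapping.single 0 c * p"
proof -
  have "(\<Sum>w\<in>Poly_Mapping.keys p. Poly_Mapping.single w (Poly_Mapping.lookup p w)) * Poly_Mapping.single 0 c =
    Poly_Mapping.single 0 c * (\<Sum>w\<in>Poly_Mapping.keys p. Poly_Mapping.single w (Poly_Mapping.lookup p w))"
    by (simp add: sum_distrib_left sum_distrib_right mult_single mult.commute)
  then show ?thesis
    by (simp flip: poly_mapping_sum_single)
qed

lemma pm_scale_mult_right:
  fixes p :: "'x::monoid_add \<Rightarrow>\<^sub>0 'k::field"
  shows "p * pm_scale c q = pm_scale c (p * q)"
  unfolding pm_scale_conv_mult mult.assoc[symmetric] single_zero_mult_comm ..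

lemma ring_free_alg: "ring (free_alg X :: ('k::field, 'x word \<Rightarrow>\<^sub>0 'k) module)"
proof -
  let ?F = "free_alg X :: ('k, 'x word \<Rightarrow>\<^sub>0 'k) module"
  have add: "p + q \<in> carrier ?F" if "p \<in> carrier ?F" "q \<in> carrier ?F" for p q
    using that keys_add[of p q] by (auto simp: free_alg_def)
  have mul: "p * q \<in> carrier ?F" if "p \<in> carrier ?F" "q \<in> carrier ?F" for p q
    using that keys_mult[of p q] by (fastforce simp: free_alg_def plus_word_def)
  have "- p \<in> carrier ?F" if "p \<in> carrier ?F" for p
    using that by (auto simp: free_alg_def in_keys_iff)
  then have neg: "\<exists>q\<in>carrier ?F. p + q = 0" if "p \<in> carrier ?F" for p
    using that by (metis add.right_inverse)
  have simps: "mult ?F = (*)" "one ?F = 1" "zero ?F = 0" "add ?F = (+)"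
    by (simp_all add: free_alg_def)
  have "0 \<in> carrier ?F" "1 \<in> carrier ?F"
    by (simp_all add: free_alg_def zero_word_def)
  then show ?thesis
    by (intro ringI abelian_groupI Group.monoidI; unfold simps)
      (auto simp: algebra_simps add mul neg)
qed

subsection \<open>Supports in the skew group algebra\<close>

abbreviation skew_scale :: "'k::field \<Rightarrow> ('g, 'v, 'k) skew \<Rightarrow> ('g, 'v, 'k) skew"
  where "skew_scale c \<equiv> Poly_Mapping.map (pm_scale c)"

text \<open>Flattens the two nested finitely supported functions into coordinates for the basis of
  monomials times group elements, so that equality, supports and degrees become pointwise
  statements.\<close>

definition skew_coeff :: "('g, 'v, 'k::field) skew \<Rightarrow> 'g \<Rightarrow> ('v \<Rightarrow>\<^sub>0 nat) \<Rightarrow> 'k"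
  where "skew_coeff a g m = Poly_Mapping.lookup (Poly_Mapping.lookup a g) m"

definition skew_monom :: "'g \<Rightarrow> ('v \<Rightarrow>\<^sub>0 nat) \<Rightarrow> ('g, 'v, 'k::field) skew"
  where "skew_monom g m = Poly_Mapping.single g (Poly_Mapping.single m 1)"

lemma skew_eqI: "(\<And>g m. skew_coeff a g m = skew_coeff b g m) \<Longrightarrow> a = b"
  by (intro poly_mapping_eqI) (simp add: skew_coeff_def)

lemma skew_coeff_simps [simp]:
  "skew_coeff 0 g m = 0"
  "skew_coeff (a + b) g m = skew_coeff a g m + skew_coeff b g m"
  "skew_coeff (a - b) g m = skew_coeff a g m - skew_coeff b g m"
  "skew_coeff (- a) g m = - skew_coeff a g m"
  "skew_coeff (skew_scale c a) g m = c * skew_coeff a g m"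
  "skew_coeff (sum f I) g m = (\<Sum>i\<in>I. skew_coeff (f i) g m)"
  by (simp_all add: skew_coeff_def lookup_add lookup_minus lookup_skew_scale lookup_pm_scale lookup_sum)

lemma in_keys_skew_coeff: "m \<in> Poly_Mapping.keys (Poly_Mapping.lookup a g) \<longleftrightarrow> skew_coeff a g m \<noteq> 0"
  by (simp add: skew_coeff_def in_keys_iff)

lemma skew_coeff_single:
  "skew_coeff (Poly_Mapping.single g p) h m = (Poly_Mapping.lookup p m when g = h)"
  by (simp add: skew_coeff_def lookup_single when_def)

lemma skew_coeff_monom: "skew_coeff (skew_monom g m) h n = (1 when g = h \<and> m = n)"
  by (simp add: skew_monom_def skew_coeff_single lookup_single when_def)

lemma skew_sum_monom:
  "a = (\<Sum>g\<in>Poly_Mapping.keys a. \<Sum>m\<in>Poly_Mapping.keys (Poly_Mapping.lookup a g).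
      skew_scale (skew_coeff a g m) (skew_monom g m))" (is "a = ?s")
proof -
  have "(\<Sum>m\<in>Poly_Mapping.keys (Poly_Mapping.lookup a g).
      skew_scale (skew_coeff a g m) (skew_monom g m)) = Poly_Mapping.single g (Poly_Mapping.lookup a g)" for g
    by (rule skew_eqI)
      (auto simp: skew_coeff_monom skew_coeff_single when_def in_keys_skew_coeff if_distrib
        simp flip: skew_coeff_def cong: if_cong)
  then show ?thesis
    using poly_mapping_sum_single[of a] by simp
qed

text \<open>Its instances are the components, with \<open>P = (\<lambda>e. e = d)\<close>, and the filtration, with \<open>P = (\<lambda>e. e < d)\<close>.\<close>

definition skew_supp :: "('g, 'x) monoid_scheme \<Rightarrow> 'v set \<Rightarrow> (nat \<Rightarrow> bool) \<Rightarrow> ('g, 'v, 'k::field) skew set"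
  where "skew_supp G Basis P = {a. \<forall>g m. skew_coeff a g m \<noteq> 0 \<longrightarrow>
    g \<in> carrier G \<and> Poly_Mapping.keys m \<subseteq> Basis \<and> P (mon_degree m)}"

lemma skew_supp_alt: "skew_supp G Basis P = {a. Poly_Mapping.keys a \<subseteq> carrier G \<and>
    (\<forall>g. Poly_Mapping.lookup a g \<in> sym_carrier Basis \<and>
      (\<forall>m \<in> Poly_Mapping.keys (Poly_Mapping.lookup a g). P (mon_degree m)))}"
proof (intro equalityI subsetI CollectI conjI allI ballI)
  fix a :: "('a, 'b, 'c) skew" and g
  assume a: "a \<in> skew_supp G Basis P"
  then show "Poly_Mapping.lookup a g \<in> sym_carrier Basis"
    by (auto simp: skew_supp_def sym_carrier_def in_keys_skew_coeff)
  show "P (mon_degree m)" if "m \<in> Poly_Mapping.keys (Poly_Mapping.lookup a g)" for m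
    using a that by (auto simp: skew_supp_def in_keys_skew_coeff)
  show "g \<in> carrier G" if g: "g \<in> Poly_Mapping.keys a"
  proof -
    obtain m where "skew_coeff a g m \<noteq> 0"
      using g by (auto simp: in_keys_iff poly_mapping_eq_iff fun_eq_iff skew_coeff_def)
    then show ?thesis using a by (auto simp: skew_supp_def)
  qed
next
  fix a :: "('a, 'b, 'c) skew"
  assume a: "a \<in> {a. Poly_Mapping.keys a \<subseteq> carrier G \<and>
    (\<forall>g. Poly_Mapping.lookup a g \<in> sym_carrier Basis \<and>
      (\<forall>m \<in> Poly_Mapping.keys (Poly_Mapping.lookup a g). P (mon_degree m)))}"
  have "g \<in> carrier G \<and> Poly_Mapping.keys m \<subseteq> Basis \<and> P (mon_degree m)" if "skew_coeff a g m \<noteq> 0" for g m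
  proof -
    have "g \<in> Poly_Mapping.keys a" "m \<in> Poly_Mapping.keys (Poly_Mapping.lookup a g)"
      using that by (auto simp: skew_coeff_def in_keys_iff)
    then show ?thesis using a by (auto simp: sym_carrier_def)
  qed
  then show "a \<in> skew_supp G Basis P"
    by (simp add: skew_supp_def)
qed

lemma skew_component_eq_supp: "skew_component G Basis d = skew_supp G Basis (\<lambda>e. e = d)"
  by (simp add: skew_component_def skew_supp_alt)

lemma skew_carrier_eq_supp:
  "carrier (skew_group_alg G scale Basis \<rho>) = skew_supp G Basis (\<lambda>_. True)"
  by (simp add: skew_group_alg_def skew_supp_alt)

lemma skew_supp_closed:
  shows skew_supp_zero: "0 \<in> skew_supp G Basis P"
    and skew_supp_add: "\<lbrakk>a \<in> skew_supp G Basis P; b \<in> skew_supp G Basis P\<rbrakk> \<Longrightarrow> a + b \<in> skew_supp G Basis P"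
    and skew_supp_diff: "\<lbrakk>a \<in> skew_supp G Basis P; b \<in> skew_supp G Basis P\<rbrakk> \<Longrightarrow> a - b \<in> skew_supp G Basis P"
    and skew_supp_uminus: "a \<in> skew_supp G Basis P \<Longrightarrow> - a \<in> skew_supp G Basis P"
    and skew_supp_scale: "a \<in> skew_supp G Basis P \<Longrightarrow> skew_scale c a \<in> skew_supp G Basis P"
  unfolding skew_supp_def mem_Collect_eq skew_coeff_simps
  by (metis add_0 diff_0_right neg_equal_0_iff_equal mult_zero_right)+

lemma skew_supp_sum:
  "(\<And>i. i \<in> I \<Longrightarrow> f i \<in> skew_supp G Basis P) \<Longrightarrow> sum f I \<in> skew_supp G Basis P"
  by (induction I rule: infinite_finite_induct) (simp_all add: skew_supp_closed)

lemma skew_supp_mono: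
  "\<lbrakk>a \<in> skew_supp G Basis P; \<And>e. P e \<Longrightarrow> Q e\<rbrakk> \<Longrightarrow> a \<in> skew_supp G Basis Q"
  by (auto simp: skew_supp_def)

text \<open>This is how leading terms are compared: an element homogeneous of degree d that also has
  only terms of degree below d vanishes.\<close>

lemma skew_supp_inter_eq_0:
  "\<lbrakk>a \<in> skew_supp G Basis P; a \<in> skew_supp G Basis Q; \<And>e. P e \<Longrightarrow> \<not> Q e\<rbrakk> \<Longrightarrow> a = 0"
  by (rule skew_eqI) (auto simp: skew_supp_def)

lemma skew_monom_supp:
  "\<lbrakk>g \<in> carrier G; Poly_Mapping.keys m \<subseteq> Basis; P (mon_degree m)\<rbrakk> \<Longrightarrow> skew_monom g m \<in> skew_supp G Basis P"
  by (simp add: skew_supp_def skew_coeff_monom when_def)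

lemma skew_supp_induct [consumes 1, case_names add scale zero monom]:
  assumes a: "a \<in> skew_supp G Basis P"
    and add: "\<And>a b. Q a \<Longrightarrow> Q b \<Longrightarrow> Q (a + b)"
    and scale: "\<And>c a. Q a \<Longrightarrow> Q (skew_scale c a)"
    and zero: "Q 0"
    and monom: "\<And>g m. \<lbrakk>g \<in> carrier G; Poly_Mapping.keys m \<subseteq> Basis; P (mon_degree m)\<rbrakk> \<Longrightarrow> Q (skew_monom g m)"
  shows "Q a"
proof -
  have Qsum: "Q (sum f I)" if "\<And>i. i \<in> I \<Longrightarrow> Q (f i)" for f and I :: "'x set"
    using that by (induction I rule: infinite_finite_induct) (simp_all add: zero add)
  show ?thesis
    by (subst skew_sum_monom, intro Qsum scale monom)
      (use a in \<open>auto simp: skew_supp_def skew_coeff_def in_keys_iff subset_iff\<close>)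
qed

definition skew_proj :: "nat \<Rightarrow> ('g, 'v, 'k::field) skew \<Rightarrow> ('g, 'v, 'k) skew"
  where "skew_proj d = Poly_Mapping.map (Poly_Mapping.mapp (\<lambda>m c. c when mon_degree m = d))"

lemma skew_coeff_proj:
  fixes a :: "('g, 'v, 'k::field) skew"
  shows "skew_coeff (skew_proj d a) g m = (skew_coeff a g m when mon_degree m = d)"
proof -
  have "Poly_Mapping.mapp (\<lambda>m c. c when mon_degree m = d) 0 = (0 :: ('v, 'k) sym)"
    by (rule poly_mapping_eqI) (simp add: lookup_mapp)
  then have "Poly_Mapping.lookup (skew_proj d a) g =
      Poly_Mapping.mapp (\<lambda>m c. c when mon_degree m = d) (Poly_Mapping.lookup a g)"
    by (simp add: skew_proj_def Poly_Mapping.map.rep_eq when_def)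
  then show ?thesis
    by (auto simp: skew_coeff_def lookup_mapp when_def in_keys_iff)
qed

lemma skew_proj_supp: "a \<in> skew_supp G Basis P \<Longrightarrow> skew_proj d a \<in> skew_supp G Basis (\<lambda>e. e = d)"
  by (auto simp: skew_supp_def skew_coeff_proj when_def split: if_splits)

lemma skew_proj_diff_supp: "a \<in> skew_supp G Basis P \<Longrightarrow> a - skew_proj d a \<in> skew_supp G Basis (\<lambda>e. P e \<and> e \<noteq> d)"
  by (auto simp: skew_supp_def skew_coeff_proj when_def split: if_splits)

lemma sum_skew_proj:
  assumes "a \<in> skew_supp G Basis (\<lambda>e. e < d)"
  shows "(\<Sum>i<d. skew_proj i a) = a"
  by (rule skew_eqI)
    (use assms in \<open>auto simp: skew_coeff_proj when_def skew_supp_def\<close>)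

lemma skew_supp_bounded:
  assumes "a \<in> skew_supp G Basis P"
  obtains d where "a \<in> skew_supp G Basis (\<lambda>e. e < d)"
proof -
  define M where "M = (\<Union>g\<in>Poly_Mapping.keys a. mon_degree ` Poly_Mapping.keys (Poly_Mapping.lookup a g))"
  have fin: "finite M" by (simp add: M_def)
  \<comment> \<open>For \<open>a = 0\<close> the set \<open>M\<close> is empty and
    \<open>Max M\<close> unspecified, which is harmless: the claim starts from a nonzero
    coefficient, and this puts an element into \<open>M\<close>.\<close>
  have "mon_degree m < Suc (Max M)" if "skew_coeff a g m \<noteq> 0" for g m
  proof -
    have "m \<in> Poly_Mapping.keys (Poly_Mapping.lookup a g)" "g \<in> Poly_Mapping.keys a"
      using that by (auto simp: skew_coeff_def in_keys_iff)
    then have "mon_degree m \<in> M" unfolding M_def by blast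
    then show ?thesis using fin by (simp add: le_imp_less_Suc)
  qed
  then have "a \<in> skew_supp G Basis (\<lambda>e. e < Suc (Max M))"
    using assms by (auto simp: skew_supp_def)
  then show thesis by (rule that)
qed

subsection \<open>Products in the skew group algebra\<close>

lemma skew_group_alg_simps [simp]:
  "one (skew_group_alg G scale Basis \<rho>) = skew_monom \<one>\<^bsub>G\<^esub> 0"
  "zero (skew_group_alg G scale Basis \<rho>) = 0"
  "add (skew_group_alg G scale Basis \<rho>) = (+)"
  "smult (skew_group_alg G scale Basis \<rho>) = (\<lambda>c. skew_scale c)"
  by (simp_all add: skew_group_alg_def skew_monom_def)

lemma skew_mult_single:
  "Poly_Mapping.single g p \<otimes>\<^bsub>skew_group_alg G scale Basis \<rho>\<^esub> Poly_Mapping.single h q =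
    Poly_Mapping.single (g \<otimes>\<^bsub>G\<^esub> h) (p * sym_map scale Basis (\<rho> g) q)"
  by (simp add: skew_group_alg_def sym_map_def)

lemma sym_map_one: "sym_map scale Basis f 1 = 1"
  by (simp add: sym_map_def)

lemma skew_of_group_elt: "skew_of_group_alg (group_elt g) = skew_monom g 0"
  by (rule poly_mapping_eqI)
    (simp add: lookup_skew_of_group_alg group_elt_def skew_monom_def lookup_single when_def)

lemma (in finite_dimensional_vector_space) sym_vec_sum:
  "sym_vec scale Basis (\<Sum>i\<in>I. f i) = (\<Sum>i\<in>I. sym_vec scale Basis (f i))"
proof -
  have "sym_vec scale Basis 0 = 0"
    using sym_vec_add[of 0 0] by simp
  then show ?thesis
    by (induction I rule: infinite_finite_induct) (simp_all add: sym_vec_add)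
qed

lemma (in finite_dimensional_vector_space) sum_representation_Basis:
  "(\<Sum>b\<in>Basis. scale (representation Basis v b) b) = v"
  using sum_representation_eq[OF independent_Basis, of v Basis] span_Basis finite_Basis by simp

lemma (in finite_dimensional_vector_space) sym_map_vec:
  assumes "Vector_Spaces.linear scale scale f"
  shows "sym_map scale Basis f (sym_vec scale Basis v) = sym_vec scale Basis (f v)"
proof -
  interpret f: Vector_Spaces.linear scale scale f by fact
  let ?r = "representation Basis v"
  let ?x = "\<lambda>b. Poly_Mapping.single b (1::nat)"
  have lookup: "Poly_Mapping.lookup (sym_vec scale Basis v) (?x b) = ?r b" if "b \<in> Basis" for b
  proof -
    have "?x c = ?x b \<longleftrightarrow> c = b" for c
      by (metis lookup_single_eq lookup_single_not_eq zero_neq_one)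
    then show ?thesis
      using that finite_Basis
      by (simp add: sym_vec_def lookup_sum lookup_single when_def)
  qed
  have inj: "inj_on ?x Basis"
    by (rule inj_onI) (metis lookup_single_eq lookup_single_not_eq zero_neq_one)
  have keys: "Poly_Mapping.keys (sym_vec scale Basis v) \<subseteq> ?x ` Basis"
    unfolding sym_vec_def by (rule keys_sum_subset) auto
  let ?F = "\<lambda>m. pm_scale (Poly_Mapping.lookup (sym_vec scale Basis v) m)
       (\<Prod>b \<in> Poly_Mapping.keys m. sym_vec scale Basis (f b) ^ Poly_Mapping.lookup m b)"
  \<comment> \<open>Summing over all basis indeterminates instead of the keys only adds terms with
    coefficient 0.\<close>
  have "sym_map scale Basis f (sym_vec scale Basis v) = sum ?F (?x ` Basis)"
    unfolding sym_map_def
    by (rule sum.mono_neutral_left) (use keys finite_Basis in \<open>auto simp: in_keys_iff\<close>)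
  also have "\<dots> = (\<Sum>b\<in>Basis. pm_scale (?r b) (sym_vec scale Basis (f b)))"
    by (subst sum.reindex[OF inj]) (simp add: lookup[unfolded One_nat_def])
  also have "\<dots> = sym_vec scale Basis (f (\<Sum>b\<in>Basis. scale (?r b) b))"
    by (simp add: f.sum f.scale sym_vec_sum sym_vec_scale)
  finally show ?thesis
    by (simp add: sum_representation_Basis)
qed

subsection \<open>The fiber of a deformation\<close>

text \<open>Reindexing of a threefold Cauchy product by \<open>n = i + j + l\<close>;
  \<open>2 * N + M\<close> merely bounds this sum on the box where \<open>T\<close> can be nonzero.
  It turns the sum of all coefficients of a product in \<open>A[t]\<close> into a sum over pairs of
  coefficients.\<close>

lemma sum_triple_convolution:
  fixes T :: "nat \<Rightarrow> nat \<Rightarrow> nat \<Rightarrow> 'a::comm_monoid_add"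
  assumes T: "\<And>i j l. \<not> (i < N \<and> j < N \<and> l < M) \<Longrightarrow> T i j l = 0"
  shows "(\<Sum>n<2 * N + M. \<Sum>i\<le>n. \<Sum>j\<le>n - i. T i j (n - i - j)) =
    (\<Sum>i<N. \<Sum>j<N. \<Sum>l<M. T i j l)"
proof -
  let ?S = "SIGMA n:{..<2 * N + M}. SIGMA i:{..n}. {..n - i}"
  let ?f = "\<lambda>(n, i, j). (i, j, n - i - j)"
  let ?C = "{..<N} \<times> {..<N} \<times> {..<M}"
  have inj: "inj_on ?f ?S"
    by (auto simp: inj_on_def)
  have sub: "?C \<subseteq> ?f ` ?S"
  proof
    fix x assume "x \<in> ?C"
    then obtain i j l where "x = (i, j, l)" "i < N" "j < N" "l < M" by auto
    then show "x \<in> ?f ` ?S"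
      by (intro image_eqI[of _ _ "(i + j + l, i, j)"]) auto
  qed
  have "(\<Sum>n<2 * N + M. \<Sum>i\<le>n. \<Sum>j\<le>n - i. T i j (n - i - j)) = (\<Sum>x\<in>?S. case ?f x of (i, j, l) \<Rightarrow> T i j l)"
    by (simp add: sum.Sigma split_def)
  also have "\<dots> = (\<Sum>(i, j, l)\<in>?f ` ?S. T i j l)"
    by (subst sum.reindex[OF inj]) (simp add: split_def)
  also have "\<dots> = (\<Sum>(i, j, l)\<in>?C. T i j l)"
    by (rule sum.mono_neutral_right) (use sub T in auto)
  also have "\<dots> = (\<Sum>i<N. \<Sum>j<N. \<Sum>l<M. T i j l)"
    by (simp add: sum.Sigma split_def)
  finally show ?thesis .
qed

locale deformed_skew =
  fixes scale :: "'k::field \<Rightarrow> 'v::ab_group_add \<Rightarrow> 'v"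
    and Basis :: "'v set"
    and G :: "'g monoid"
    and \<rho> :: "'g \<Rightarrow> 'v \<Rightarrow> 'v"
    and \<mu> :: "nat \<Rightarrow> ('g, 'v, 'k) skew \<Rightarrow> ('g, 'v, 'k) skew \<Rightarrow> ('g, 'v, 'k) skew"
  assumes fin_dim: "finite_dimensional_vector_space scale Basis"
    and group: "group G"
    and action: "group_action G UNIV \<rho>"
    and linear: "\<And>g. g \<in> carrier G \<Longrightarrow> Vector_Spaces.linear scale scale (\<rho> g)"
    and graded_def: "graded_deformation (skew_group_alg G scale Basis \<rho>) (skew_component G Basis) \<mu>"
begin

sublocale V: finite_dimensional_vector_space scale Basis by (rule fin_dim)
sublocale G: group G by (rule group)

abbreviation "A \<equiv> skew_group_alg G scale Basis \<rho>"
abbreviation "At \<equiv> deformed_alg A \<mu>"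
abbreviation supp :: "(nat \<Rightarrow> bool) \<Rightarrow> ('g, 'v, 'k) skew set" where "supp \<equiv> skew_supp G Basis"
abbreviation below :: "nat \<Rightarrow> ('g, 'v, 'k) skew set" where "below d \<equiv> supp (\<lambda>e. e < d)"
abbreviation unit :: "('g, 'v, 'k) skew" where "unit \<equiv> skew_monom \<one>\<^bsub>G\<^esub> 0"

lemma carrier_A: "carrier A = supp (\<lambda>_. True)"
  by (rule skew_carrier_eq_supp)

lemma supp_carrier: "a \<in> supp P \<Longrightarrow> a \<in> carrier A"
  unfolding carrier_A by (erule skew_supp_mono) simp

lemma carrier_A_closed:
  "0 \<in> carrier A"
  "a \<in> carrier A \<Longrightarrow> b \<in> carrier A \<Longrightarrow> a + b \<in> carrier A"
  "a \<in> carrier A \<Longrightarrow> b \<in> carrier A \<Longrightarrow> a - b \<in> carrier A"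
  "a \<in> carrier A \<Longrightarrow> - a \<in> carrier A"
  "a \<in> carrier A \<Longrightarrow> skew_scale c a \<in> carrier A"
  "(\<And>i. i \<in> I \<Longrightarrow> f i \<in> carrier A) \<Longrightarrow> sum f I \<in> carrier A"
  unfolding carrier_A by (intro skew_supp_closed skew_supp_sum; assumption)+

lemma unit_carrier: "unit \<in> carrier A"
  unfolding carrier_A by (rule skew_monom_supp) simp_all

section \<open>Degrees of the multiplication maps\<close>

lemma bilinear: "bilinear_map A (\<mu> j)"
  and ring_At: "ring At"
  and mu_0: "a \<in> carrier A \<Longrightarrow> b \<in> carrier A \<Longrightarrow> \<mu> 0 a b = a \<otimes>\<^bsub>A\<^esub> b"
  and finite_mu: "a \<in> carrier A \<Longrightarrow> b \<in> carrier A \<Longrightarrow> finite {j. \<mu> j a b \<noteq> 0}"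
  using graded_def by (simp_all add: graded_deformation_def deformation_def)

lemma mu_closed: "a \<in> carrier A \<Longrightarrow> b \<in> carrier A \<Longrightarrow> \<mu> j a b \<in> carrier A"
  using bilinear[of j] by (simp add: bilinear_map_def)

lemma mu_add:
  "a \<in> carrier A \<Longrightarrow> a' \<in> carrier A \<Longrightarrow> b \<in> carrier A \<Longrightarrow> \<mu> j (a + a') b = \<mu> j a b + \<mu> j a' b"
  "a \<in> carrier A \<Longrightarrow> a' \<in> carrier A \<Longrightarrow> b \<in> carrier A \<Longrightarrow> \<mu> j b (a + a') = \<mu> j b a + \<mu> j b a'"
  using bilinear_mapD(1,2)[OF bilinear[of j]] by simp_all

lemma mu_scale:
  "a \<in> carrier A \<Longrightarrow> b \<in> carrier A \<Longrightarrow> \<mu> j (skew_scale c a) b = skew_scale c (\<mu> j a b)"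
  "a \<in> carrier A \<Longrightarrow> b \<in> carrier A \<Longrightarrow> \<mu> j a (skew_scale c b) = skew_scale c (\<mu> j a b)"
  using bilinear_mapD(3,4)[OF bilinear[of j]] by simp_all

lemma mu_zero:
  "a \<in> carrier A \<Longrightarrow> \<mu> j 0 a = 0" "a \<in> carrier A \<Longrightarrow> \<mu> j a 0 = 0"
  using mu_scale[of 0 a j 0] mu_scale[of a 0 j 0] carrier_A_closed(1) by simp_all

lemma mu_sum:
  assumes "\<And>i. i \<in> I \<Longrightarrow> f i \<in> carrier A" "b \<in> carrier A"
  shows "\<mu> j (sum f I) b = (\<Sum>i\<in>I. \<mu> j (f i) b)" "\<mu> j b (sum f I) = (\<Sum>i\<in>I. \<mu> j b (f i))"
  using assms by (induction I rule: infinite_finite_induct) (simp_all add: mu_zero mu_add carrier_A_closed)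

text \<open>With \<open>e + j\<close> in place of a truncated difference, the condition is
  unsatisfiable for \<open>j > m + n\<close>, so the vanishing case of the grading is
  included.\<close>

lemma mu_graded:
  assumes "a \<in> supp (\<lambda>e. e = m)" "b \<in> supp (\<lambda>e. e = n)"
  shows "\<mu> j a b \<in> supp (\<lambda>e. e + j = m + n)"
proof -
  have "if j \<le> m + n then \<mu> j a b \<in> supp (\<lambda>e. e = m + n - j) else \<mu> j a b = 0"
    using graded_def assms unfolding graded_deformation_def skew_component_eq_supp by simp
  then show ?thesis
    by (auto split: if_splits intro: skew_supp_zero elim!: skew_supp_mono)
qed

text \<open>Under strict bounds the top degrees are \<open>m - 1\<close> and \<open>n - 1\<close>,
  so a term of \<open>\<mu> j\<close> has degree at most \<open>m + n - 2 - j\<close>; hence the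
  extra 1. Splitting into homogeneous components reduces this to \<open>mu_graded\<close>.\<close>

lemma mu_filtered:
  assumes "a \<in> below m" "b \<in> below n"
  shows "\<mu> j a b \<in> supp (\<lambda>e. e + j + 1 < m + n)"
proof -
  have "\<mu> j a b = \<mu> j (\<Sum>i<m. skew_proj i a) (\<Sum>k<n. skew_proj k b)"
    using assms by (simp add: sum_skew_proj)
  also have "\<dots> = (\<Sum>i<m. \<Sum>k<n. \<mu> j (skew_proj i a) (skew_proj k b))"
    using supp_carrier[OF skew_proj_supp[OF assms(1)]] supp_carrier[OF skew_proj_supp[OF assms(2)]]
    by (simp add: mu_sum carrier_A_closed) (rule sum.swap)
  also have "\<dots> \<in> supp (\<lambda>e. e + j + 1 < m + n)"
    by (intro skew_supp_sum skew_supp_mono[OF mu_graded[OF skew_proj_supp[OF assms(1)] skew_proj_supp[OF assms(2)]]]) auto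
  finally show ?thesis .
qed

text \<open>The product of the fiber at \<open>t = 1\<close>, transported to \<open>A\<close>.\<close>

definition circ :: "('g, 'v, 'k) skew \<Rightarrow> ('g, 'v, 'k) skew \<Rightarrow> ('g, 'v, 'k) skew"
  where "circ a b = (\<Sum>j. \<mu> j a b)"

lemma circ_eq_sum:
  assumes "a \<in> carrier A" "b \<in> carrier A" "\<And>j. j \<ge> N \<Longrightarrow> \<mu> j a b = 0"
  shows "circ a b = (\<Sum>j<N. \<mu> j a b)"
  unfolding circ_def
  by (rule Sum_any.expand_superset) (use assms in \<open>auto simp: not_less\<close>, meson not_less)

lemma circ_add:
  assumes "a \<in> carrier A" "a' \<in> carrier A" "b \<in> carrier A"
  shows "circ (a + a') b = circ a b + circ a' b" "circ b (a + a') = circ b a + circ b a'"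
  using assms by (simp_all add: circ_def mu_add Sum_any.distrib finite_mu)

lemma circ_scale:
  assumes "a \<in> carrier A" "b \<in> carrier A"
  shows "circ (skew_scale c a) b = skew_scale c (circ a b)" "circ a (skew_scale c b) = skew_scale c (circ a b)"
proof -
  have "(\<Sum>j. skew_scale c (\<mu> j a b)) = skew_scale c (\<Sum>j. \<mu> j a b)"
  proof -
    have "(\<Sum>j. skew_scale c (\<mu> j a b)) = (\<Sum>j\<in>{j. \<mu> j a b \<noteq> 0}. skew_scale c (\<mu> j a b))"
      by (rule Sum_any.expand_superset) (use finite_mu[OF assms] in auto)
    then show ?thesis by (simp add: skew.scale_sum_right Sum_any.expand_set)
  qed
  then show "circ (skew_scale c a) b = skew_scale c (circ a b)" "circ a (skew_scale c b) = skew_scale c (circ a b)"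
    using assms by (simp_all add: circ_def mu_scale)
qed

lemma circ_zero: "a \<in> carrier A \<Longrightarrow> circ 0 a = 0" "a \<in> carrier A \<Longrightarrow> circ a 0 = 0"
  by (simp_all add: circ_def mu_zero)

lemma circ_sum:
  assumes "\<And>i. i \<in> I \<Longrightarrow> f i \<in> carrier A" "b \<in> carrier A"
  shows "circ (sum f I) b = (\<Sum>i\<in>I. circ (f i) b)" "circ b (sum f I) = (\<Sum>i\<in>I. circ b (f i))"
  using assms by (induction I rule: infinite_finite_induct) (simp_all add: circ_zero circ_add carrier_A_closed)

lemma circ_diff:
  assumes "a \<in> carrier A" "a' \<in> carrier A" "b \<in> carrier A"
  shows "circ (a - a') b = circ a b - circ a' b" "circ b (a - a') = circ b a - circ b a'"
  using circ_add[of "a - a'" a' b] assms by (simp_all add: carrier_A_closed eq_diff_eq)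

text \<open>Each further map that is split off lowers the bound by one. Where the bound becomes
  unsatisfiable the sum has stopped, which computes the products of generators; the second statement
  compares leading terms.\<close>

lemma circ_filtered:
  assumes "a \<in> below m" "b \<in> below n"
  shows "circ a b \<in> supp (\<lambda>e. e + 1 < m + n)"
    and "circ a b - \<mu> 0 a b \<in> supp (\<lambda>e. e + 2 < m + n)"
    and "circ a b - \<mu> 0 a b - \<mu> 1 a b \<in> supp (\<lambda>e. e + 3 < m + n)"
    and "circ a b - \<mu> 0 a b - \<mu> 1 a b - \<mu> 2 a b \<in> supp (\<lambda>e. e + 4 < m + n)"
proof -
  note mu = mu_filtered[OF assms]
  have "\<mu> j a b = 0" if "j \<ge> m + n + 3" for j
    using that by (intro skew_supp_inter_eq_0[OF mu mu, of j]) simp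
  \<comment> \<open>The cut-off is three larger than degrees require, so that three initial terms
    can be peeled off for all \<open>m\<close> and \<open>n\<close>.\<close>
  then have circ: "circ a b = (\<Sum>j<Suc (Suc (Suc (m + n))). \<mu> j a b)"
    using assms supp_carrier by (intro circ_eq_sum) auto
  have tail: "(\<Sum>j<N. \<mu> (j + i) a b) \<in> supp (\<lambda>e. e + Suc i < m + n)" for i N
    by (intro skew_supp_sum skew_supp_mono[OF mu]) simp
  show "circ a b \<in> supp (\<lambda>e. e + 1 < m + n)"
    using tail[where i = 0 and N = "Suc (Suc (Suc (m + n)))"] by (simp add: circ)
  show "circ a b - \<mu> 0 a b \<in> supp (\<lambda>e. e + 2 < m + n)"
    using tail[where i = 1 and N = "Suc (Suc (m + n))"]
    by (simp only: circ sum.lessThan_Suc_shift) (simp add: numeral_eq_Suc)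
  show "circ a b - \<mu> 0 a b - \<mu> 1 a b \<in> supp (\<lambda>e. e + 3 < m + n)"
    using tail[where i = 2 and N = "Suc (m + n)"]
    by (simp only: circ sum.lessThan_Suc_shift) (simp add: numeral_eq_Suc)
  show "circ a b - \<mu> 0 a b - \<mu> 1 a b - \<mu> 2 a b \<in> supp (\<lambda>e. e + 4 < m + n)"
    using tail[where i = 3 and N = "m + n"]
    by (simp only: circ sum.lessThan_Suc_shift) (simp add: numeral_eq_Suc)
qed

definition B :: "('k, ('g, 'v, 'k) skew) module"
  where "B = \<lparr>carrier = carrier A, mult = circ, one = unit, zero = 0, add = (+), smult = (\<lambda>c. skew_scale c)\<rparr>"

lemma B_simps [simp]:
  "carrier B = carrier A" "mult B = circ" "one B = unit" "zero B = 0" "add B = (+)"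
  "smult B = (\<lambda>c. skew_scale c)"
  by (simp_all add: B_def)

lemma abelian_group_A: "abelian_group A"
proof (rule abelian_groupI)
  show "\<exists>y\<in>carrier A. y \<oplus>\<^bsub>A\<^esub> x = \<zero>\<^bsub>A\<^esub>" if "x \<in> carrier A" for x
    using that by (intro bexI[of _ "- x"]) (simp_all add: carrier_A_closed)
qed (simp_all add: carrier_A_closed algebra_simps)

lemma finsum_A: "finite I \<Longrightarrow> (\<And>i. i \<in> I \<Longrightarrow> f i \<in> carrier A) \<Longrightarrow> finsum A f I = sum f I"
  using abelian_group_A by (intro finsum_eq_sum) (simp_all add: abelian_group_def)

section \<open>The deformed algebra as sequences of coefficients\<close>

lemma mem_At_iff: "p \<in> carrier At \<longleftrightarrow> (\<forall>n. p n \<in> carrier A) \<and> (\<exists>N. \<forall>n\<ge>N. p n = 0)"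
proof -
  have "(\<exists>N. bound 0 N p) \<longleftrightarrow> (\<exists>N. \<forall>n\<ge>N. p n = 0)"
    unfolding bound_def by (metis Suc_le_eq le_eq_less_or_eq)
  then show ?thesis
    by (auto simp: deformed_alg_def UP_def up_def Pi_def)
qed

lemma At_simps:
  "p \<in> carrier At \<Longrightarrow> q \<in> carrier At \<Longrightarrow> p \<oplus>\<^bsub>At\<^esub> q = (\<lambda>n. p n + q n)"
  "p \<in> carrier At \<Longrightarrow> q \<in> carrier At \<Longrightarrow> p \<otimes>\<^bsub>At\<^esub> q = (\<lambda>n. \<Sum>i\<le>n. \<Sum>j\<le>n - i. \<mu> (n - i - j) (p i) (q j))"
  "\<one>\<^bsub>At\<^esub> = (\<lambda>n. if n = 0 then unit else 0)"
  "\<zero>\<^bsub>At\<^esub> = (\<lambda>n. 0)"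
  "c \<odot>\<^bsub>At\<^esub> p = (\<lambda>n. skew_scale c (p n))"
proof -
  assume "p \<in> carrier At" "q \<in> carrier At"
  then have mu: "\<mu> l (p i) (q j) \<in> carrier A" for i j l
    by (simp add: mem_At_iff mu_closed)
  show "p \<otimes>\<^bsub>At\<^esub> q = (\<lambda>n. \<Sum>i\<le>n. \<Sum>j\<le>n - i. \<mu> (n - i - j) (p i) (q j))"
    by (simp add: deformed_alg_def finsum_A[OF _ mu] finsum_A[OF _ carrier_A_closed(6)[OF mu]])
qed (simp_all add: deformed_alg_def UP_def fun_eq_iff)

definition const :: "('g, 'v, 'k) skew \<Rightarrow> nat \<Rightarrow> ('g, 'v, 'k) skew"
  where "const a n = (if n = 0 then a else 0)"

lemma const_carrier: "a \<in> carrier A \<Longrightarrow> const a \<in> carrier At"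
  by (auto simp: mem_At_iff const_def carrier_A_closed intro!: exI[of _ 1])

lemma const_mult:
  assumes "a \<in> carrier A" "b \<in> carrier A"
  shows "const a \<otimes>\<^bsub>At\<^esub> const b = (\<lambda>n. \<mu> n a b)"
proof -
  have "\<mu> l (const a i) (const b j) = (if j = 0 then if i = 0 then \<mu> l a b else 0 else 0)" for i j l
    using assms by (simp add: const_def mu_zero carrier_A_closed)
  then show ?thesis
    by (simp add: At_simps const_carrier assms)
qed

text \<open>The identity of the deformed algebra is the constant sequence \<open>unit\<close>, and a
  product of constants lists all \<open>\<mu> n a b\<close>. Comparing coefficients in the unit laws
  therefore kills every \<open>\<mu> n\<close> with \<open>n > 0\<close> on
  \<open>unit\<close>.\<close>

lemma mu_unit:
  assumes "a \<in> carrier A"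
  shows "\<mu> n unit a = (if n = 0 then a else 0)" "\<mu> n a unit = (if n = 0 then a else 0)"
proof -
  interpret At: ring At by (rule ring_At)
  have 1: "\<one>\<^bsub>At\<^esub> = const unit" by (simp add: At_simps const_def fun_eq_iff)
  have "const unit \<otimes>\<^bsub>At\<^esub> const a = const a" "const a \<otimes>\<^bsub>At\<^esub> const unit = const a"
    using assms unfolding 1[symmetric] by (simp_all add: const_carrier)
  then show "\<mu> n unit a = (if n = 0 then a else 0)" "\<mu> n a unit = (if n = 0 then a else 0)"
    using assms unfolding const_mult[OF assms unit_carrier] const_mult[OF unit_carrier assms]
    by (simp_all add: fun_eq_iff const_def)
qed

text \<open>Reduction modulo \<open>t\<close>: the constant coefficient of a product only sees
  \<open>\<mu> 0\<close>, so taking it is a homomorphism onto \<open>A\<close>.\<close>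

lemma ring_A: "ring A"
proof -
  interpret At: ring At by (rule ring_At)
  have hom: "(\<lambda>p. p 0) \<in> ring_hom At A"
    by (rule ring_hom_memI) (simp_all add: At_simps mem_At_iff mu_0)
  have img: "(\<lambda>p. p 0) ` carrier At = carrier A"
  proof
    show "carrier A \<subseteq> (\<lambda>p. p 0) ` carrier At"
      by (intro subsetI image_eqI[OF _ const_carrier]) (simp add: const_def)
  qed (auto simp: mem_At_iff)
  show ?thesis
    by (rule ring_cong[OF At.ring_hom_imp_img_ring[OF hom]]) (simp_all add: img At_simps)
qed

section \<open>Evaluation at \<open>t = 1\<close> and its kernel\<close>

definition ev :: "(nat \<Rightarrow> ('g, 'v, 'k) skew) \<Rightarrow> ('g, 'v, 'k) skew"
  where "ev p = (\<Sum>n. p n)"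

lemma ev_eq_sum: "(\<And>n. n \<ge> N \<Longrightarrow> p n = 0) \<Longrightarrow> ev p = (\<Sum>n<N. p n)"
  unfolding ev_def by (rule Sum_any.expand_superset) (auto simp: not_less, meson not_less)

lemma ev_mult:
  assumes p: "p \<in> carrier At" and q: "q \<in> carrier At"
  shows "ev (p \<otimes>\<^bsub>At\<^esub> q) = circ (ev p) (ev q)"
proof -
  obtain N1 N2 where "\<forall>n\<ge>N1. p n = 0" "\<forall>n\<ge>N2. q n = 0"
    using p q by (auto simp: mem_At_iff)
  then obtain N where pN: "\<And>n. n \<ge> N \<Longrightarrow> p n = 0" and qN: "\<And>n. n \<ge> N \<Longrightarrow> q n = 0"
    by (metis max.bounded_iff)
  have pq: "p i \<in> carrier A" "q i \<in> carrier A" for i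
    using p q by (simp_all add: mem_At_iff)
  \<comment> \<open>The expansion is known to be finite for each pair separately; only finitely many
    pairs of coefficients occur, so they share a bound \<open>M\<close>.\<close>
  have "finite (\<Union>i<N. \<Union>j<N. {l. \<mu> l (p i) (q j) \<noteq> 0})"
    by (intro finite_UN_I finite_mu pq) simp_all
  then obtain M where "\<forall>l \<in> (\<Union>i<N. \<Union>j<N. {l. \<mu> l (p i) (q j) \<noteq> 0}). l < M"
    using finite_nat_set_iff_bounded by blast
  then have M: "\<mu> l (p i) (q j) = 0" if "i < N" "j < N" "l \<ge> M" for i j l
    using that by fastforce
  have T: "\<mu> l (p i) (q j) = 0" if "\<not> (i < N \<and> j < N \<and> l < M)" for i j l
    using that M pN qN pq by (metis mu_zero not_less)
  have "(p \<otimes>\<^bsub>At\<^esub> q) n = 0" if "n \<ge> 2 * N + M" for n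
    unfolding At_simps(2)[OF p q]
    by (intro sum.neutral ballI T) (use that in auto)
  then have "ev (p \<otimes>\<^bsub>At\<^esub> q) = (\<Sum>n<2 * N + M. \<Sum>i\<le>n. \<Sum>j\<le>n - i. \<mu> (n - i - j) (p i) (q j))"
    using At_simps(2)[OF p q] by (subst ev_eq_sum) auto
  also have "\<dots> = (\<Sum>i<N. \<Sum>j<N. \<Sum>l<M. \<mu> l (p i) (q j))"
    by (rule sum_triple_convolution[where T = "\<lambda>i j l. \<mu> l (p i) (q j)"]) (rule T)
  also have "\<dots> = (\<Sum>i<N. \<Sum>j<N. circ (p i) (q j))"
    by (intro sum.cong refl) (simp add: circ_eq_sum[where N = M] M pq)
  also have "\<dots> = circ (\<Sum>i<N. p i) (\<Sum>j<N. q j)"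
    by (simp add: circ_sum pq carrier_A_closed) (rule sum.swap)
  finally show ?thesis
    by (simp add: ev_eq_sum[where N = N] pN qN)
qed

lemma ev_closed: "p \<in> carrier At \<Longrightarrow> ev p \<in> carrier A"
  by (simp add: ev_def Sum_any.expand_set mem_At_iff carrier_A_closed)

lemma finite_At: "p \<in> carrier At \<Longrightarrow> finite {n. p n \<noteq> 0}"
  by (auto simp: mem_At_iff finite_nat_set_iff_bounded not_less[symmetric])

lemma ev_const: "ev (const a) = a"
  by (subst ev_eq_sum[where N = 1]) (simp_all add: const_def)

lemma ev_hom: "ev \<in> ring_hom At B"
proof (rule ring_hom_memI)
  show "ev (p \<oplus>\<^bsub>At\<^esub> q) = ev p \<oplus>\<^bsub>B\<^esub> ev q" if "p \<in> carrier At" "q \<in> carrier At" for p q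
    using that by (simp add: At_simps ev_def Sum_any.distrib finite_At)
  have "\<one>\<^bsub>At\<^esub> = const unit" by (simp add: At_simps const_def fun_eq_iff)
  then show "ev \<one>\<^bsub>At\<^esub> = \<one>\<^bsub>B\<^esub>" by (simp add: ev_const)
qed (simp_all add: ev_mult ev_closed)

lemma ev_surj: "ev ` carrier At = carrier B"
proof
  show "carrier B \<subseteq> ev ` carrier At"
    by (intro subsetI image_eqI[OF _ const_carrier]) (simp_all add: ev_const)
qed (auto simp: ev_closed)

lemma ring_B: "ring B"
proof -
  interpret At: ring At by (rule ring_At)
  have "ev \<zero>\<^bsub>At\<^esub> = 0" by (simp add: ev_def At_simps)
  then show ?thesis
    by (intro ring_cong[OF At.ring_hom_imp_img_ring[OF ev_hom]]) (simp_all add: ev_surj)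
qed

lemma t_minus_one_eq: "t_minus_one A n = skew_scale (if n = 0 then - 1 else if n = 1 then 1 else 0) unit"
proof -
  interpret A: ring A by (rule ring_A)
  \<comment> \<open>The subtraction in \<open>t - 1\<close> is taken in the undeformed
    \<open>UP A\<close>, whose ring structure rests on \<open>ring_A\<close>.\<close>
  interpret P: UP_ring A "UP A" by unfold_locales
  have "\<ominus>\<^bsub>UP A\<^esub> \<one>\<^bsub>UP A\<^esub> = (\<lambda>n. if n = 0 then - unit else 0)"
  proof (rule P.minus_equality)
    have "(\<lambda>n. if n = 0 then - unit else 0) \<in> up A"
      by (auto simp: up_def carrier_A_closed unit_carrier bound_def intro!: exI[of _ 0])
    then show "(\<lambda>n. if n = 0 then - unit else 0) \<in> carrier (UP A)"
      "(\<lambda>n. if n = 0 then - unit else 0) \<oplus>\<^bsub>UP A\<^esub> \<one>\<^bsub>UP A\<^esub> = \<zero>\<^bsub>UP A\<^esub>"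
      using A.up_one_closed by (auto simp: UP_def fun_eq_iff)
  qed simp
  moreover have "(\<lambda>n. if n = 0 then - unit else 0) \<in> up A"
    by (auto simp: up_def carrier_A_closed unit_carrier bound_def intro!: exI[of _ 0])
  moreover have "(\<lambda>n. if n = Suc 0 then unit else 0) \<in> up A"
    by (auto simp: up_def carrier_A_closed unit_carrier bound_def intro!: exI[of _ 1])
  ultimately show ?thesis
    by (simp add: t_minus_one_def a_minus_def) (auto simp: UP_def unit_carrier cong: if_cong)
qed

lemma t_minus_one_carrier: "t_minus_one A \<in> carrier At"
  by (auto simp: mem_At_iff t_minus_one_eq carrier_A_closed unit_carrier intro!: exI[of _ 2])

text \<open>All higher \<open>\<mu>\<close> vanish on \<open>unit\<close>, so multiplication by
  \<open>t - 1\<close> is undeformed: shift minus identity.\<close>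

lemma t_minus_one_mult:
  assumes p: "p \<in> carrier At"
  shows "(t_minus_one A \<otimes>\<^bsub>At\<^esub> p) n = (if n = 0 then 0 else p (n - 1)) - p n"
proof -
  let ?c = "\<lambda>i::nat. if i = 0 then - 1 else if i = 1 then 1 else (0 :: 'k)"
  have pA: "p j \<in> carrier A" for j using p by (simp add: mem_At_iff)
  have "(t_minus_one A \<otimes>\<^bsub>At\<^esub> p) n = (\<Sum>i\<le>n. \<Sum>j\<le>n - i. if j = n - i then skew_scale (?c i) (p j) else 0)"
    unfolding At_simps(2)[OF t_minus_one_carrier p] t_minus_one_eq mu_scale(1)[OF unit_carrier pA] mu_unit(1)[OF pA]
    by (intro sum.cong refl) auto
  also have "\<dots> = (\<Sum>i\<le>n. skew_scale (?c i) (p (n - i)))"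
    by (simp add: sum.delta)
  also have "\<dots> = (if n = 0 then 0 else p (n - 1)) - p n"
  proof (cases n)
    case (Suc m)
    have "(\<Sum>i\<le>n. skew_scale (?c i) (p (n - i))) = - p n + (\<Sum>i\<le>m. skew_scale (?c (Suc i)) (p (m - i)))"
      unfolding Suc by (subst sum.atMost_Suc_shift) simp
    also have "(\<Sum>i\<le>m. skew_scale (?c (Suc i)) (p (m - i))) = (\<Sum>i\<le>m. if i = 0 then p m else 0)"
      by (intro sum.cong refl) auto
    finally show ?thesis using Suc by simp
  qed simp
  finally show ?thesis .
qed

lemma kernel_ev: "a_kernel At B ev = {t_minus_one A \<otimes>\<^bsub>At\<^esub> p | p. p \<in> carrier At}"
proof (intro equalityI subsetI)
  interpret At: ring At by (rule ring_At)
  fix x assume "x \<in> {t_minus_one A \<otimes>\<^bsub>At\<^esub> p | p. p \<in> carrier At}"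
  then obtain p where p: "p \<in> carrier At" "x = t_minus_one A \<otimes>\<^bsub>At\<^esub> p" by blast
  have "ev (t_minus_one A) = 0"
    by (subst ev_eq_sum[where N = 2]) (auto simp: t_minus_one_eq numeral_2_eq_2)
  then have "ev x = 0"
    by (simp add: p ev_mult t_minus_one_carrier circ_zero ev_closed)
  then show "x \<in> a_kernel At B ev"
    using p by (simp add: a_kernel_def' t_minus_one_carrier)
next
  fix p assume "p \<in> a_kernel At B ev"
  then have p: "p \<in> carrier At" and ev: "ev p = 0"
    by (auto simp: a_kernel_def')
  obtain N where N: "\<And>n. n \<ge> N \<Longrightarrow> p n = 0"
    using p by (auto simp: mem_At_iff)
  \<comment> \<open>Division by \<open>t - 1\<close> amounts to solving
    \<open>q (n - 1) - q n = p n\<close>. The solution consists of negated partial sums, and these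
    end in zeros because the full sum \<open>ev p\<close> is 0.\<close>
  define q where "q n = - (\<Sum>i<Suc n. p i)" for n
  have "q n = 0" if "n \<ge> N" for n
    using that N ev ev_eq_sum[of "Suc n" p] by (simp add: q_def del: sum.lessThan_Suc)
  then have q: "q \<in> carrier At"
    using p by (auto simp: mem_At_iff q_def carrier_A_closed simp del: sum.lessThan_Suc)
  have "t_minus_one A \<otimes>\<^bsub>At\<^esub> q = p"
    by (rule ext) (auto simp: t_minus_one_mult q q_def gr0_conv_Suc)
  then show "p \<in> {t_minus_one A \<otimes>\<^bsub>At\<^esub> p | p. p \<in> carrier At}"
    using q by blast
qed

lemma fiber_isomorphic_B: "alg_isomorphic (fiber_at_one A \<mu>) B"
proof -
  have "ring_hom_ring At B ev"
    by (intro ring_hom_ringI2 ring_At ring_B ev_hom)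
  then have "(\<lambda>X. the_elem (ev ` X)) \<in> alg_iso (alg_quot At (a_kernel At B ev)) B"
  proof (rule alg_quot_iso)
    show "c \<odot>\<^bsub>At\<^esub> x \<in> carrier At" if "x \<in> carrier At" for c x
      using that by (auto simp: mem_At_iff At_simps carrier_A_closed)
    show "ev (c \<odot>\<^bsub>At\<^esub> x) = c \<odot>\<^bsub>B\<^esub> ev x" if x: "x \<in> carrier At" for c x
    proof -
      obtain N where "\<forall>n\<ge>N. x n = 0" using x by (auto simp: mem_At_iff)
      then show ?thesis
        by (simp add: At_simps ev_eq_sum[where N = N] skew.scale_sum_right)
    qed
  qed (rule ev_surj)
  then show ?thesis
    by (auto simp: alg_isomorphic_def fiber_at_one_def Let_def kernel_ev)
qed

lemma circ_assoc:
  "a \<in> carrier A \<Longrightarrow> b \<in> carrier A \<Longrightarrow> c \<in> carrier A \<Longrightarrow> circ (circ a b) c = circ a (circ b c)"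
  using ring.ring_simprules(11)[OF ring_B] by simp

lemma circ_unit: "a \<in> carrier A \<Longrightarrow> circ unit a = a" "a \<in> carrier A \<Longrightarrow> circ a unit = a"
  using ring.ring_simprules(12)[OF ring_B, of a] monoid.r_one[OF ring.is_monoid[OF ring_B], of a] by simp_all

end

subsection \<open>The presentation of the fiber\<close>

lemma lookup_multiset_exists:
  fixes m :: "'v \<Rightarrow>\<^sub>0 nat"
  shows "\<exists>xs. count (mset xs) = Poly_Mapping.lookup m"
proof -
  have "finite {x. 0 < Poly_Mapping.lookup m x}"
    using finite_lookup[of m] by simp
  then have "count (Abs_multiset (Poly_Mapping.lookup m)) = Poly_Mapping.lookup m"
    by simp
  then show ?thesis
    by (metis ex_mset)
qed

definition mon_list :: "('v \<Rightarrow>\<^sub>0 nat) \<Rightarrow> 'v list"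
  where "mon_list m = (SOME xs. count (mset xs) = Poly_Mapping.lookup m)"

lemma count_mon_list: "count (mset (mon_list m)) = Poly_Mapping.lookup m"
  unfolding mon_list_def by (rule someI_ex) (rule lookup_multiset_exists)

lemma set_mon_list: "set (mon_list m) = Poly_Mapping.keys m"
  by (auto simp: in_keys_iff count_mon_list[symmetric] set_mset_mset[symmetric] simp del: set_mset_mset)

lemma length_mon_list: "length (mon_list m) = mon_degree m"
  using size_multiset_overloaded_eq[of "mset (mon_list m)"]
  by (simp add: mon_degree_def count_mon_list set_mon_list)

lemma mon_list_zero: "mon_list 0 = []"
  using length_mon_list[of 0] by (simp add: mon_degree_def)

definition list_mon :: "'v list \<Rightarrow> 'v \<Rightarrow>\<^sub>0 nat"
  where "list_mon xs = sum_list (map (\<lambda>x. Poly_Mapping.single x 1) xs)"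

lemma list_mon_simps [simp]:
  "list_mon [] = 0" "list_mon (xs @ ys) = list_mon xs + list_mon ys"
  "list_mon [x] = Poly_Mapping.single x 1"
  by (simp_all add: list_mon_def)

lemma lookup_list_mon: "Poly_Mapping.lookup (list_mon xs) = count (mset xs)"
  by (induction xs) (auto simp: list_mon_def lookup_add lookup_single when_def fun_eq_iff)

lemma list_mon_list: "list_mon (mon_list m) = m"
  by (rule poly_mapping_eqI) (simp add: lookup_list_mon count_mon_list)

text \<open>The claim is about multisets only: the arrangements that \<open>mon_list\<close> chooses
  for two monomials are unrelated. \<open>free_word_mset\<close> repairs the discrepancy modulo
  lower degree.\<close>

lemma mset_mon_list_add:
  "mset (mon_list (m + Poly_Mapping.single x 1)) = mset (mon_list m @ [x])"
  by (rule multiset_eqI) (simp add: count_mon_list lookup_add lookup_single when_def)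

lemma mon_degree_add_single: "mon_degree (m + Poly_Mapping.single x 1) = Suc (mon_degree m)"
  using arg_cong[OF mset_mon_list_add[of m x], of size] by (simp add: length_mon_list)

lemma mon_degree_list_mon: "mon_degree (list_mon xs) = length xs"
  by (induction xs rule: rev_induct) (simp_all add: mon_degree_add_single del: One_nat_def, simp add: mon_degree_eq_0_iff)

lemma keys_list_mon: "Poly_Mapping.keys (list_mon xs) = set xs"
  by (auto simp: in_keys_iff lookup_list_mon set_mset_mset[symmetric] simp del: set_mset_mset)

lemma skew_of_group_alg_sum:
  "skew_of_group_alg a = (\<Sum>g\<in>Poly_Mapping.keys a. skew_scale (Poly_Mapping.lookup a g) (skew_monom g 0))"
  by (rule skew_eqI)
    (auto simp: skew_coeff_monom skew_coeff_def[of "skew_of_group_alg a"] lookup_skew_of_group_alg lookup_single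
      when_def in_keys_iff if_distrib cong: if_cong)

abbreviation free_word :: "'x list \<Rightarrow> ('x word \<Rightarrow>\<^sub>0 'k::field)"
  where "free_word xs \<equiv> Poly_Mapping.single (Word xs) 1"

lemma free_word_append: "free_word (xs @ ys) = free_word xs * free_word ys"
  by (simp add: mult_single plus_word_def)

lemma single_eq_pm_scale: "Poly_Mapping.single w c = pm_scale c (free_word (letters w))"
  by (simp add: pm_scale_single)

lemma vec_degree_simps [simp]:
  "vec_degree (Word []) = 0" "vec_degree (Word (Inl b # xs)) = Suc (vec_degree (Word xs))"
  "vec_degree (Word (Inr g # xs)) = vec_degree (Word xs)"
  "vec_degree (Word (xs @ ys)) = vec_degree (Word xs) + vec_degree (Word ys)"
  "vec_degree (Word (map Inl bs)) = length bs"
  "vec_degree (u + v) = vec_degree u + vec_degree v"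
  by (simp_all add: vec_degree_def plus_word_def filter_map o_def)

lemma free_group_alg_elt: "free_group_alg (group_elt g) = free_word [Inr g]"
  by (simp add: free_group_alg_def group_elt_def)

locale deformed_skew_parameters = deformed_skew scale Basis G \<rho> \<mu>
  for scale :: "'k::field \<Rightarrow> 'v::ab_group_add \<Rightarrow> 'v"
    and Basis :: "'v set"
    and G :: "'g monoid"
    and \<rho> :: "'g \<Rightarrow> 'v \<Rightarrow> 'v"
    and \<mu> :: "nat \<Rightarrow> ('g, 'v, 'k) skew \<Rightarrow> ('g, 'v, 'k) skew \<Rightarrow> ('g, 'v, 'k) skew" +
  fixes lam :: "('g \<Rightarrow>\<^sub>0 'k) \<Rightarrow> 'v \<Rightarrow> ('g \<Rightarrow>\<^sub>0 'k)"
    and kap :: "'v \<Rightarrow> 'v \<Rightarrow> ('g \<Rightarrow>\<^sub>0 'k)"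
  assumes mu_1_vec: "\<And>v w. \<mu> 1 (skew_vec G scale Basis v) (skew_vec G scale Basis w) = 0"
    and parameters: "H_parameters G scale lam kap"
    and lam_eq: "\<And>g v. g \<in> carrier G \<Longrightarrow>
      skew_of_group_alg (lam (group_elt g) v) =
        \<mu> 1 (skew_of_group_alg (group_elt g)) (skew_vec G scale Basis v) -
        \<mu> 1 (skew_vec G scale Basis (\<rho> g v)) (skew_of_group_alg (group_elt g))"
    and kap_eq: "\<And>v w. skew_of_group_alg (kap v w) =
        \<mu> 2 (skew_vec G scale Basis v) (skew_vec G scale Basis w) -
        \<mu> 2 (skew_vec G scale Basis w) (skew_vec G scale Basis v)"
begin

section \<open>The free algebra, its filtration and the ideal of relations\<close>

abbreviation "X \<equiv> Basis <+> carrier G"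
abbreviation F :: "('k, ('g, 'v, 'k) free_VG) module" where "F \<equiv> free_alg X"
abbreviation I where "I \<equiv> H_ideal G scale Basis \<rho> lam kap"
abbreviation vec :: "'v \<Rightarrow> ('g, 'v, 'k) skew" where "vec \<equiv> skew_vec G scale Basis"

definition F_below :: "nat \<Rightarrow> ('g, 'v, 'k) free_VG set"
  where "F_below d = {p \<in> carrier F. \<forall>w \<in> Poly_Mapping.keys p. vec_degree w < d}"

lemma F_simps [simp]:
  "mult F = (*)" "one F = 1" "zero F = 0" "add F = (+)" "smult F = pm_scale"
  by (simp_all add: free_alg_def)

sublocale F: ring F by (rule ring_free_alg)

lemma mem_F_iff: "p \<in> carrier F \<longleftrightarrow> (\<forall>w. Poly_Mapping.lookup p w \<noteq> 0 \<longrightarrow> set (letters w) \<subseteq> X)"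
  by (auto simp: free_alg_def in_keys_iff)

lemma mem_F_below_iff:
  "p \<in> F_below d \<longleftrightarrow> (\<forall>w. Poly_Mapping.lookup p w \<noteq> 0 \<longrightarrow> set (letters w) \<subseteq> X \<and> vec_degree w < d)"
  by (auto simp: F_below_def mem_F_iff in_keys_iff)

lemma F_below_closed:
  "0 \<in> F_below d"
  "p \<in> F_below d \<Longrightarrow> q \<in> F_below d \<Longrightarrow> p + q \<in> F_below d"
  "p \<in> F_below d \<Longrightarrow> q \<in> F_below d \<Longrightarrow> p - q \<in> F_below d"
  "p \<in> F_below d \<Longrightarrow> pm_scale c p \<in> F_below d"
  unfolding mem_F_below_iff lookup_add lookup_minus lookup_pm_scale lookup_zero
  by (metis add_0 diff_0_right mult_zero_right)+

lemma F_below_mono: "p \<in> F_below d \<Longrightarrow> d \<le> e \<Longrightarrow> p \<in> F_below e"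
  by (auto simp: F_below_def)

lemma F_below_carrier: "p \<in> F_below d \<Longrightarrow> p \<in> carrier F"
  by (simp add: F_below_def)

lemma F_carrier_closed:
  "0 \<in> carrier F" "1 \<in> carrier F"
  "p \<in> carrier F \<Longrightarrow> q \<in> carrier F \<Longrightarrow> p + q \<in> carrier F"
  "p \<in> carrier F \<Longrightarrow> q \<in> carrier F \<Longrightarrow> p * q \<in> carrier F"
  "p \<in> carrier F \<Longrightarrow> q \<in> carrier F \<Longrightarrow> p - q \<in> carrier F"
  "p \<in> carrier F \<Longrightarrow> pm_scale c p \<in> carrier F"
proof -
  show "p \<in> carrier F \<Longrightarrow> q \<in> carrier F \<Longrightarrow> p - q \<in> carrier F"
    unfolding mem_F_iff lookup_minus by (metis diff_0_right)
  show "p \<in> carrier F \<Longrightarrow> pm_scale c p \<in> carrier F"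
    by (simp add: mem_F_iff lookup_pm_scale)
qed (use F.zero_closed F.one_closed F.a_closed[of p q] F.m_closed[of p q] in simp_all)

lemma F_below_bounded: "p \<in> carrier F \<Longrightarrow> \<exists>d. p \<in> F_below d"
proof -
  assume p: "p \<in> carrier F"
  have "finite (vec_degree ` Poly_Mapping.keys p)" by simp
  then obtain d where "\<forall>n \<in> vec_degree ` Poly_Mapping.keys p. n < d"
    using finite_nat_set_iff_bounded by blast
  with p show ?thesis by (auto simp: F_below_def)
qed

text \<open>Degree below d times degree at most e. With the shift on one factor only,
  \<open>d = 0\<close> is covered as well, the first factor being 0 there.\<close>

lemma F_below_mult:
  assumes "p \<in> F_below d" "q \<in> F_below (Suc e)"
  shows "p * q \<in> F_below (d + e)"
proof -
  have "vec_degree w < d + e" if "w \<in> Poly_Mapping.keys (p * q)" for w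
    using that keys_mult[of p q] assms by (fastforce simp: F_below_def)
  then show ?thesis
    using assms F_carrier_closed(4) by (simp add: F_below_def)
qed

lemma free_word_F_below: "set xs \<subseteq> X \<Longrightarrow> vec_degree (Word xs) < d \<Longrightarrow> free_word xs \<in> F_below d"
  by (auto simp: F_below_def free_alg_def)

lemma free_word_carrier: "set xs \<subseteq> X \<Longrightarrow> free_word xs \<in> carrier F"
  by (auto simp: free_alg_def)

lemma free_group_alg_F_below: "a \<in> group_alg_carrier G \<Longrightarrow> free_group_alg a \<in> F_below 1"
proof -
  assume a: "a \<in> group_alg_carrier G"
  have "(\<Sum>g\<in>K. Poly_Mapping.single (Word [Inr g]) (Poly_Mapping.lookup a g)) \<in> F_below 1" if "K \<subseteq> Poly_Mapping.keys a" for K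
    using that a
    by (induction K rule: infinite_finite_induct)
      (auto simp: F_below_closed group_alg_carrier_def single_eq_pm_scale[of _ "Poly_Mapping.lookup a _"]
        intro!: F_below_closed free_word_F_below)
  then show ?thesis by (simp add: free_group_alg_def)
qed

lemma free_vec_F_below: "free_vec scale Basis v \<in> F_below 2"
proof -
  have "(\<Sum>b\<in>K. Poly_Mapping.single (Word [Inl b]) (V.representation Basis v b)) \<in> F_below 2" if "K \<subseteq> Basis" for K
    using that
    by (induction K rule: infinite_finite_induct)
      (auto simp: F_below_closed single_eq_pm_scale[of _ "V.representation Basis v _"] intro!: F_below_closed free_word_F_below)
  then show ?thesis by (simp add: free_vec_def)
qed

lemma free_vec_Basis: "b \<in> Basis \<Longrightarrow> free_vec scale Basis b = free_word [Inl b]"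
  by (simp add: free_vec_def V.representation_basis[OF V.independent_Basis] if_distrib V.finite_Basis cong: if_cong)

lemma lam_kap_carrier:
  "g \<in> carrier G \<Longrightarrow> lam (group_elt g) v \<in> group_alg_carrier G" "kap v w \<in> group_alg_carrier G"
proof -
  show "kap v w \<in> group_alg_carrier G"
    using parameters unfolding H_parameters_def by blast
  show "lam (group_elt g) v \<in> group_alg_carrier G" if "g \<in> carrier G"
  proof -
    have "group_elt g \<in> group_alg_carrier G"
      using that by (simp add: group_elt_def group_alg_carrier_def)
    then show ?thesis
      using parameters unfolding H_parameters_def by blast
  qed
qed

lemma rho_carrier_one: "\<rho> \<one>\<^bsub>G\<^esub> v = v"
  using group_action.id_eq_one[OF action] by (metis UNIV_I restrict_apply')

lemma H_relations_carrier: "H_relations G scale Basis \<rho> lam kap \<subseteq> carrier F"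
proof -
  have "free_group_alg (group_elt g) \<in> carrier F" if "g \<in> carrier G" for g
    using that by (auto simp: free_group_alg_elt intro!: free_word_carrier)
  moreover have "free_group_alg a \<in> carrier F" if "a \<in> group_alg_carrier G" for a
    using free_group_alg_F_below[OF that] by (rule F_below_carrier)
  moreover have "free_vec scale Basis v \<in> carrier F" for v
    using free_vec_F_below by (rule F_below_carrier)
  ultimately show ?thesis
    unfolding H_relations_def Let_def
    by (auto intro!: F_carrier_closed lam_kap_carrier)
qed

sublocale I: ideal I F
  unfolding H_ideal_def by (rule F.genideal_ideal[OF H_relations_carrier])

lemma H_relations_I: "p \<in> H_relations G scale Basis \<rho> lam kap \<Longrightarrow> p \<in> I"
  unfolding H_ideal_def using F.genideal_self[OF H_relations_carrier] by blast

lemma I_relations: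
  "free_word [Inr \<one>\<^bsub>G\<^esub>] - 1 \<in> I"
  "g \<in> carrier G \<Longrightarrow> h \<in> carrier G \<Longrightarrow>
    free_word [Inr g] * free_word [Inr h] - free_word [Inr (g \<otimes>\<^bsub>G\<^esub> h)] \<in> I"
  "free_vec scale Basis v * free_vec scale Basis w - free_vec scale Basis w * free_vec scale Basis v
    - free_group_alg (kap v w) \<in> I"
  "g \<in> carrier G \<Longrightarrow> free_word [Inr g] * free_vec scale Basis v
    - free_vec scale Basis (\<rho> g v) * free_word [Inr g] - free_group_alg (lam (group_elt g) v) \<in> I"
  by (rule H_relations_I, force simp: H_relations_def free_group_alg_elt Let_def)+

lemma I_closed:
  "0 \<in> I" "p \<in> I \<Longrightarrow> q \<in> I \<Longrightarrow> p + q \<in> I" "p \<in> I \<Longrightarrow> q \<in> carrier F \<Longrightarrow> p * q \<in> I"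
  "p \<in> I \<Longrightarrow> q \<in> carrier F \<Longrightarrow> q * p \<in> I" "p \<in> I \<Longrightarrow> pm_scale c p \<in> I"
proof -
  show mul: "p \<in> I \<Longrightarrow> q \<in> carrier F \<Longrightarrow> q * p \<in> I" for p q
    using I.I_l_closed[of p q] by simp
  \<comment> \<open>A ring ideal is stable under multiplication by ring elements; scaling is
    multiplication by the element \<open>pm_scale c 1\<close> of the free algebra.\<close>
  have "pm_scale c 1 \<in> carrier F" by (intro F_carrier_closed)
  then show "p \<in> I \<Longrightarrow> pm_scale c p \<in> I"
    using mul[of p "pm_scale c 1"] by (simp add: pm_scale_mult_left)
qed (use I.zero_closed I.a_closed[of p q] I.I_r_closed[of p q] in simp_all)

subsubsection \<open>The homomorphism onto the fiber\<close>

fun gen :: "'v + 'g \<Rightarrow> ('g, 'v, 'k) skew"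
  where "gen (Inl b) = skew_monom \<one>\<^bsub>G\<^esub> (Poly_Mapping.single b 1)"
  | "gen (Inr g) = skew_monom g 0"

text \<open>Folding from the left makes appending a letter a single multiplication on the right by a
  generator, which suits \<open>rev_induct\<close>.\<close>

definition word_val :: "('v + 'g) list \<Rightarrow> ('g, 'v, 'k) skew"
  where "word_val xs = foldl (\<lambda>a x. circ a (gen x)) unit xs"

definition phi :: "('g, 'v, 'k) free_VG \<Rightarrow> ('g, 'v, 'k) skew"
  where "phi p = (\<Sum>w\<in>Poly_Mapping.keys p. skew_scale (Poly_Mapping.lookup p w) (word_val (letters w)))"

lemma gen_below: "x \<in> X \<Longrightarrow> gen x \<in> below (Suc (vec_degree (Word [x])))"
  by (cases x)
    (auto intro!: skew_monom_supp simp: mon_degree_list_mon[of "[_]", simplified] mon_degree_eq_0_iff[THEN iffD2] split: if_splits)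

lemma word_val_simps [simp]:
  "word_val [] = unit" "word_val (xs @ [x]) = circ (word_val xs) (gen x)"
  by (simp_all add: word_val_def)

lemma word_val_below: "set xs \<subseteq> X \<Longrightarrow> word_val xs \<in> below (Suc (vec_degree (Word xs)))"
proof (induction xs rule: rev_induct)
  case Nil
  show ?case
    by (auto intro!: skew_monom_supp simp: mon_degree_eq_0_iff[THEN iffD2])
next
  case (snoc x xs)
  then show ?case
    using circ_filtered(1)[OF snoc.IH gen_below[of x]] by (auto elim!: skew_supp_mono)
qed

lemma word_val_carrier: "set xs \<subseteq> X \<Longrightarrow> word_val xs \<in> carrier A"
  using word_val_below supp_carrier by blast

lemma gen_carrier: "x \<in> X \<Longrightarrow> gen x \<in> carrier A"
  using gen_below supp_carrier by blast

lemma word_val_append: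
  "set xs \<subseteq> X \<Longrightarrow> set ys \<subseteq> X \<Longrightarrow> word_val (xs @ ys) = circ (word_val xs) (word_val ys)"
proof (induction ys rule: rev_induct)
  case (snoc y ys)
  have "word_val (xs @ ys @ [y]) = circ (word_val (xs @ ys)) (gen y)"
    using word_val_simps(2)[of "xs @ ys" y] by simp
  then show ?case
    using snoc by (simp add: circ_assoc word_val_carrier gen_carrier)
qed (simp add: circ_unit word_val_carrier)

lemma phi_superset:
  assumes "finite S" "Poly_Mapping.keys p \<subseteq> S"
  shows "phi p = (\<Sum>w\<in>S. skew_scale (Poly_Mapping.lookup p w) (word_val (letters w)))"
  unfolding phi_def by (rule sum.mono_neutral_left) (use assms in \<open>auto simp: in_keys_iff\<close>)

lemma phi_add: "phi (p + q) = phi p + phi q"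
proof -
  let ?S = "Poly_Mapping.keys p \<union> Poly_Mapping.keys q"
  have "phi r = (\<Sum>w\<in>?S. skew_scale (Poly_Mapping.lookup r w) (word_val (letters w)))" if "r \<in> {p, q, p + q}" for r
    using that keys_add[of p q] by (intro phi_superset) auto
  then show ?thesis
    by (simp add: lookup_add skew.scale_left_distrib sum.distrib)
qed

lemma phi_scale: "phi (pm_scale c p) = skew_scale c (phi p)"
proof -
  have "phi (pm_scale c p) = (\<Sum>w\<in>Poly_Mapping.keys p. skew_scale (Poly_Mapping.lookup (pm_scale c p) w) (word_val (letters w)))"
    by (rule phi_superset) (auto simp: in_keys_iff lookup_pm_scale)
  then show ?thesis
    by (simp add: phi_def lookup_pm_scale skew.scale_sum_right)
qed

lemma phi_zero: "phi 0 = 0"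
  by (simp add: phi_def)

lemma phi_diff: "phi (p - q) = phi p - phi q"
  using phi_add[of "p - q" q] by simp

lemma phi_sum: "phi (sum f S) = (\<Sum>i\<in>S. phi (f i))"
  by (induction S rule: infinite_finite_induct) (simp_all add: phi_zero phi_add)

lemma phi_word: "phi (free_word xs) = word_val xs"
  by (simp add: phi_def)

lemma phi_below: "p \<in> F_below d \<Longrightarrow> phi p \<in> below d"
  unfolding phi_def
proof (intro skew_supp_sum skew_supp_scale)
  fix w assume "p \<in> F_below d" "w \<in> Poly_Mapping.keys p"
  then have "set (letters w) \<subseteq> X" "vec_degree w < d"
    by (auto simp: mem_F_below_iff in_keys_iff)
  then show "word_val (letters w) \<in> below d"
    using word_val_below[of "letters w"] by (auto elim!: skew_supp_mono)
qed

lemma phi_carrier: "p \<in> carrier F \<Longrightarrow> phi p \<in> carrier A"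
  using F_below_bounded phi_below supp_carrier by blast

lemma phi_mult:
  assumes p: "p \<in> carrier F" and q: "q \<in> carrier F"
  shows "phi (p * q) = circ (phi p) (phi q)"
proof -
  let ?s = "\<lambda>p :: ('g, 'v, 'k) free_VG. \<Sum>w\<in>Poly_Mapping.keys p. pm_scale (Poly_Mapping.lookup p w) (free_word (letters w))"
  have s: "?s r = r" for r :: "('g, 'v, 'k) free_VG"
    using poly_mapping_sum_single[of r] by (simp add: single_eq_pm_scale[of _ "Poly_Mapping.lookup r _"])
  have X: "set (letters w) \<subseteq> X" if "w \<in> Poly_Mapping.keys p \<or> w \<in> Poly_Mapping.keys q" for w
    using that p q by (auto simp: free_alg_def)
  have "p * q = ?s p * ?s q"
    by (simp only: s)
  also have "phi \<dots> = (\<Sum>u\<in>Poly_Mapping.keys p. \<Sum>w\<in>Poly_Mapping.keys q.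
      skew_scale (Poly_Mapping.lookup p u) (skew_scale (Poly_Mapping.lookup q w) (word_val (letters u @ letters w))))"
    unfolding sum_product pm_scale_mult_left pm_scale_mult_right free_word_append[symmetric]
    by (simp only: phi_sum phi_scale phi_word skew.scale_left_commute)
  also have "\<dots> = (\<Sum>u\<in>Poly_Mapping.keys p. \<Sum>w\<in>Poly_Mapping.keys q.
      circ (skew_scale (Poly_Mapping.lookup p u) (word_val (letters u))) (skew_scale (Poly_Mapping.lookup q w) (word_val (letters w))))"
    by (intro sum.cong refl) (simp add: X word_val_append circ_scale word_val_carrier carrier_A_closed)
  also have "\<dots> = circ (phi p) (phi q)"
    unfolding phi_def by (simp add: X circ_sum word_val_carrier carrier_A_closed) (rule sum.swap)
  finally show ?thesis .
qed

lemma phi_hom: "phi \<in> ring_hom F B"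
proof (rule ring_hom_memI)
  have "phi (free_word []) = unit"
    by (simp add: phi_word)
  then show "phi \<one>\<^bsub>F\<^esub> = \<one>\<^bsub>B\<^esub>"
    by (simp flip: zero_word_def)
qed (simp_all add: phi_carrier phi_mult phi_add)

lemma phi_ring_hom_ring: "ring_hom_ring F B phi"
  by (intro ring_hom_ringI2 ring_free_alg ring_B phi_hom)

lemma vec_eq_sum: "vec v = (\<Sum>b\<in>Basis. skew_scale (V.representation Basis v b) (gen (Inl b)))"
  by (rule skew_eqI)
    (auto simp: skew_coeff_monom skew_vec_def skew_coeff_single sym_vec_def lookup_sum lookup_single when_def
      intro!: sum.cong)

lemma phi_free_vec: "phi (free_vec scale Basis v) = vec v"
proof -
  have "word_val [Inl b] = gen (Inl b)" if "b \<in> Basis" for b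
    using word_val_simps(2)[of "[]" "Inl b"] gen_carrier[OF InlI[OF that]]
    by (simp add: circ_unit del: gen.simps)
  then show ?thesis
    by (simp add: free_vec_def vec_eq_sum phi_sum single_eq_pm_scale[of _ "V.representation Basis v _"] phi_scale phi_word
      del: gen.simps)
qed

lemma word_val_Inr: "g \<in> carrier G \<Longrightarrow> word_val [Inr g] = skew_monom g 0"
  using word_val_simps(2)[of "[]" "Inr g"] gen_carrier[OF InrI, of g] by (simp add: circ_unit)

lemma phi_free_group_alg:
  assumes "a \<in> group_alg_carrier G"
  shows "phi (free_group_alg a) = skew_of_group_alg a"
proof -
  have "g \<in> carrier G" if "g \<in> Poly_Mapping.keys a" for g
    using assms that by (auto simp: group_alg_carrier_def)
  then show ?thesis
    by (simp add: free_group_alg_def skew_of_group_alg_sum phi_sum single_eq_pm_scale[of _ "Poly_Mapping.lookup a _"]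
        phi_scale phi_word word_val_Inr)
qed

lemma mult_monom_group:
  "g \<in> carrier G \<Longrightarrow> h \<in> carrier G \<Longrightarrow> skew_monom g m \<otimes>\<^bsub>A\<^esub> skew_monom h 0 = skew_monom (g \<otimes>\<^bsub>G\<^esub> h) m"
  by (simp add: skew_monom_def skew_mult_single sym_map_one)

lemma mult_group_vec:
  "g \<in> carrier G \<Longrightarrow> skew_monom g 0 \<otimes>\<^bsub>A\<^esub> vec v = Poly_Mapping.single g (sym_vec scale Basis (\<rho> g v))"
  by (simp add: skew_monom_def skew_vec_def skew_mult_single V.sym_map_vec linear)

lemma mult_single_vec:
  "Poly_Mapping.single \<one>\<^bsub>G\<^esub> p \<otimes>\<^bsub>A\<^esub> vec v = Poly_Mapping.single \<one>\<^bsub>G\<^esub> (p * sym_vec scale Basis v)"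
  by (simp add: skew_vec_def skew_mult_single V.sym_map_vec linear rho_carrier_one)

lemma gen_Inl_vec: "b \<in> Basis \<Longrightarrow> gen (Inl b) = vec b"
  by (simp add: skew_monom_def skew_vec_def sym_vec_def V.representation_basis[OF V.independent_Basis]
      V.finite_Basis if_distrib cong: if_cong)

lemma vec_below: "vec v \<in> below 2"
  using G.skew_vec_component[of scale Basis v] unfolding skew_component_eq_supp
  by (rule skew_supp_mono) simp

lemma group_below: "g \<in> carrier G \<Longrightarrow> skew_monom g 0 \<in> below 1"
  by (rule skew_monom_supp) (simp_all add: mon_degree_eq_0_iff)

lemmas mu_0_below = mu_0[OF supp_carrier supp_carrier]

lemma supp_False_eq_0: "a \<in> supp P \<Longrightarrow> (\<And>e. \<not> P e) \<Longrightarrow> a = 0"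
  using skew_supp_inter_eq_0[of a G Basis P P] by blast

text \<open>Total degree 0 leaves room for \<open>\<mu> 0\<close> only: the bound
  \<open>e + 2 < 1 + 1\<close> on the rest is unsatisfiable.\<close>

lemma circ_group_group:
  assumes "g \<in> carrier G" "h \<in> carrier G"
  shows "circ (skew_monom g 0) (skew_monom h 0) = skew_monom (g \<otimes>\<^bsub>G\<^esub> h) 0"
  using supp_False_eq_0[OF circ_filtered(2)[OF group_below[OF assms(1)] group_below[OF assms(2)]]]
    mu_0_below[OF group_below[OF assms(1)] group_below[OF assms(2)]] mult_monom_group[OF assms]
  by simp

text \<open>Total degree 1 leaves \<open>\<mu> 0\<close> and \<open>\<mu> 1\<close>. The
  \<open>\<mu> 0\<close> parts agree because moving g past v in \<open>A\<close> just applies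
  \<open>\<rho> g\<close> to v, and the difference of the \<open>\<mu> 1\<close> parts is
  \<open>lam_eq\<close>.\<close>

lemma circ_group_vec:
  assumes "g \<in> carrier G"
  shows "circ (skew_monom g 0) (vec v) - circ (vec (\<rho> g v)) (skew_monom g 0) = skew_of_group_alg (lam (group_elt g) v)"
proof -
  let ?g = "skew_monom g 0" and ?w = "vec (\<rho> g v)"
  have "circ ?g (vec v) = \<mu> 0 ?g (vec v) + \<mu> 1 ?g (vec v)"
    using supp_False_eq_0[OF circ_filtered(3)[OF group_below[OF assms] vec_below[of v]]] by (simp add: diff_diff_eq)
  moreover have "circ ?w ?g = \<mu> 0 ?w ?g + \<mu> 1 ?w ?g"
    using supp_False_eq_0[OF circ_filtered(3)[OF vec_below[of "\<rho> g v"] group_below[OF assms]]] by (simp add: diff_diff_eq)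
  moreover have "\<mu> 0 ?g (vec v) = \<mu> 0 ?w ?g"
    using assms mu_0_below[OF group_below[OF assms] vec_below] mu_0_below[OF vec_below group_below[OF assms]]
    by (simp add: mult_group_vec) (simp add: skew_monom_def skew_vec_def skew_mult_single sym_map_one)
  ultimately show ?thesis
    by (simp add: lam_eq[OF assms] skew_of_group_elt)
qed

text \<open>Total degree 2 leaves three maps: \<open>\<mu> 1\<close> vanishes by hypothesis,
  \<open>\<mu> 0\<close> is symmetric on vectors because S(V) is commutative, and
  \<open>\<mu> 2\<close> contributes \<open>kap\<close>.\<close>

lemma circ_vec_vec: "circ (vec v) (vec w) - circ (vec w) (vec v) = skew_of_group_alg (kap v w)"
proof -
  have *: "circ (vec v) (vec w) = \<mu> 0 (vec v) (vec w) + \<mu> 2 (vec v) (vec w)" for v w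
    using supp_False_eq_0[OF circ_filtered(4)[OF vec_below[of v] vec_below[of w]]] mu_1_vec[of v w]
    by (simp add: diff_diff_eq)
  have "vec v \<otimes>\<^bsub>A\<^esub> vec w = Poly_Mapping.single \<one>\<^bsub>G\<^esub> (sym_vec scale Basis v * sym_vec scale Basis w)" for v w
    using mult_single_vec[of "sym_vec scale Basis v" w] by (simp add: skew_vec_def)
  then have "\<mu> 0 (vec v) (vec w) = \<mu> 0 (vec w) (vec v)"
    by (simp add: mu_0_below[OF vec_below vec_below] mult.commute)
  then show ?thesis
    by (simp add: * kap_eq)
qed

text \<open>The ideal is the smallest one containing the relations, so it is enough that these hold
  between the generators of \<open>B\<close>.\<close>

lemma I_subset_kernel: "I \<subseteq> a_kernel F B phi"
  unfolding H_ideal_def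
proof (rule F.genideal_minimal)
  show "ideal (a_kernel F B phi) F"
    by (rule ring_hom_ring.kernel_is_ideal[OF phi_ring_hom_ring])
  have "phi p = 0" if "p \<in> H_relations G scale Basis \<rho> lam kap" for p
  proof -
    have gr: "free_word [Inr g] \<in> carrier F" if "g \<in> carrier G" for g
      using that by (auto intro!: free_word_carrier)
    have phi_gr: "phi (free_word [Inr g]) = skew_monom g 0" if "g \<in> carrier G" for g
      using that by (simp add: phi_word word_val_Inr)
    have phi1: "phi 1 = unit"
      using phi_word[of "[]"] by (simp flip: zero_word_def)
    note fv = F_below_carrier[OF free_vec_F_below]
    show ?thesis
      using that unfolding H_relations_def Let_def free_group_alg_elt Un_iff mem_Collect_eq singleton_iff
      by (elim disjE exE conjE)
        (simp_all add: phi_diff phi_mult phi_gr gr fv phi1 phi_free_vec phi_free_group_alg lam_kap_carrier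
          circ_group_group circ_group_vec circ_vec_vec)
  qed
  note phi_rel = this
  show "H_relations G scale Basis \<rho> lam kap \<subseteq> a_kernel F B phi"
  proof
    fix p assume p: "p \<in> H_relations G scale Basis \<rho> lam kap"
    show "p \<in> a_kernel F B phi"
      using subsetD[OF H_relations_carrier p] phi_rel[OF p] by (simp add: a_kernel_def')
  qed
qed

lemma phi_I: "p \<in> I \<Longrightarrow> phi p = 0"
  using I_subset_kernel by (auto simp: a_kernel_def')

subsubsection \<open>Leading terms\<close>

text \<open>These words are the Poincare-Birkhoff-Witt monomials. No order on the basis is fixed:
  \<^const>\<open>mon_list\<close> picks one arrangement of every monomial.\<close>

definition nf_word :: "('v \<Rightarrow>\<^sub>0 nat) \<Rightarrow> 'g \<Rightarrow> ('v + 'g) list"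
  where "nf_word m g = map Inl (mon_list m) @ [Inr g]"

lemma nf_word_X: "g \<in> carrier G \<Longrightarrow> Poly_Mapping.keys m \<subseteq> Basis \<Longrightarrow> set (nf_word m g) \<subseteq> X"
  by (auto simp: nf_word_def set_mon_list)

lemma vec_degree_nf_word: "vec_degree (Word (nf_word m g)) = mon_degree m"
  by (simp add: nf_word_def length_mon_list)

lemma monom_below: "g \<in> carrier G \<Longrightarrow> Poly_Mapping.keys m \<subseteq> Basis \<Longrightarrow> skew_monom g m \<in> below (Suc (mon_degree m))"
  by (rule skew_monom_supp) simp_all

text \<open>Split \<open>circ a c\<close> into \<open>circ (a - b) c\<close> and
  \<open>circ b c\<close>. The left factor of the first is of too small degree, and the second
  differs from the product in \<open>A\<close> by values of the higher \<open>\<mu>\<close>, which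
  lose degree. Leading terms can thus be multiplied one factor at a time.\<close>

lemma circ_lead:
  assumes "a - b \<in> below d" "b \<in> below (Suc d)" "c \<in> below (Suc e)"
  shows "circ a c - (b \<otimes>\<^bsub>A\<^esub> c) \<in> below (d + e)"
proof -
  have car: "a - b \<in> carrier A" "b \<in> carrier A" "c \<in> carrier A"
    using assms supp_carrier by blast+
  have "circ a c - (b \<otimes>\<^bsub>A\<^esub> c) = circ (a - b) c + (circ b c - \<mu> 0 b c)"
    using car carrier_A_closed(2)[OF car(1,2)] by (simp add: circ_diff mu_0)
  moreover have "circ (a - b) c \<in> below (d + e)"
    using circ_filtered(1)[OF assms(1,3)] by (auto elim!: skew_supp_mono)
  moreover have "circ b c - \<mu> 0 b c \<in> below (d + e)"
    using circ_filtered(2)[OF assms(2,3)] by (auto elim!: skew_supp_mono)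
  ultimately show ?thesis
    by (simp add: skew_supp_add)
qed

text \<open>The leading term forgets the order of the letters, being computed in the commutative
  algebra S(V).\<close>

lemma word_val_Inl_lead:
  "set xs \<subseteq> Basis \<Longrightarrow> word_val (map Inl xs) - skew_monom \<one>\<^bsub>G\<^esub> (list_mon xs) \<in> below (length xs)"
proof (induction xs rule: rev_induct)
  case Nil
  then show ?case by (simp add: skew_supp_zero)
next
  case (snoc x xs)
  have "skew_monom \<one>\<^bsub>G\<^esub> (list_mon xs) \<in> below (Suc (length xs))"
    using monom_below[of "\<one>\<^bsub>G\<^esub>" "list_mon xs"] snoc.prems by (simp add: keys_list_mon mon_degree_list_mon)
  moreover have "gen (Inl x) \<in> below (Suc 1)"
    using gen_below[of "Inl x"] snoc.prems by auto
  ultimately have "circ (word_val (map Inl xs)) (gen (Inl x)) - (skew_monom \<one>\<^bsub>G\<^esub> (list_mon xs) \<otimes>\<^bsub>A\<^esub> gen (Inl x)) \<in> below (length xs + 1)"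
    using snoc by (intro circ_lead) auto
  moreover have "skew_monom \<one>\<^bsub>G\<^esub> (list_mon xs) \<otimes>\<^bsub>A\<^esub> gen (Inl x) = skew_monom \<one>\<^bsub>G\<^esub> (list_mon (xs @ [x]))"
  proof -
    have "x \<in> Basis" using snoc.prems by simp
    then have "sym_vec scale Basis x = Poly_Mapping.single (Poly_Mapping.single x 1) 1"
      by (simp add: sym_vec_def V.representation_basis[OF V.independent_Basis] V.finite_Basis if_distrib cong: if_cong)
    then show ?thesis
      using \<open>x \<in> Basis\<close> by (simp add: gen_Inl_vec skew_monom_def mult_single_vec mult_single del: gen.simps)
  qed
  ultimately show ?case
    by (simp del: gen.simps)
qed

lemma word_val_nf_word_lead:
  assumes "g \<in> carrier G" "Poly_Mapping.keys m \<subseteq> Basis"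
  shows "word_val (nf_word m g) - skew_monom g m \<in> below (mon_degree m)"
proof -
  have "word_val (map Inl (mon_list m)) - skew_monom \<one>\<^bsub>G\<^esub> m \<in> below (mon_degree m)"
    using word_val_Inl_lead[of "mon_list m"] assms by (simp add: set_mon_list list_mon_list length_mon_list)
  then have "circ (word_val (map Inl (mon_list m))) (skew_monom g 0) - (skew_monom \<one>\<^bsub>G\<^esub> m \<otimes>\<^bsub>A\<^esub> skew_monom g 0)
      \<in> below (mon_degree m + 0)"
    using monom_below[of "\<one>\<^bsub>G\<^esub>" m] group_below assms by (intro circ_lead) auto
  then show ?thesis
    using assms by (simp add: nf_word_def mult_monom_group)
qed

text \<open>Equality, not just inclusion, later identifies the filtration of \<open>H\<close> with
  the degree filtration of \<open>A\<close>. A monomial is the image of its normal word up to lower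
  terms, and these have preimages of smaller degree by induction.\<close>

lemma phi_image_below: "phi ` F_below d = below d"
proof (intro equalityI subsetI)
  show "a \<in> below d" if "a \<in> phi ` F_below d" for a
    using that phi_below by blast
  show "a \<in> phi ` F_below d" if "a \<in> below d" for a
    using that
  proof (induction d arbitrary: a)
    case 0
    then show ?case
      using supp_False_eq_0[of a "\<lambda>e. e < 0"] F_below_closed(1) phi_zero by force
  next
    case (Suc d)
    from Suc.prems show ?case
    proof (induction rule: skew_supp_induct)
      case (add a b)
      then obtain p q where "a = phi p" "b = phi q" "p \<in> F_below (Suc d)" "q \<in> F_below (Suc d)"
        by blast
      then show ?case by (intro image_eqI[of _ _ "p + q"]) (simp_all add: phi_add F_below_closed)
    next
      case (scale c a)
      then obtain p where "a = phi p" "p \<in> F_below (Suc d)"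
        by blast
      then show ?case by (intro image_eqI[of _ _ "pm_scale c p"]) (simp_all add: phi_scale F_below_closed)
    next
      case zero
      show ?case by (intro image_eqI[of _ _ 0]) (simp_all add: phi_zero F_below_closed)
    next
      case (monom g m)
      let ?p = "free_word (nf_word m g)"
      have "phi ?p - skew_monom g m \<in> below d"
        using word_val_nf_word_lead[OF monom(1,2)] monom(3) by (auto simp: phi_word elim!: skew_supp_mono)
      from Suc.IH[OF this] obtain r where r: "r \<in> F_below d" "phi r = phi ?p - skew_monom g m"
        by auto
      have "?p \<in> F_below (Suc d)"
        using monom by (intro free_word_F_below nf_word_X) (simp_all add: vec_degree_nf_word)
      moreover have "r \<in> F_below (Suc d)"
        using r F_below_mono by simp
      moreover have "phi (?p - r) = skew_monom g m"
        by (simp add: phi_diff r)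
      ultimately show ?case
        by (metis F_below_closed(3) image_eqI)
    qed
  qed
qed

subsubsection \<open>Normal forms\<close>

text \<open>What a rewriting step may discard: elements of the ideal and words of smaller
  degree.\<close>

definition mod_low :: "nat \<Rightarrow> ('g, 'v, 'k) free_VG set"
  where "mod_low d = {i + r | i r. i \<in> I \<and> r \<in> F_below d}"

lemma mod_low_intros: "p \<in> I \<Longrightarrow> p \<in> mod_low d" "p \<in> F_below d \<Longrightarrow> p \<in> mod_low d"
  unfolding mod_low_def using I_closed(1) F_below_closed(1)[of d] by force+

lemma mod_low_add: "p \<in> mod_low d \<Longrightarrow> q \<in> mod_low d \<Longrightarrow> p + q \<in> mod_low d"
proof -
  assume "p \<in> mod_low d" "q \<in> mod_low d"
  then obtain i r j s where "p = i + r" "q = j + s" "i \<in> I" "j \<in> I" "r \<in> F_below d" "s \<in> F_below d"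
    by (auto simp: mod_low_def)
  then show ?thesis
    unfolding mod_low_def by (intro CollectI exI[of _ "i + j"] exI[of _ "r + s"]) (simp add: I_closed F_below_closed)
qed

lemma mod_low_scale: "p \<in> mod_low d \<Longrightarrow> pm_scale c p \<in> mod_low d"
  unfolding mod_low_def using I_closed(5) F_below_closed(4) by (force simp: pm_scale_add_right)

lemma mod_low_uminus: "p \<in> mod_low d \<Longrightarrow> - p \<in> mod_low d"
  using mod_low_scale[of p d "- 1"] by simp

lemma mod_low_mult_right: "p \<in> mod_low d \<Longrightarrow> q \<in> F_below (Suc e) \<Longrightarrow> p * q \<in> mod_low (d + e)"
proof -
  assume "p \<in> mod_low d" and q: "q \<in> F_below (Suc e)"
  then obtain i r where p: "p = i + r" "i \<in> I" "r \<in> F_below d" by (auto simp: mod_low_def)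
  show ?thesis
    unfolding p(1) distrib_right
    by (rule mod_low_add[OF mod_low_intros(1)[OF I_closed(3)[OF p(2) F_below_carrier[OF q]]] mod_low_intros(2)[OF F_below_mult[OF p(3) q]]])
qed

lemma mod_low_mult_left: "p \<in> mod_low d \<Longrightarrow> q \<in> F_below (Suc e) \<Longrightarrow> q * p \<in> mod_low (d + e)"
proof -
  assume "p \<in> mod_low d" and q: "q \<in> F_below (Suc e)"
  then obtain i r where p: "p = i + r" "i \<in> I" "r \<in> F_below d" by (auto simp: mod_low_def)
  have "q * r \<in> F_below (d + e)"
  \<comment> \<open>\<open>F_below_mult\<close> wants the bound of its right factor to be a
    successor; for \<open>d = 0\<close> the remainder \<open>r\<close> is 0.\<close>
  proof (cases d)
    case 0
    then have "r = 0" using p(3) by (intro poly_mapping_eqI) (auto simp: mem_F_below_iff)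
    then show ?thesis by (simp add: F_below_closed)
  next
    case (Suc d')
    then show ?thesis using F_below_mult[of q "Suc e" r d'] q p by (simp add: add.commute)
  qed
  then show ?thesis
    using p q F_below_carrier mod_low_add mod_low_intros(1)[OF I_closed(4)[of i q]] mod_low_intros(2) by (simp add: distrib_left)
qed

text \<open>Adjacent transpositions: exchanging two vectors costs \<open>kap\<close>, which has
  degree 0. The letter \<open>x\<close> is carried through \<open>ys\<close> one place at a
  time.\<close>

lemma free_word_move:
  assumes "x \<in> Basis" "set ys \<subseteq> Basis"
  shows "free_word (map Inl (x # ys)) - free_word (map Inl (ys @ [x])) \<in> mod_low (Suc (length ys))"
  using assms(2)
proof (induction ys)
  case Nil
  then show ?case by (simp add: mod_low_intros F_below_closed)
next
  case (Cons y ys)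
  let ?w = "\<lambda>bs. free_word (map Inl bs) :: ('g, 'v, 'k) free_VG"
  have y: "y \<in> Basis" and ys: "set ys \<subseteq> Basis" using Cons.prems by auto
  have w: "?w (x # y # ys) = ?w [x] * ?w [y] * ?w ys" "?w (y # x # ys) = ?w [y] * ?w [x] * ?w ys"
      "?w (y # x # ys) = ?w [y] * ?w (x # ys)" "?w (y # ys @ [x]) = ?w [y] * ?w (ys @ [x])"
    by (simp_all add: mult_single plus_word_def)
  have wys: "?w ys \<in> F_below (Suc (length ys))"
    using ys by (intro free_word_F_below) auto
  have "?w [x] * ?w [y] - ?w [y] * ?w [x] - free_group_alg (kap x y) \<in> mod_low 1"
    using I_relations(3)[of x y] assms(1) y by (intro mod_low_intros(1)) (simp add: free_vec_Basis)
  then have "?w [x] * ?w [y] - ?w [y] * ?w [x] \<in> mod_low 1"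
    using mod_low_add[OF _ mod_low_intros(2)[OF free_group_alg_F_below[OF lam_kap_carrier(2)[of x y]]]] by fastforce
  then have 1: "?w (x # y # ys) - ?w (y # x # ys) \<in> mod_low (Suc (length ys))"
    using mod_low_mult_right[OF _ wys] unfolding w(1,2) by (fastforce simp: left_diff_distrib)
  have "?w [y] \<in> F_below (Suc 1)"
    using y by (intro free_word_F_below) auto
  then have "?w [y] * (?w (x # ys) - ?w (ys @ [x])) \<in> mod_low (Suc (length ys) + 1)"
    using Cons.IH[OF ys] by (intro mod_low_mult_left)
  then have 2: "?w (y # x # ys) - ?w (y # ys @ [x]) \<in> mod_low (Suc (Suc (length ys)))"
    unfolding w(3,4) by (simp add: right_diff_distrib)
  \<comment> \<open>The first exchange drops two degrees, but the induction hypothesis promises a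
    drop of one only, so the better bound is weakened.\<close>
  have "mod_low (Suc (length ys)) \<subseteq> mod_low (Suc (Suc (length ys)))"
    unfolding mod_low_def using F_below_mono by fastforce
  then show ?case
    using mod_low_add[OF _ 2, of "?w (x # y # ys) - ?w (y # x # ys)"] 1 by auto
qed

text \<open>Insertion sort without an order: the first letter of \<open>xs\<close> is located in
  \<open>ys\<close> and moved into its place there, and induction rearranges the other
  letters.\<close>

lemma free_word_mset:
  "mset xs = mset ys \<Longrightarrow> set xs \<subseteq> Basis \<Longrightarrow> free_word (map Inl xs) - free_word (map Inl ys) \<in> mod_low (length xs)"
proof (induction xs arbitrary: ys)
  case Nil
  then show ?case by (simp add: mod_low_intros F_below_closed)
next
  case (Cons x xs)
  let ?w = "\<lambda>bs. free_word (map Inl bs) :: ('g, 'v, 'k) free_VG"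
  have "x \<in> set ys" using Cons.prems by (metis list.set_intros(1) mset_eq_setD)
  then obtain ys1 ys2 where ys: "ys = ys1 @ x # ys2" by (meson split_list)
  have m: "mset xs = mset (ys1 @ ys2)" using Cons.prems ys by simp
  have x: "x \<in> Basis" and sub: "set ys1 \<subseteq> Basis" "set ys2 \<subseteq> Basis"
    using Cons.prems mset_eq_setD[OF m] by auto
  have len: "length xs = length ys1 + length ys2" using mset_eq_length[OF m] by simp
  have w: "?w (x # xs) = ?w [x] * ?w xs" "?w (x # ys1 @ ys2) = ?w [x] * ?w (ys1 @ ys2)"
      "?w (x # ys1 @ ys2) = ?w (x # ys1) * ?w ys2" "?w ys = ?w (ys1 @ [x]) * ?w ys2"
    by (simp_all add: ys mult_single plus_word_def)
  have "?w [x] \<in> F_below (Suc 1)" using x by (intro free_word_F_below) auto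
  then have "?w [x] * (?w xs - ?w (ys1 @ ys2)) \<in> mod_low (length xs + 1)"
    using Cons.IH[OF m] Cons.prems by (intro mod_low_mult_left) auto
  then have 1: "?w (x # xs) - ?w (x # ys1 @ ys2) \<in> mod_low (Suc (length xs))"
    unfolding w(1,2) by (simp add: right_diff_distrib)
  have "?w ys2 \<in> F_below (Suc (length ys2))" using sub by (intro free_word_F_below) auto
  then have "(?w (x # ys1) - ?w (ys1 @ [x])) * ?w ys2 \<in> mod_low (Suc (length ys1) + length ys2)"
    using free_word_move[OF x sub(1)] by (intro mod_low_mult_right)
  then have "?w (x # ys1 @ ys2) - ?w ys \<in> mod_low (Suc (length xs))"
    unfolding w(3,4) by (simp add: left_diff_distrib len)
  from mod_low_add[OF 1 this] show ?case by simp
qed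

text \<open>Described by supports rather than as a linear span, so that a member exhibits its normal
  words and coefficients directly.\<close>

definition nf_span :: "nat \<Rightarrow> ('g, 'v, 'k) free_VG set"
  where "nf_span d = {q. \<forall>w. Poly_Mapping.lookup q w \<noteq> 0 \<longrightarrow>
    (\<exists>m g. w = Word (nf_word m g) \<and> g \<in> carrier G \<and> Poly_Mapping.keys m \<subseteq> Basis \<and> mon_degree m = d)}"

lemma nf_span_closed:
  "0 \<in> nf_span d"
  "p \<in> nf_span d \<Longrightarrow> q \<in> nf_span d \<Longrightarrow> p + q \<in> nf_span d"
  "p \<in> nf_span d \<Longrightarrow> pm_scale c p \<in> nf_span d"
  unfolding nf_span_def mem_Collect_eq lookup_add lookup_pm_scale lookup_zero
  by (metis add_0 mult_zero_right)+

lemma nf_word_Q: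
  "g \<in> carrier G \<Longrightarrow> Poly_Mapping.keys m \<subseteq> Basis \<Longrightarrow> free_word (nf_word m g) \<in> nf_span (mon_degree m)"
  by (auto simp: nf_span_def lookup_single when_def split: if_splits)

definition nf_red :: "nat \<Rightarrow> ('g, 'v, 'k) free_VG set"
  where "nf_red d = {q + l | q l. q \<in> nf_span d \<and> l \<in> mod_low d}"

lemma nf_red_intros: "q \<in> nf_span d \<Longrightarrow> q \<in> nf_red d" "q \<in> mod_low d \<Longrightarrow> q \<in> nf_red d"
  unfolding nf_red_def using nf_span_closed(1)[of d] mod_low_intros(1)[OF I_closed(1), of d] by force+

lemma nf_red_add: "p \<in> nf_red d \<Longrightarrow> q \<in> nf_red d \<Longrightarrow> p + q \<in> nf_red d"
proof -
  assume "p \<in> nf_red d" "q \<in> nf_red d"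
  then obtain i r j s where "p = i + r" "q = j + s" "i \<in> nf_span d" "j \<in> nf_span d" "r \<in> mod_low d" "s \<in> mod_low d"
    by (auto simp: nf_red_def)
  then show ?thesis
    unfolding nf_red_def by (intro CollectI exI[of _ "i + j"] exI[of _ "r + s"]) (simp add: nf_span_closed mod_low_add)
qed

lemma nf_red_scale: "p \<in> nf_red d \<Longrightarrow> pm_scale c p \<in> nf_red d"
  unfolding nf_red_def using nf_span_closed(3) mod_low_scale by (force simp: pm_scale_add_right)

lemma nf_red_sum: "(\<And>i. i \<in> S \<Longrightarrow> f i \<in> nf_red d) \<Longrightarrow> sum f S \<in> nf_red d"
  by (induction S rule: infinite_finite_induct) (simp_all add: nf_red_add nf_red_intros nf_span_closed)

lemma nf_red_cong: "q \<in> nf_red d \<Longrightarrow> p - q \<in> mod_low d \<Longrightarrow> p \<in> nf_red d"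
  using nf_red_add[OF _ nf_red_intros(2), of q d "p - q"] by simp

lemma nf_word_group_T:
  assumes h: "h \<in> carrier G" and g: "g \<in> carrier G" and m: "Poly_Mapping.keys m \<subseteq> Basis"
  shows "free_word (nf_word m h) * free_word [Inr g] \<in> nf_red (mon_degree m)"
proof (rule nf_red_cong)
  let ?u = "free_word (map Inl (mon_list m)) :: ('g, 'v, 'k) free_VG"
  show "free_word (nf_word m (h \<otimes>\<^bsub>G\<^esub> g)) \<in> nf_red (mon_degree m)"
    using assms by (intro nf_red_intros nf_word_Q) auto
  have "?u \<in> carrier F"
    using m by (intro free_word_carrier) (auto simp: set_mon_list)
  then have "?u * (free_word [Inr h] * free_word [Inr g] - free_word [Inr (h \<otimes>\<^bsub>G\<^esub> g)]) \<in> I"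
    using I_relations(2)[OF h g] by (intro I_closed(4))
  then show "free_word (nf_word m h) * free_word [Inr g] - free_word (nf_word m (h \<otimes>\<^bsub>G\<^esub> g)) \<in> mod_low (mon_degree m)"
    by (intro mod_low_intros(1)) (simp add: nf_word_def free_word_append right_diff_distrib mult.assoc)
qed

text \<open>The vector has to cross the group element: this applies \<open>\<rho> h\<close> to it
  and leaves a \<open>lam\<close> term, which has no vector letter and so falls into the lower part.
  The new vector is then expanded in the basis and each basis vector merged into the
  monomial.\<close>

lemma nf_word_vec_T:
  assumes h: "h \<in> carrier G" and b: "b \<in> Basis" and m: "Poly_Mapping.keys m \<subseteq> Basis"
  shows "free_word (nf_word m h) * free_word [Inl b] \<in> nf_red (Suc (mon_degree m))"
proof (rule nf_red_cong)
  let ?u = "free_word (map Inl (mon_list m)) :: ('g, 'v, 'k) free_VG"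
  let ?v = "free_vec scale Basis (\<rho> h b) :: ('g, 'v, 'k) free_VG"
  let ?l = "free_group_alg (lam (group_elt h) b) :: ('g, 'v, 'k) free_VG"
  have hF: "free_word [Inr h] \<in> F_below (Suc 0)"
    using h by (intro free_word_F_below) auto
  have u: "?u \<in> F_below (Suc (mon_degree m))"
    using m by (intro free_word_F_below) (auto simp: set_mon_list length_mon_list)
  then have "?u * (free_word [Inr h] * free_word [Inl b] - ?v * free_word [Inr h] - ?l) \<in> I"
    using I_relations(4)[OF h, of b] b by (intro I_closed(4) F_below_carrier) (auto simp: free_vec_Basis)
  moreover have "?u * ?l \<in> F_below (Suc (mon_degree m) + 0)"
    using free_group_alg_F_below[OF lam_kap_carrier(1)[OF h]] by (intro F_below_mult u) simp
  ultimately have "?u * (free_word [Inr h] * free_word [Inl b] - ?v * free_word [Inr h] - ?l) + ?u * ?l \<in> mod_low (Suc (mon_degree m))"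
    by (intro mod_low_add mod_low_intros) simp_all
  then show "free_word (nf_word m h) * free_word [Inl b] - ?u * ?v * free_word [Inr h] \<in> mod_low (Suc (mon_degree m))"
    by (simp add: nf_word_def free_word_append algebra_simps)
  have "?u * free_word [Inl c] * free_word [Inr h] \<in> nf_red (Suc (mon_degree m))" if c: "c \<in> Basis" for c
  proof (rule nf_red_cong)
    let ?n = "m + Poly_Mapping.single c 1"
    have keys: "Poly_Mapping.keys ?n \<subseteq> Basis"
      using m c keys_add[of m "Poly_Mapping.single c 1"] by auto
    then show "free_word (nf_word ?n h) \<in> nf_red (Suc (mon_degree m))"
      using nf_red_intros(1)[OF nf_word_Q[OF h keys]] by (simp add: mon_degree_add_single del: One_nat_def)
    \<comment> \<open>\<open>mon_list m @ [c]\<close> is an arrangement of the new monomial, but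
      perhaps not the chosen one.\<close>
    have "free_word (map Inl (mon_list m @ [c])) - free_word (map Inl (mon_list ?n)) \<in> mod_low (Suc (mon_degree m))"
      using free_word_mset[of "mon_list m @ [c]" "mon_list ?n"] mset_mon_list_add[of m c] m c
      by (simp add: set_mon_list length_mon_list)
    from mod_low_mult_right[OF this hF]
    show "?u * free_word [Inl c] * free_word [Inr h] - free_word (nf_word ?n h) \<in> mod_low (Suc (mon_degree m))"
      by (simp add: nf_word_def free_word_append left_diff_distrib)
  qed
  then have "(\<Sum>c\<in>Basis. pm_scale (V.representation Basis (\<rho> h b) c) (?u * free_word [Inl c] * free_word [Inr h])) \<in> nf_red (Suc (mon_degree m))"
    by (intro nf_red_sum nf_red_scale)
  moreover have "?u * ?v * free_word [Inr h] =
      (\<Sum>c\<in>Basis. pm_scale (V.representation Basis (\<rho> h b) c) (?u * free_word [Inl c] * free_word [Inr h]))"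
    unfolding free_vec_def single_eq_pm_scale[of _ "V.representation Basis (\<rho> h b) _"] sum_distrib_left
      sum_distrib_right pm_scale_mult_right pm_scale_mult_left by simp
  ultimately show "?u * ?v * free_word [Inr h] \<in> nf_red (Suc (mon_degree m))"
    by simp
qed

lemma nf_span_mult_T:
  assumes q: "q \<in> nf_span d"
    and nf_red: "\<And>m g. g \<in> carrier G \<Longrightarrow> Poly_Mapping.keys m \<subseteq> Basis \<Longrightarrow> mon_degree m = d \<Longrightarrow> free_word (nf_word m g) * r \<in> nf_red e"
  shows "q * r \<in> nf_red e"
proof -
  have "(\<Sum>w\<in>Poly_Mapping.keys q. pm_scale (Poly_Mapping.lookup q w) (free_word (letters w) * r)) \<in> nf_red e"
  proof (intro nf_red_sum nf_red_scale)
    fix w assume "w \<in> Poly_Mapping.keys q"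
    then show "free_word (letters w) * r \<in> nf_red e"
      using q nf_red by (auto simp: nf_span_def in_keys_iff)
  qed
  moreover have "(\<Sum>w\<in>Poly_Mapping.keys q. pm_scale (Poly_Mapping.lookup q w) (free_word (letters w) * r)) =
    (\<Sum>w\<in>Poly_Mapping.keys q. Poly_Mapping.single w (Poly_Mapping.lookup q w)) * r"
    unfolding sum_distrib_right single_eq_pm_scale[of _ "Poly_Mapping.lookup q _"] pm_scale_mult_left ..
  ultimately show ?thesis
    by (simp flip: poly_mapping_sum_single)
qed

lemma free_word_T: "set xs \<subseteq> X \<Longrightarrow> free_word xs \<in> nf_red (vec_degree (Word xs))"
proof (induction xs rule: rev_induct)
  case Nil
  have "free_word (nf_word 0 \<one>\<^bsub>G\<^esub>) \<in> nf_red (mon_degree (0 :: 'v \<Rightarrow>\<^sub>0 nat))"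
    by (intro nf_red_intros(1) nf_word_Q) auto
  \<comment> \<open>Normal words end in a group letter, so the empty word is not one of them; the
    relation between the group unit and 1 supplies the letter.\<close>
  moreover have "free_word [] - free_word (nf_word 0 \<one>\<^bsub>G\<^esub>) \<in> mod_low 0"
    using mod_low_uminus[OF mod_low_intros(1)[OF I_relations(1)]] by (simp add: nf_word_def mon_list_zero flip: zero_word_def)
  ultimately show ?case
    using nf_red_cong[of _ 0 "free_word []"] by (simp add: mon_degree_def)
next
  case (snoc x xs)
  let ?d = "vec_degree (Word xs)"
  let ?e = "vec_degree (Word [x])"
  obtain q l where ql: "free_word xs = q + l" "q \<in> nf_span ?d" "l \<in> mod_low ?d"
    using snoc by (auto simp: nf_red_def)
  have "free_word [x] \<in> F_below (Suc ?e)"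
    using snoc.prems by (intro free_word_F_below) auto
  then have "l * free_word [x] \<in> nf_red (?d + ?e)"
    using ql by (intro nf_red_intros(2) mod_low_mult_right)
  moreover have "q * free_word [x] \<in> nf_red (?d + ?e)"
  proof (rule nf_span_mult_T[OF ql(2)])
    fix m g assume "g \<in> carrier G" "Poly_Mapping.keys m \<subseteq> Basis" "mon_degree m = ?d"
    then show "free_word (nf_word m g) * free_word [x] \<in> nf_red (?d + ?e)"
      using nf_word_group_T[of g _ m] nf_word_vec_T[of g _ m] snoc.prems by (cases x) auto
  qed
  ultimately show ?case
    by (simp only: free_word_append ql(1) distrib_right nf_red_add vec_degree_simps(4))
qed

text \<open>Words of degree below d already lie in the part that is discarded; only those of degree
  exactly d have to be reduced.\<close>

lemma F_below_T: "p \<in> F_below (Suc d) \<Longrightarrow> p \<in> nf_red d"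
proof -
  assume p: "p \<in> F_below (Suc d)"
  have "free_word (letters w) \<in> nf_red d" if "w \<in> Poly_Mapping.keys p" for w
  proof -
    have X: "set (letters w) \<subseteq> X" and "vec_degree w < Suc d"
      using p that by (auto simp: mem_F_below_iff in_keys_iff)
    then consider "vec_degree w = d" | "vec_degree w < d" by linarith
    then show ?thesis
    proof cases
      case 1
      then show ?thesis using free_word_T[OF X] by simp
    next
      case 2
      then show ?thesis using X by (intro nf_red_intros(2) mod_low_intros(2) free_word_F_below) auto
    qed
  qed
  then have "(\<Sum>w\<in>Poly_Mapping.keys p. Poly_Mapping.single w (Poly_Mapping.lookup p w)) \<in> nf_red d"
    unfolding single_eq_pm_scale[of _ "Poly_Mapping.lookup p _"] by (intro nf_red_sum nf_red_scale)
  then show ?thesis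
    by (simp flip: poly_mapping_sum_single)
qed

text \<open>Normal words of one degree have distinct monomials of \<open>A\<close> as leading terms.
  The combination \<open>a\<close> of these terms is homogeneous of degree d and also of degree
  below d, so it vanishes, and its coefficients are those of \<open>q\<close>.\<close>

lemma nf_span_eq_0:
  assumes q: "q \<in> nf_span d" and phi: "phi q \<in> below d"
  shows "q = 0"
proof -
  let ?K = "Poly_Mapping.keys q"
  have "\<exists>m g. \<forall>w\<in>?K. w = Word (nf_word (m w) (g w)) \<and> g w \<in> carrier G \<and> Poly_Mapping.keys (m w) \<subseteq> Basis \<and> mon_degree (m w) = d"
    using q unfolding nf_span_def mem_Collect_eq in_keys_iff[symmetric] by metis
  then obtain m g where mg: "\<And>w. w \<in> ?K \<Longrightarrow> w = Word (nf_word (m w) (g w)) \<and> g w \<in> carrier G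
      \<and> Poly_Mapping.keys (m w) \<subseteq> Basis \<and> mon_degree (m w) = d"
    by blast
  define a where "a = (\<Sum>w\<in>?K. skew_scale (Poly_Mapping.lookup q w) (skew_monom (g w) (m w)))"
  have "phi q - a = (\<Sum>w\<in>?K. skew_scale (Poly_Mapping.lookup q w) (word_val (letters w) - skew_monom (g w) (m w)))"
    by (simp add: phi_def a_def sum_subtractf skew.scale_right_diff_distrib)
  also have "\<dots> \<in> below d"
  proof (intro skew_supp_sum skew_supp_scale)
    fix w assume "w \<in> ?K"
    then show "word_val (letters w) - skew_monom (g w) (m w) \<in> below d"
      using mg[of w] word_val_nf_word_lead[of "g w" "m w"] by (metis word.sel)
  qed
  finally have "a \<in> below d"
    using skew_supp_diff[OF phi] by fastforce
  moreover have "a \<in> supp (\<lambda>e. e = d)"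
    unfolding a_def using mg by (intro skew_supp_sum skew_supp_scale skew_monom_supp) auto
  ultimately have "a = 0"
    by (rule skew_supp_inter_eq_0) simp
  have "w \<notin> ?K" for w
  proof
    assume w: "w \<in> ?K"
    have "g u = g w \<and> m u = m w \<longleftrightarrow> u = w" if "u \<in> ?K" for u
      using mg[OF w] mg[OF that] by metis
    then have "skew_coeff a (g w) (m w) = (\<Sum>u\<in>?K. if u = w then Poly_Mapping.lookup q u else 0)"
      unfolding a_def skew_coeff_simps skew_coeff_monom by (intro sum.cong refl) (simp add: when_def)
    then show False
      using w \<open>a = 0\<close> by (simp add: in_keys_iff)
  qed
  then show ?thesis
    by (metis poly_mapping_eqI in_keys_iff lookup_zero)
qed

text \<open>Induction on the degree bound. Modulo the ideal, \<open>p\<close> is a combination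
  \<open>q\<close> of normal words plus lower terms \<open>r\<close>. From \<open>phi p = 0\<close>
  it follows that \<open>phi q = - phi r\<close> has lower degree, so \<open>q = 0\<close>, and the
  induction hypothesis applies to \<open>r\<close>.\<close>

lemma kernel_phi: "a_kernel F B phi = I"
proof (intro equalityI I_subset_kernel subsetI)
  have "p \<in> I" if "p \<in> F_below d" "phi p = 0" for p d
    using that
  proof (induction d arbitrary: p)
    case 0
    then have "p = 0" by (intro poly_mapping_eqI) (auto simp: mem_F_below_iff)
    then show ?case by (simp add: I_closed)
  next
    case (Suc d)
    obtain q i r where p: "p = q + (i + r)" "q \<in> nf_span d" "i \<in> I" "r \<in> F_below d"
      using F_below_T[OF Suc.prems(1)] by (auto simp: nf_red_def mod_low_def)
    have "phi q = - phi r"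
      using Suc.prems(2) p phi_I by (simp add: phi_add eq_neg_iff_add_eq_0)
    then have "q = 0"
      using p phi_below by (intro nf_span_eq_0[OF p(2)]) (simp add: skew_supp_uminus)
    then show ?case
      using Suc.IH[of r] p Suc.prems(2) phi_I by (simp add: phi_add I_closed)
  qed
  note * = this
  show "p \<in> I" if "p \<in> a_kernel F B phi" for p
  proof -
    have p: "p \<in> carrier F" "phi p = 0" using that by (auto simp: a_kernel_def')
    from F_below_bounded[OF p(1)] obtain d where "p \<in> F_below d" ..
    then show ?thesis using p(2) by (rule *)
  qed
qed

end

subsection \<open>The associated graded algebra\<close>

lemma skew_proj_simps:
  "skew_proj d (a + b) = skew_proj d a + skew_proj d b"
  "skew_proj d (skew_scale c a) = skew_scale c (skew_proj d a)"
  "skew_proj d (sum f S) = (\<Sum>i\<in>S. skew_proj d (f i))"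
  by (rule skew_eqI, simp add: skew_coeff_proj when_def)+

lemma skew_proj_supp_eq:
  "a \<in> skew_supp G Basis (\<lambda>e. e = i) \<Longrightarrow> skew_proj d a = (if d = i then a else 0)"
  by (rule skew_eqI) (auto simp: skew_coeff_proj when_def skew_supp_def)

lemma skew_proj_eqI: "(\<And>d. skew_proj d a = skew_proj d b) \<Longrightarrow> a = b"
proof (rule skew_eqI)
  fix g m
  assume "\<And>d. skew_proj d a = skew_proj d b"
  then have "skew_coeff (skew_proj (mon_degree m) a) g m = skew_coeff (skew_proj (mon_degree m) b) g m" by simp
  then show "skew_coeff a g m = skew_coeff b g m" by (simp add: skew_coeff_proj)
qed

context deformed_skew_parameters
begin

section \<open>The filtration of \<open>H\<close> seen in \<open>A\<close>\<close>

abbreviation "H \<equiv> H_alg G scale Basis \<rho> lam kap"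
abbreviation "Fl \<equiv> H_filtration G scale Basis \<rho> lam kap"
abbreviation "Gr \<equiv> assoc_graded H Fl"

definition psi :: "('g, 'v, 'k) free_VG set \<Rightarrow> ('g, 'v, 'k) skew"
  where "psi Y = the_elem (phi ` Y)"

lemma phi_surj: "phi ` carrier F = carrier B"
proof
  show "carrier B \<subseteq> phi ` carrier F"
  proof
    fix a assume "a \<in> carrier B"
    then obtain d where "a \<in> below d"
      using skew_supp_bounded by (metis B_simps(1) carrier_A)
    then show "a \<in> phi ` carrier F"
      using phi_image_below[of d] F_below_carrier by blast
  qed
qed (auto simp: phi_carrier)

lemma psi_iso: "psi \<in> alg_iso H B"
proof -
  have "(\<lambda>Y. the_elem (phi ` Y)) \<in> alg_iso (alg_quot F (a_kernel F B phi)) B"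
    by (rule alg_quot_iso[OF phi_ring_hom_ring]) (simp_all add: F_carrier_closed phi_scale phi_surj)
  then show ?thesis
    by (simp add: kernel_phi H_alg_def psi_def[abs_def])
qed

lemma psi_coset: "p \<in> carrier F \<Longrightarrow> psi (I +>\<^bsub>F\<^esub> p) = phi p"
  using ring_hom_ring.the_elem_simp[OF phi_ring_hom_ring] by (simp add: psi_def kernel_phi)

lemma carrier_H: "carrier H = (+>\<^bsub>F\<^esub>) I ` carrier F"
  by (auto simp: H_alg_def FactRing_def A_RCOSETS_def')

lemma ring_H: "ring H"
  unfolding H_alg_def by (intro ring_alg_quot I.ideal_axioms)

sublocale H: ring H by (rule ring_H)

lemma H_smult_closed: "x \<in> carrier H \<Longrightarrow> c \<odot>\<^bsub>H\<^esub> x \<in> carrier H"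
proof -
  assume "x \<in> carrier H"
  then obtain p where p: "p \<in> carrier F" "x = I +>\<^bsub>F\<^esub> p" by (auto simp: carrier_H)
  have "c \<odot>\<^bsub>alg_quot F (a_kernel F B phi)\<^esub> (a_kernel F B phi +>\<^bsub>F\<^esub> p) = a_kernel F B phi +>\<^bsub>F\<^esub> (c \<odot>\<^bsub>F\<^esub> p)"
    by (rule alg_quot_smult[OF phi_ring_hom_ring]) (simp_all add: F_carrier_closed phi_scale p)
  then show ?thesis
    using p F_carrier_closed(6)[of p c] by (simp add: kernel_phi carrier_H flip: H_alg_def)
qed

lemma psi_simps:
  "x \<in> carrier H \<Longrightarrow> psi x \<in> carrier A"
  "x \<in> carrier H \<Longrightarrow> y \<in> carrier H \<Longrightarrow> psi (x \<otimes>\<^bsub>H\<^esub> y) = circ (psi x) (psi y)"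
  "x \<in> carrier H \<Longrightarrow> y \<in> carrier H \<Longrightarrow> psi (x \<oplus>\<^bsub>H\<^esub> y) = psi x + psi y"
  "psi \<one>\<^bsub>H\<^esub> = unit"
  "x \<in> carrier H \<Longrightarrow> psi (c \<odot>\<^bsub>H\<^esub> x) = skew_scale c (psi x)"
proof -
  have iso: "psi \<in> ring_iso H B" using psi_iso by (simp add: alg_iso_def)
  show "x \<in> carrier H \<Longrightarrow> psi x \<in> carrier A"
    "x \<in> carrier H \<Longrightarrow> y \<in> carrier H \<Longrightarrow> psi (x \<otimes>\<^bsub>H\<^esub> y) = circ (psi x) (psi y)"
    "x \<in> carrier H \<Longrightarrow> y \<in> carrier H \<Longrightarrow> psi (x \<oplus>\<^bsub>H\<^esub> y) = psi x + psi y"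
    "psi \<one>\<^bsub>H\<^esub> = unit"
    using ring_iso_memE(1-4)[OF iso] by simp_all
  show "x \<in> carrier H \<Longrightarrow> psi (c \<odot>\<^bsub>H\<^esub> x) = skew_scale c (psi x)"
    using psi_iso by (simp add: alg_iso_def)
qed

lemma psi_inj: "x \<in> carrier H \<Longrightarrow> y \<in> carrier H \<Longrightarrow> psi x = psi y \<Longrightarrow> x = y"
  and psi_surj: "a \<in> carrier A \<Longrightarrow> \<exists>x\<in>carrier H. psi x = a"
proof -
  have bij: "bij_betw psi (carrier H) (carrier A)"
    using psi_iso ring_iso_memE(5)[of psi H B] by (simp add: alg_iso_def)
  then show "x \<in> carrier H \<Longrightarrow> y \<in> carrier H \<Longrightarrow> psi x = psi y \<Longrightarrow> x = y"
    by (meson bij_betw_imp_inj_on inj_onD)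
  show "\<exists>x\<in>carrier H. psi x = a" if "a \<in> carrier A"
    using that unfolding bij_betw_imp_surj_on[OF bij, symmetric] by (elim imageE) (intro bexI, rule sym)
qed

lemma psi_zero: "psi \<zero>\<^bsub>H\<^esub> = 0"
  using psi_simps(3)[of "\<zero>\<^bsub>H\<^esub>" "\<zero>\<^bsub>H\<^esub>"] by simp

lemma psi_minus: "x \<in> carrier H \<Longrightarrow> y \<in> carrier H \<Longrightarrow> psi (x \<ominus>\<^bsub>H\<^esub> y) = psi x - psi y"
  using psi_simps(3)[of "x \<ominus>\<^bsub>H\<^esub> y" y] by (simp add: a_minus_def H.a_assoc H.l_neg)

lemma psi_finsum: "finite S \<Longrightarrow> (\<And>i. i \<in> S \<Longrightarrow> f i \<in> carrier H) \<Longrightarrow> psi (finsum H f S) = (\<Sum>i\<in>S. psi (f i))"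
proof (induction S rule: finite_induct)
  case (insert i S)
  then have "finsum H f (insert i S) = f i \<oplus>\<^bsub>H\<^esub> finsum H f S"
    by (intro H.finsum_insert) auto
  then show ?case
    using insert by (simp add: psi_simps Pi_def)
qed (simp add: psi_zero)

text \<open>The harder direction must find a representative of small degree:
  \<open>phi_image_below\<close> produces an element of the free algebra with the right image, and
  injectivity of \<open>psi\<close> shows that it represents the given element.\<close>

lemma mem_Fl_iff: "x \<in> Fl d \<longleftrightarrow> x \<in> carrier H \<and> psi x \<in> below (Suc d)"
proof -
  have Fl: "Fl d = (+>\<^bsub>F\<^esub>) I ` F_below (Suc d)"
    by (simp add: H_filtration_def F_below_def less_Suc_eq_le Let_def)
  show ?thesis
  proof
    assume "x \<in> Fl d"
    then obtain p where "p \<in> F_below (Suc d)" "x = I +>\<^bsub>F\<^esub> p" by (auto simp: Fl)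
    then show "x \<in> carrier H \<and> psi x \<in> below (Suc d)"
      using phi_below F_below_carrier by (auto simp: carrier_H psi_coset)
  next
    assume x: "x \<in> carrier H \<and> psi x \<in> below (Suc d)"
    then have "psi x \<in> phi ` F_below (Suc d)"
      by (simp only: phi_image_below)
    then obtain p where p: "p \<in> F_below (Suc d)" "psi x = phi p" by blast
    have pF: "p \<in> carrier F" using p(1) by (rule F_below_carrier)
    then have "x = I +>\<^bsub>F\<^esub> p"
      using x p pF by (intro psi_inj) (simp_all add: carrier_H psi_coset)
    then show "x \<in> Fl d" using p(1) by (simp add: Fl)
  qed
qed

lemma filt_below_eq: "filt_below H Fl d = {x \<in> carrier H. psi x \<in> below d}"
proof (cases d)
  case 0
  have "x = \<zero>\<^bsub>H\<^esub>" if "x \<in> carrier H" "psi x \<in> below 0" for x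
    using that supp_False_eq_0[OF that(2)] by (intro psi_inj) (simp_all add: psi_zero)
  then show ?thesis
    using 0 by (auto simp: filt_below_def psi_zero skew_supp_zero)
next
  case (Suc e)
  then show ?thesis by (auto simp: filt_below_def mem_Fl_iff)
qed

text \<open>The cosets of the filtration, indexed by elements of \<open>A\<close> modulo
  \<open>below d\<close>. Questions about cosets in \<open>H\<close> thereby become questions about
  supports in \<open>A\<close>.\<close>

definition cls :: "nat \<Rightarrow> ('g, 'v, 'k) skew \<Rightarrow> ('g, 'v, 'k) free_VG set set"
  where "cls d a = {x \<in> carrier H. psi x - a \<in> below d}"

lemma filt_below_cls: "filt_below H Fl d = cls d 0"
  by (simp add: filt_below_eq cls_def)

lemma filt_coset: "y \<in> carrier H \<Longrightarrow> filt_below H Fl d +>\<^bsub>H\<^esub> y = cls d (psi y)"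
proof (intro equalityI subsetI)
  fix x
  assume y: "y \<in> carrier H"
  show "x \<in> cls d (psi y)" if "x \<in> filt_below H Fl d +>\<^bsub>H\<^esub> y"
    using that y by (auto simp: a_r_coset_def' filt_below_eq cls_def psi_simps)
  show "x \<in> filt_below H Fl d +>\<^bsub>H\<^esub> y" if "x \<in> cls d (psi y)"
  proof -
    have x: "x \<in> carrier H" "psi x - psi y \<in> below d" using that by (auto simp: cls_def)
    have "x = (x \<ominus>\<^bsub>H\<^esub> y) \<oplus>\<^bsub>H\<^esub> y"
      using x y by (simp add: a_minus_def H.a_assoc H.l_neg)
    moreover have "x \<ominus>\<^bsub>H\<^esub> y \<in> filt_below H Fl d"
      using x y by (simp add: filt_below_eq psi_minus)
    ultimately show ?thesis
      by (auto simp: a_r_coset_def')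
  qed
qed

lemma cls_eqI: "a - b \<in> below d \<Longrightarrow> cls d a = cls d b"
proof -
  assume ab: "a - b \<in> below d"
  have "c - a \<in> below d \<longleftrightarrow> c - b \<in> below d" for c
    using skew_supp_add[OF _ ab, of "c - a"] skew_supp_diff[OF _ ab, of "c - b"] by auto
  then show ?thesis by (simp add: cls_def)
qed

text \<open>Surjectivity of \<open>psi\<close> provides a member of the class with value
  \<open>a\<close>; equality of empty classes would say nothing.\<close>

lemma cls_eqD: "a \<in> carrier A \<Longrightarrow> cls d a = cls d b \<Longrightarrow> a - b \<in> below d"
proof -
  assume "a \<in> carrier A" and eq: "cls d a = cls d b"
  then obtain x where x: "x \<in> carrier H" "psi x = a" using psi_surj by blast
  then have "x \<in> cls d a" by (simp add: cls_def skew_supp_zero)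
  then have "x \<in> cls d b" by (simp only: eq)
  then show ?thesis using x by (simp add: cls_def)
qed

lemma cls_nonempty: "a \<in> carrier A \<Longrightarrow> \<exists>x. x \<in> cls d a"
  using psi_surj[of a] by (auto simp: cls_def skew_supp_zero)

lemma cls_add:
  assumes "a \<in> carrier A" "b \<in> carrier A"
  shows "cls d a <+>\<^bsub>H\<^esub> cls d b = cls d (a + b)"
proof (intro equalityI subsetI)
  fix x assume "x \<in> cls d a <+>\<^bsub>H\<^esub> cls d b"
  then obtain y z where "y \<in> cls d a" "z \<in> cls d b" "x = y \<oplus>\<^bsub>H\<^esub> z"
    by (auto simp: set_add_def')
  then show "x \<in> cls d (a + b)"
    using skew_supp_add[of "psi y - a" G Basis _ "psi z - b"] by (simp add: cls_def psi_simps algebra_simps)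
next
  fix x assume x: "x \<in> cls d (a + b)"
  obtain y where y: "y \<in> carrier H" "psi y = a" using psi_surj assms by blast
  have xH: "x \<in> carrier H" using x by (simp add: cls_def)
  have "x = y \<oplus>\<^bsub>H\<^esub> (x \<ominus>\<^bsub>H\<^esub> y)"
    using xH y(1) by (simp add: a_minus_def H.a_lcomm[of y] H.r_neg)
  moreover have "y \<in> cls d a" "x \<ominus>\<^bsub>H\<^esub> y \<in> cls d b"
    using x y xH by (simp_all add: cls_def skew_supp_zero psi_minus algebra_simps)
  ultimately show "x \<in> cls d a <+>\<^bsub>H\<^esub> cls d b"
    by (auto simp: set_add_def')
qed

text \<open>The symbol map starts from \<open>A\<close> because a homogeneous component determines a
  coset, whereas the opposite direction would have to choose representatives. It is inverted at the
  end.\<close>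

definition symb :: "('g, 'v, 'k) skew \<Rightarrow> nat \<Rightarrow> ('g, 'v, 'k) free_VG set set"
  where "symb a d = cls d (skew_proj d a)"

lemma proj_carrier: "a \<in> carrier A \<Longrightarrow> skew_proj d a \<in> carrier A"
  unfolding carrier_A[symmetric] using skew_proj_supp supp_carrier carrier_A by metis

lemma proj_supp: "a \<in> carrier A \<Longrightarrow> skew_proj d a \<in> supp (\<lambda>e. e = d)"
  unfolding carrier_A by (rule skew_proj_supp)

lemma proj_below: "a \<in> carrier A \<Longrightarrow> skew_proj d a \<in> below (Suc d)"
  by (rule skew_supp_mono[OF proj_supp]) simp_all

lemma carrier_Gr:
  "x \<in> carrier Gr \<longleftrightarrow> (\<forall>d. \<exists>y\<in>Fl d. x d = cls d (psi y)) \<and> finite {d. x d \<noteq> cls d 0}"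
proof -
  have "(\<exists>y\<in>Fl d. x d = filt_below H Fl d +>\<^bsub>H\<^esub> y) \<longleftrightarrow> (\<exists>y\<in>Fl d. x d = cls d (psi y))" for d
    by (intro bex_cong refl) (simp add: filt_coset mem_Fl_iff)
  then show ?thesis
    by (simp add: assoc_graded_def Let_def filt_below_cls)
qed

lemma symb_carrier:
  assumes a: "a \<in> carrier A"
  shows "symb a \<in> carrier Gr"
proof -
  obtain N where N: "a \<in> below N"
    using a skew_supp_bounded unfolding carrier_A by blast
  have "skew_proj d a = 0" if "N \<le> d" for d
    by (rule skew_eqI) (use N that in \<open>fastforce simp: skew_coeff_proj when_def skew_supp_def\<close>)
  then have "finite {d. symb a d \<noteq> cls d 0}"
    by (intro finite_subset[OF _ finite_lessThan[of N]]) (auto simp: symb_def not_le[symmetric])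
  moreover have "\<exists>y\<in>Fl d. symb a d = cls d (psi y)" for d
  proof -
    from psi_surj[OF proj_carrier[OF a, of d]] obtain y where "y \<in> carrier H" "psi y = skew_proj d a" ..
    then show ?thesis
      using proj_below[OF a, of d] by (intro bexI[of _ y]) (simp_all add: symb_def mem_Fl_iff)
  qed
  ultimately show ?thesis by (simp add: carrier_Gr)
qed

lemma symb_surj:
  assumes x: "x \<in> carrier Gr"
  shows "\<exists>a\<in>carrier A. symb a = x"
proof -
  obtain y where y: "\<And>d. y d \<in> Fl d" "\<And>d. x d = cls d (psi (y d))"
    using x unfolding carrier_Gr by metis
  define c where "c d = skew_proj d (psi (y d))" for d
  have yA: "psi (y d) \<in> carrier A" and yb: "psi (y d) \<in> below (Suc d)" for d
    using y(1)[of d] psi_simps(1) by (auto simp: mem_Fl_iff)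
  have low: "psi (y d) - c d \<in> below d" for d
    unfolding c_def using skew_proj_diff_supp[OF yb[of d]] by (rule skew_supp_mono) simp
  have xc: "x d = cls d (c d)" for d
    unfolding y(2) by (rule cls_eqI[OF low])
  define S where "S = {d. x d \<noteq> cls d 0}"
  have S: "finite S" using x by (simp add: S_def carrier_Gr)
  \<comment> \<open>A component of degree d that lies in the zero coset also has degree below d.
    Hence only the finitely many indices in \<open>S\<close> contribute.\<close>
  have c0: "c d = 0" if "d \<notin> S" for d
  proof -
    have "c d - 0 \<in> below d"
      using that by (intro cls_eqD) (simp_all add: S_def xc c_def proj_carrier yA)
    then show ?thesis
      using skew_supp_inter_eq_0[OF _ proj_supp[OF yA], of d d "\<lambda>e. e < d"] by (simp add: c_def)
  qed
  have cs: "c d \<in> supp (\<lambda>e. e = d)" for d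
    unfolding c_def by (rule proj_supp[OF yA])
  have "skew_proj d (\<Sum>i\<in>S. c i) = c d" for d
    by (simp add: skew_proj_simps skew_proj_supp_eq[OF cs] S c0)
  then have "symb (\<Sum>i\<in>S. c i) = x"
    by (simp add: symb_def fun_eq_iff xc)
  moreover have "(\<Sum>i\<in>S. c i) \<in> carrier A"
    using cs supp_carrier by (intro carrier_A_closed(6)) blast
  ultimately show ?thesis by blast
qed

lemma symb_inj: "a \<in> carrier A \<Longrightarrow> b \<in> carrier A \<Longrightarrow> symb a = symb b \<Longrightarrow> a = b"
proof (rule skew_proj_eqI)
  fix d
  assume ab: "a \<in> carrier A" "b \<in> carrier A" "symb a = symb b"
  then have "skew_proj d a - skew_proj d b \<in> below d"
    by (intro cls_eqD proj_carrier) (simp_all add: symb_def fun_eq_iff)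
  moreover have "skew_proj d a - skew_proj d b \<in> supp (\<lambda>e. e = d)"
    using ab by (intro skew_supp_diff proj_supp)
  ultimately have "skew_proj d a - skew_proj d b = 0"
    by (rule skew_supp_inter_eq_0) simp
  then show "skew_proj d a = skew_proj d b" by simp
qed

lemma proj_mult:
  assumes a: "a \<in> carrier A" and b: "b \<in> carrier A"
  shows "skew_proj d (a \<otimes>\<^bsub>A\<^esub> b) = (\<Sum>i\<le>d. skew_proj i a \<otimes>\<^bsub>A\<^esub> skew_proj (d - i) b)"
proof -
  obtain N1 N2 where "a \<in> below N1" "b \<in> below N2"
    using a b skew_supp_bounded unfolding carrier_A by metis
  \<comment> \<open>Bounds the degrees of \<open>a\<close> and \<open>b\<close> and also exceeds d,
    so that the box of indices contains the whole antidiagonal \<open>i + j = d\<close>.\<close>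
  define N where "N = Suc d + N1 + N2"
  have aN: "a \<in> below N" and bN: "b \<in> below N"
    using \<open>a \<in> below N1\<close> \<open>b \<in> below N2\<close> by (auto simp: N_def elim!: skew_supp_mono)
  let ?m = "\<lambda>i j. \<mu> 0 (skew_proj i a) (skew_proj j b)"
  have m: "?m i j \<in> supp (\<lambda>e. e = i + j)" for i j
    using mu_graded[OF proj_supp[OF a] proj_supp[OF b], of 0 i j] by simp
  have "a \<otimes>\<^bsub>A\<^esub> b = \<mu> 0 (\<Sum>i<N. skew_proj i a) (\<Sum>j<N. skew_proj j b)"
    using a b by (simp add: sum_skew_proj[OF aN] sum_skew_proj[OF bN] mu_0)
  also have "\<dots> = (\<Sum>i<N. \<Sum>j<N. ?m i j)"
    using proj_carrier[OF a] proj_carrier[OF b] by (simp add: mu_sum carrier_A_closed) (rule sum.swap)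
  finally have "skew_proj d (a \<otimes>\<^bsub>A\<^esub> b) = (\<Sum>i<N. \<Sum>j<N. if d = i + j then ?m i j else 0)"
    by (simp add: skew_proj_simps skew_proj_supp_eq[OF m])
  also have "\<dots> = (\<Sum>i<N. if i \<le> d then ?m i (d - i) else 0)"
  proof (intro sum.cong refl)
    fix i
    have "(\<Sum>j<N. if d = i + j then ?m i j else 0) = (\<Sum>j<N. if j = d - i then (if i \<le> d then ?m i j else 0) else 0)"
      by (intro sum.cong refl) auto
    also have "\<dots> = (if i \<le> d then ?m i (d - i) else 0)"
      by (subst sum.delta) (auto simp: N_def)
    finally show "(\<Sum>j<N. if d = i + j then ?m i j else 0) = (if i \<le> d then ?m i (d - i) else 0)" .
  qed
  also have "\<dots> = (\<Sum>i\<le>d. ?m i (d - i))"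
    by (rule sum.mono_neutral_cong_right) (auto simp: N_def)
  finally show ?thesis
    using a b by (simp add: mu_0 proj_carrier)
qed

text \<open>The product in \<open>Gr\<close> is a union over all families of representatives. Every
  family gives the same coset: replacing \<open>y (d - i)\<close> by its leading component, and then
  \<open>x i\<close> by its own, changes the product only below degree d. Such families exist, so
  the union is not empty.\<close>

lemma symb_mult:
  assumes a: "a \<in> carrier A" and b: "b \<in> carrier A"
  shows "symb (a \<otimes>\<^bsub>A\<^esub> b) = symb a \<otimes>\<^bsub>Gr\<^esub> symb b"
proof
  fix d
  have coset: "filt_below H Fl d +>\<^bsub>H\<^esub> (\<Oplus>\<^bsub>H\<^esub>i\<in>{..d}. x i \<otimes>\<^bsub>H\<^esub> y (d - i)) = symb (a \<otimes>\<^bsub>A\<^esub> b) d"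
    if x: "x \<in> Pi UNIV (symb a)" and y: "y \<in> Pi UNIV (symb b)" for x y
  proof -
    have xH: "x i \<in> carrier H" and xl: "psi (x i) - skew_proj i a \<in> below i" for i
      using x by (auto simp: symb_def cls_def Pi_def)
    have yH: "y i \<in> carrier H" and yl: "psi (y i) - skew_proj i b \<in> below i" for i
      using y by (auto simp: symb_def cls_def Pi_def)
    have "circ (psi (x i)) (psi (y (d - i))) - (skew_proj i a \<otimes>\<^bsub>A\<^esub> skew_proj (d - i) b) \<in> below d"
      if "i \<le> d" for i
    proof -
      let ?x = "psi (x i)" and ?y = "psi (y (d - i))" and ?a = "skew_proj i a" and ?b = "skew_proj (d - i) b"
      have xA: "?x \<in> carrier A" and yA: "?y \<in> carrier A"
        using psi_simps(1) xH yH by auto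
      \<comment> \<open>\<open>circ_filtered\<close> needs a bound on the representative itself, not
        only on its distance from the leading component.\<close>
      have "?x - ?a + ?a \<in> below (Suc i)"
        by (intro skew_supp_add proj_below a skew_supp_mono[OF xl]) simp
      then have "circ ?x (?y - ?b) \<in> below d"
        using circ_filtered(1)[OF _ yl[of "d - i"], of ?x "Suc i"] that by (auto elim!: skew_supp_mono)
      moreover have "circ ?x ?b - (?a \<otimes>\<^bsub>A\<^esub> ?b) \<in> below (i + (d - i))"
        by (intro circ_lead xl proj_below a b)
      ultimately have "circ ?x (?y - ?b) + (circ ?x ?b - (?a \<otimes>\<^bsub>A\<^esub> ?b)) \<in> below d"
        using that by (intro skew_supp_add) simp_all
      then show ?thesis
        using xA yA proj_carrier[OF b] by (simp add: circ_diff)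
    qed
    then have "(\<Sum>i\<le>d. circ (psi (x i)) (psi (y (d - i))) - (skew_proj i a \<otimes>\<^bsub>A\<^esub> skew_proj (d - i) b)) \<in> below d"
      by (intro skew_supp_sum) simp
    then have "psi (\<Oplus>\<^bsub>H\<^esub>i\<in>{..d}. x i \<otimes>\<^bsub>H\<^esub> y (d - i)) - skew_proj d (a \<otimes>\<^bsub>A\<^esub> b) \<in> below d"
      by (simp add: psi_finsum xH yH psi_simps proj_mult[OF a b] sum_subtractf)
    then show ?thesis
      using xH yH by (simp add: filt_coset symb_def cls_eqI)
  qed
  obtain x where x: "\<And>d. x d \<in> symb a d"
    using cls_nonempty[OF proj_carrier[OF a]] choice[of "\<lambda>d x. x \<in> symb a d"] unfolding symb_def by blast
  obtain y where y: "\<And>d. y d \<in> symb b d"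
    using cls_nonempty[OF proj_carrier[OF b]] choice[of "\<lambda>d x. x \<in> symb b d"] unfolding symb_def by blast
  have "(symb a \<otimes>\<^bsub>Gr\<^esub> symb b) d = (\<Union>x\<in>Pi UNIV (symb a). \<Union>y\<in>Pi UNIV (symb b).
      filt_below H Fl d +>\<^bsub>H\<^esub> (\<Oplus>\<^bsub>H\<^esub>i\<in>{..d}. x i \<otimes>\<^bsub>H\<^esub> y (d - i)))"
    by (simp add: assoc_graded_def Let_def)
  also have "\<dots> = (\<Union>x\<in>Pi UNIV (symb a). \<Union>y\<in>Pi UNIV (symb b). symb (a \<otimes>\<^bsub>A\<^esub> b) d)"
    by (intro SUP_cong refl coset)
  also have "\<dots> = symb (a \<otimes>\<^bsub>A\<^esub> b) d"
  proof -
    have "Pi UNIV (symb a) \<noteq> {}" "Pi UNIV (symb b) \<noteq> {}" using x y by blast+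
    then show ?thesis by simp
  qed
  finally show "symb (a \<otimes>\<^bsub>A\<^esub> b) d = (symb a \<otimes>\<^bsub>Gr\<^esub> symb b) d" by simp
qed

lemma symb_iso: "symb \<in> alg_iso A Gr"
proof -
  have "symb \<in> ring_iso A Gr"
  proof (rule ring_iso_memI)
    show "symb x \<in> carrier Gr" if "x \<in> carrier A" for x
      using that by (rule symb_carrier)
    show "symb (x \<otimes>\<^bsub>A\<^esub> y) = symb x \<otimes>\<^bsub>Gr\<^esub> symb y" if "x \<in> carrier A" "y \<in> carrier A" for x y
      using that by (rule symb_mult)
    show "symb (x \<oplus>\<^bsub>A\<^esub> y) = symb x \<oplus>\<^bsub>Gr\<^esub> symb y" if "x \<in> carrier A" "y \<in> carrier A" for x y
      using that by (simp add: assoc_graded_def Let_def symb_def fun_eq_iff skew_proj_simps cls_add proj_carrier)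
    have "unit \<in> supp (\<lambda>e. e = 0)"
      by (rule skew_monom_supp) (simp_all add: mon_degree_eq_0_iff)
    then show "symb \<one>\<^bsub>A\<^esub> = \<one>\<^bsub>Gr\<^esub>"
      by (simp add: assoc_graded_def Let_def symb_def fun_eq_iff skew_proj_supp_eq filt_coset psi_simps psi_zero)
    show "bij_betw symb (carrier A) (carrier Gr)"
      unfolding bij_betw_def
    proof (intro conjI inj_onI equalityI subsetI)
      show "x = y" if "x \<in> carrier A" "y \<in> carrier A" "symb x = symb y" for x y
        using that by (rule symb_inj)
      show "x \<in> carrier Gr" if "x \<in> symb ` carrier A" for x
        using that symb_carrier by (elim imageE) simp
      show "x \<in> symb ` carrier A" if "x \<in> carrier Gr" for x
        using symb_surj[OF that] by (elim bexE) (rule image_eqI, rule sym)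
    qed
  qed
  moreover have "symb (c \<odot>\<^bsub>A\<^esub> a) = c \<odot>\<^bsub>Gr\<^esub> symb a" if a: "a \<in> carrier A" for c a
  proof
    fix d
    have "filt_below H Fl d +>\<^bsub>H\<^esub> (c \<odot>\<^bsub>H\<^esub> x) = cls d (skew_scale c (skew_proj d a))" if "x \<in> symb a d" for x
    proof -
      have x: "x \<in> carrier H" "psi x - skew_proj d a \<in> below d" using that by (auto simp: symb_def cls_def)
      then have "cls d (psi (c \<odot>\<^bsub>H\<^esub> x)) = cls d (skew_scale c (skew_proj d a))"
        using skew_supp_scale[OF x(2), of c] by (intro cls_eqI) (simp add: psi_simps skew.scale_right_diff_distrib)
      then show ?thesis using x by (simp add: filt_coset H_smult_closed)
    qed
    moreover have "symb a d \<noteq> {}"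
      using cls_nonempty[OF proj_carrier[OF a]] unfolding symb_def by blast
    ultimately have "(\<Union>x\<in>symb a d. filt_below H Fl d +>\<^bsub>H\<^esub> (c \<odot>\<^bsub>H\<^esub> x)) = cls d (skew_scale c (skew_proj d a))"
      by (intro SUP_eq_const)
    then show "symb (c \<odot>\<^bsub>A\<^esub> a) d = (c \<odot>\<^bsub>Gr\<^esub> symb a) d"
      by (simp add: assoc_graded_def Let_def symb_def skew_proj_simps)
  qed
  ultimately show ?thesis by (simp add: alg_iso_def)
qed

lemma symb_component: "symb ` skew_component G Basis d = assoc_graded_component H Fl d"
proof (intro equalityI subsetI)
  fix x assume "x \<in> symb ` skew_component G Basis d"
  then obtain a where a: "a \<in> supp (\<lambda>e. e = d)" "x = symb a"
    by (auto simp: skew_component_eq_supp)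
  then show "x \<in> assoc_graded_component H Fl d"
    using symb_carrier[OF supp_carrier[OF a(1)]]
    by (auto simp: assoc_graded_component_def symb_def filt_below_cls skew_proj_supp_eq)
next
  fix x assume x: "x \<in> assoc_graded_component H Fl d"
  then have "x \<in> carrier Gr" by (simp add: assoc_graded_component_def)
  from symb_surj[OF this] obtain a where a: "a \<in> carrier A" "symb a = x" by (elim bexE)
  \<comment> \<open>The coset in degree e is zero, so this component has degree e and degree below e
    at once.\<close>
  have "skew_proj e a = 0" if "e \<noteq> d" for e
  proof (rule skew_supp_inter_eq_0[OF _ proj_supp[OF a(1)]])
    have "x e = filt_below H Fl e" using x that by (simp add: assoc_graded_component_def)
    then have "cls e (skew_proj e a) = cls e 0"
      unfolding a(2)[symmetric] by (simp add: symb_def filt_below_cls)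
    then show "skew_proj e a \<in> below e"
      using cls_eqD[OF proj_carrier[OF a(1)], of e e 0] by simp
  qed simp
  then have "skew_proj e a = skew_proj e (skew_proj d a)" for e
    by (simp add: skew_proj_supp_eq[OF proj_supp[OF a(1)]])
  then have "a = skew_proj d a" by (rule skew_proj_eqI)
  then have "a \<in> skew_component G Basis d"
    using proj_supp[OF a(1), of d] by (simp add: skew_component_eq_supp)
  then show "x \<in> symb ` skew_component G Basis d"
    using a(2) by blast
qed

text \<open>\<open>graded_alg_isomorphic\<close> is used in the direction from the associated graded
  algebra to \<open>A\<close>, so the symbol map is inverted; its injectivity carries the components
  back.\<close>

lemma PBW: "exhibits_PBW G scale Basis \<rho> lam kap"
proof -
  have "inv_into (carrier A) symb \<in> alg_iso Gr A"
    by (rule alg_iso_inv_into[OF ring_A symb_iso]) (simp add: carrier_A_closed)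
  moreover have "inv_into (carrier A) symb ` assoc_graded_component H Fl d = skew_component G Basis d" for d
    unfolding symb_component[symmetric]
    by (rule inv_into_image_cancel) (auto intro: inj_onI symb_inj skew_component_subset[THEN subsetD])
  ultimately show ?thesis
    unfolding exhibits_PBW_def graded_alg_isomorphic_def Let_def by blast
qed

lemma fiber_isomorphic_H: "alg_isomorphic (fiber_at_one A \<mu>) H"
proof (rule alg_isomorphic_trans[OF fiber_isomorphic_B])
  show "alg_isomorphic B H"
  proof (rule alg_isomorphic_sym[OF ring_H])
    show "alg_isomorphic H B"
      unfolding alg_isomorphic_def using psi_iso by blast
  qed (rule H_smult_closed)
qed

end

theorem theorem6p11:
  fixes scale :: "'k::field \<Rightarrow> 'v::ab_group_add \<Rightarrow> 'v"
    and Basis :: "'v set"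
    and G :: "'g monoid"
    and \<rho> :: "'g \<Rightarrow> 'v \<Rightarrow> 'v"
    and \<mu> :: "nat \<Rightarrow> ('g, 'v, 'k) skew \<Rightarrow> ('g, 'v, 'k) skew \<Rightarrow> ('g, 'v, 'k) skew"
    and lam :: "('g \<Rightarrow>\<^sub>0 'k) \<Rightarrow> 'v \<Rightarrow> ('g \<Rightarrow>\<^sub>0 'k)"
    and kap :: "'v \<Rightarrow> 'v \<Rightarrow> ('g \<Rightarrow>\<^sub>0 'k)"
  assumes "finite_dimensional_vector_space scale Basis"
    and "group G" and "finite (carrier G)"
    and "group_action G UNIV \<rho>"
    and "\<And>g. g \<in> carrier G \<Longrightarrow> Vector_Spaces.linear scale scale (\<rho> g)"
    and "graded_deformation (skew_group_alg G scale Basis \<rho>) (skew_component G Basis) \<mu>"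
    and "\<And>v w. \<mu> 1 (skew_vec G scale Basis v) (skew_vec G scale Basis w) = 0"
    and "H_parameters G scale lam kap"
    and "\<And>g v. g \<in> carrier G \<Longrightarrow>
      skew_of_group_alg (lam (group_elt g) v) =
        \<mu> 1 (skew_of_group_alg (group_elt g)) (skew_vec G scale Basis v) -
        \<mu> 1 (skew_vec G scale Basis (\<rho> g v)) (skew_of_group_alg (group_elt g))"
    and "\<And>v w. skew_of_group_alg (kap v w) =
        \<mu> 2 (skew_vec G scale Basis v) (skew_vec G scale Basis w) -
        \<mu> 2 (skew_vec G scale Basis w) (skew_vec G scale Basis v)"
  shows "exhibits_PBW G scale Basis \<rho> lam kap \<and>
    alg_isomorphic (fiber_at_one (skew_group_alg G scale Basis \<rho>) \<mu>)
      (H_alg G scale Basis \<rho> lam kap)"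
proof -
  interpret deformed_skew_parameters scale Basis G \<rho> \<mu> lam kap
    by (intro deformed_skew_parameters.intro deformed_skew.intro deformed_skew_parameters_axioms.intro)
      (fact assms)+
  show ?thesis
    using PBW fiber_isomorphic_H ..
qed

end
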